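(* Let $\varphi:\mathbb N\to\mathbb R^+$ satisfy $\sum_{k\ge0}\varphi(k)=1$ and $\sum_{k\ge0}k\varphi(k)<\infty$, and put $\phi(x):=\sum_{k=x}^\infty\varphi(k)$. 1. (a) For all $n\ge0$ and all $\Lambda_n\in\mathcal F_n$, $$\lim_{p\to\infty}\frac{\mathbb E[\mathbf 1_{\Lambda_n}\varphi(S_{g_p})]}{\mathbb E[\varphi(S_{g_p})]}=\mathbb E[\mathbf 1_{\Lambda_n}M_n],\qquad M_n:=\tfrac12\varphi(S_{g_n})|X_n|+\varphi(S_n)(S_n-X_n^+)+\phi(S_n).$$ (b) $(M_n,n\ge0)$ is a positive $(\mathcal F_n)$-martingale under $\mathbb P$ which is not uniformly integrable. 2. Let $Q$ be the probability on $(\Omega,\mathcal F_\infty)$ characterized by $Q(\Lambda_n)=\mathbb E[\mathbf 1_{\Lambda_n}M_n]$ for all $n\ge0$, $\Lambda_n\in\mathcal F_n$. Then: (a) with $g:=\sup\{k\ge0:X_k=0\}$, one has $Q(0\le g<\infty)=1$; (b) with $S_\infty:=\sup_{k\ge0}X_k$, one has $Q(S_\infty=\infty)=\frac12$ and, for all $k\in\mathbb N$, $Q(S_\infty=k\mid S_\infty<\infty)=\varphi(k)$; (c) for all integers $a\ge1$, $k\ge0$, $$Q(\gamma_g=a,S_g=k)=\begin{cases}\left(\frac12\right)^a\varphi(0)&\text{if }k=0,\\ \frac12\left\{\left(1-\frac1{2(k+1)}\right)^{a-1}-\left(1-\frac1{2k}\right)^{a-1}\right\}\varphi(k)&\text{if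 }k\ge1;\end{cases}$$ in particular $Q(S_g=k)=\varphi(k)$ for all $k\in\mathbb N$. 3. Under $Q$: (a) $(X_n,n\le g)$ and $(X_n,n>g)$ are two independent processes; (b) with probability $\frac12$ the process $(X_{g+n},n\ge1)$ is a 3-Bessel* walk started from $1$, and with probability $\frac12$ the process $(-X_{g+n},n\ge1)$ is a 3-Bessel* walk started from $1$ (that is, $Q(X_{g+1}=1)=Q(X_{g+1}=-1)=\frac12$, and conditionally on $X_{g+1}=1$, resp. $X_{g+1}=-1$, the process $(X_{g+n},n\ge1)$, resp. $(-X_{g+n},n\ge1)$, is a 3-Bessel* walk started from $1$); (c) conditionally on $\gamma_g=a$ and $S_g=b$, the process $(X_n,n\le g)$ is distributed as the symmetric random walk started from $0$ (law $\mathbb P$), stopped at $\tau_a$ and conditioned on $S_{\tau_a}=b$.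
   Context: $\mathbb N=\{0,1,2,\dots\}$. $\Omega$ is the set of paths $\omega:\mathbb N\to\mathbb Z$ with $|\omega(n+1)-\omega(n)|=1$; $X=(X_n)_{n\ge0}$ is the coordinate process, $\mathcal F_n=\sigma(X_0,\dots,X_n)$, $\mathcal F_\infty=\bigvee_n\mathcal F_n$. $\mathbb P=\mathbb P_0$ is the law under which $X$ is the simple symmetric random walk on $\mathbb Z$ started from $0$, with expectation $\mathbb E$. $S_n:=\max_{0\le k\le n}X_k$; $x^+:=\max(x,0)$; $g_p:=\sup\{k\le p:X_k=0\}$; $\gamma_n:=\sum_{k=0}^n\mathbf 1_{X_k=0}$ (time $0$ is counted); $\tau_a:=\inf\{n\ge0:\gamma_n=a\}$. "Positive" means nonnegative. $(X_n,n>g)$ is understood as the process $(X_{g+n})_{n\ge1}$. Conditional statements are for conditioning events of positive probability. The 3-Bessel* walk is the Markov chain on $\{1,2,\dots\}$ with transition probabilities $\pi^*(x,x+1)=\frac{x+1}{2x}$, $\pi^*(x,x-1)=\frac{x-1}{2x}$ for $x\ge1$. *)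

theory Defs
  imports "HOL-Probability.Probability"
begin

section \<open>Path space\<close>

text \<open>The coordinate process is evaluation: \<open>X\<^sub>n(\<omega>) = \<omega> n\<close>.\<close>

definition paths :: "(nat \<Rightarrow> int) set" where
  "paths = {\<omega>. \<forall>n. \<bar>\<omega> (Suc n) - \<omega> n\<bar> = 1}"

definition Fil :: "nat \<Rightarrow> (nat \<Rightarrow> int) measure" where
  "Fil n = sigma paths {{\<omega> \<in> paths. \<omega> k \<in> A} | k A. k \<le> n}"

definition Fil_inf :: "(nat \<Rightarrow> int) measure" where
  "Fil_inf = sigma paths (\<Union>n. sets (Fil n))"

definition walk :: "(nat \<Rightarrow> int) measure" where
  "walk = distr (\<Pi>\<^sub>M i\<in>(UNIV::nat set). uniform_count_measure {-1, 1::int}) Fil_inf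
            (\<lambda>\<xi> n. \<Sum>k<n. \<xi> k)"

section \<open>Path functionals\<close>

definition Smax :: "nat \<Rightarrow> (nat \<Rightarrow> int) \<Rightarrow> int" where
  "Smax n \<omega> = Max (\<omega> ` {0..n})"

definition Sinf :: "(nat \<Rightarrow> int) \<Rightarrow> ereal" where
  "Sinf \<omega> = (SUP k. ereal (real_of_int (\<omega> k)))"

text \<open>The set below contains \<open>0\<close> whenever \<open>\<omega> 0 = 0\<close>, i.e. almost surely; otherwise it may be
  empty, with supremum \<open>0\<close> in \<^typ>\<open>nat\<close>.\<close>

definition last_zero_upto :: "nat \<Rightarrow> (nat \<Rightarrow> int) \<Rightarrow> nat" where
  "last_zero_upto p \<omega> = Sup {k. k \<le> p \<and> \<omega> k = 0}"

text \<open>In \<^typ>\<open>ereal\<close> the supremum is \<open>-\<infinity>\<close> for a path without zeros and \<open>\<infinity>\<close> for a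
  path with infinitely many zeros.\<close>

definition last_zero :: "(nat \<Rightarrow> int) \<Rightarrow> ereal" where
  "last_zero \<omega> = (SUP k\<in>{k. \<omega> k = 0}. ereal (real k))"

text \<open>\<^const>\<open>last_zero\<close> as a time index; it has the arbitrary value \<open>0\<close> where
  \<^const>\<open>last_zero\<close> is infinite.\<close>

definition last_zero_time :: "(nat \<Rightarrow> int) \<Rightarrow> nat" where
  "last_zero_time \<omega> = nat \<lfloor>real_of_ereal (last_zero \<omega>)\<rfloor>"

definition zeros :: "nat \<Rightarrow> (nat \<Rightarrow> int) \<Rightarrow> nat" where
  "zeros n \<omega> = card {k. k \<le> n \<and> \<omega> k = 0}"

definition tau :: "nat \<Rightarrow> (nat \<Rightarrow> int) \<Rightarrow> enat" where
  "tau a \<omega> = (INF n\<in>{n. zeros n \<omega> = a}. enat n)"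

text \<open>The process \<open>(X\<^sub>n, n \<le> t)\<close> up to a finite random time \<open>t\<close>, with its lifetime,
  as the list \<open>[X\<^sub>0, \<dots>, X\<^sub>t]\<close>.\<close>

definition path_upto :: "nat \<Rightarrow> (nat \<Rightarrow> int) \<Rightarrow> int list" where
  "path_upto t \<omega> = map \<omega> [0..<Suc t]"

section \<open>The martingale and the penalised measure\<close>

definition tail :: "(nat \<Rightarrow> real) \<Rightarrow> nat \<Rightarrow> real" where
  "tail \<phi> x = (\<Sum>k. \<phi> (x + k))"

text \<open>The truncation \<^const>\<open>nat\<close> only affects paths with \<open>\<omega> 0 < 0\<close>, a null set.\<close>

definition Mart :: "(nat \<Rightarrow> real) \<Rightarrow> nat \<Rightarrow> (nat \<Rightarrow> int) \<Rightarrow> real" where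
  "Mart \<phi> n \<omega> =
     1/2 * \<phi> (nat (Smax (last_zero_upto n \<omega>) \<omega>)) * \<bar>real_of_int (\<omega> n)\<bar>
     + \<phi> (nat (Smax n \<omega>)) * real_of_int (Smax n \<omega> - max (\<omega> n) 0)
     + tail \<phi> (nat (Smax n \<omega>))"

definition is_penalised :: "(nat \<Rightarrow> real) \<Rightarrow> (nat \<Rightarrow> int) measure \<Rightarrow> bool" where
  "is_penalised \<phi> Q \<longleftrightarrow>
     prob_space Q \<and> sets Q = sets Fil_inf \<and>
     (\<forall>n. \<forall>\<Lambda>\<in>sets (Fil n).
        measure Q \<Lambda> = (\<integral>\<omega>. indicator \<Lambda> \<omega> * Mart \<phi> n \<omega> \<partial>walk))"

section \<open>Independence, martingales, uniform integrability, Markov chains\<close>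

text \<open>The library's \<^const>\<open>prob_space.indep_var\<close>, but for random elements whose value types may
  differ.\<close>

definition indep_elements ::
    "'a measure \<Rightarrow> 'b measure \<Rightarrow> ('a \<Rightarrow> 'b) \<Rightarrow> 'c measure \<Rightarrow> ('a \<Rightarrow> 'c) \<Rightarrow> bool" where
  "indep_elements R S Y T Z \<longleftrightarrow>
     Y \<in> measurable R S \<and> Z \<in> measurable R T \<and>
     prob_space.indep_set R (sets (vimage_algebra (space R) Y S))
                            (sets (vimage_algebra (space R) Z T))"

definition martingale ::
    "'a measure \<Rightarrow> (nat \<Rightarrow> 'a measure) \<Rightarrow> (nat \<Rightarrow> 'a \<Rightarrow> real) \<Rightarrow> bool" where
  "martingale P F M \<longleftrightarrow>
     filtration (space P) F \<and> (\<forall>n. subalgebra P (F n)) \<and>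
     (\<forall>n. M n \<in> borel_measurable (F n)) \<and>
     (\<forall>n. integrable P (M n)) \<and>
     (\<forall>m n. m \<le> n \<longrightarrow> (AE \<omega> in P. real_cond_exp P (F m) (M n) \<omega> = M m \<omega>))"

definition uniformly_integrable :: "'a measure \<Rightarrow> (nat \<Rightarrow> 'a \<Rightarrow> real) \<Rightarrow> bool" where
  "uniformly_integrable P M \<longleftrightarrow>
     ((\<lambda>K::real. SUP n. \<integral>\<^sup>+\<omega>. ennreal \<bar>M n \<omega>\<bar> * indicator {\<omega>. K \<le> \<bar>M n \<omega>\<bar>} \<omega> \<partial>P)
        \<longlongrightarrow> 0) at_top"

text \<open>A Markov chain \<open>Y\<close> with state space \<open>E\<close> and transition probabilities \<open>\<pi>\<close>, started
  from \<open>x\<close>.  Only the values of \<open>\<pi>\<close> on \<open>E \<times> E\<close> matter.\<close>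

definition markov_chain_from ::
    "'a measure \<Rightarrow> int set \<Rightarrow> (int \<Rightarrow> int \<Rightarrow> real) \<Rightarrow> int \<Rightarrow> (nat \<Rightarrow> 'a \<Rightarrow> int) \<Rightarrow> bool" where
  "markov_chain_from R E \<pi> x Y \<longleftrightarrow>
     prob_space R \<and>
     (\<forall>n. Y n \<in> measurable R (count_space UNIV)) \<and>
     (AE \<omega> in R. \<forall>n. Y n \<omega> \<in> E) \<and>
     (AE \<omega> in R. Y 0 \<omega> = x) \<and>
     (\<forall>n. \<forall>y::nat \<Rightarrow> int. \<forall>z\<in>E.
        \<P>(\<omega> in R. \<forall>i\<le>n. Y i \<omega> = y i) > 0 \<longrightarrow>
        cond_prob R (\<lambda>\<omega>. Y (Suc n) \<omega> = z) (\<lambda>\<omega>. \<forall>i\<le>n. Y i \<omega> = y i) = \<pi> (y n) z)"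

definition bessel_star :: "int \<Rightarrow> int \<Rightarrow> real" where
  "bessel_star x y =
     (if y = x + 1 then (real_of_int x + 1) / (2 * real_of_int x)
      else if y = x - 1 then (real_of_int x - 1) / (2 * real_of_int x)
      else 0)"

definition bessel_star_walk_from_1 :: "'a measure \<Rightarrow> (nat \<Rightarrow> 'a \<Rightarrow> int) \<Rightarrow> bool" where
  "bessel_star_walk_from_1 R Y \<longleftrightarrow> markov_chain_from R {1..} bessel_star 1 Y"

end

theory Submission
  imports Defs "HOL-Real_Asymp.Real_Asymp"
begin

text \<open>
  All path functionals are functions of the history of the path, so everything reduces to the
  operator \<open>avg n h f\<close>, the mean of \<open>f\<close> over \<open>n\<close> fair steps continuing the history \<open>h\<close>.

  Reflecting at the first visit to \<open>j\<close>, the event that the walk reaches \<open>j\<close> and then returns to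
  \<open>0\<close> by time \<open>q\<close> has the probability of reaching \<open>2 j\<close> by time \<open>q\<close>.  Hence the mean of
  \<open>\<phi>(S\<^bsub>g\<^esub>)\<close> is an explicit combination of tails of the maximum \<open>S\<^sub>q\<close>, and since
  \<open>P(S\<^sub>q = y) / P(S\<^sub>q = 0)\<close> is at most \<open>1\<close> and tends to \<open>1\<close>, division by \<open>P(S\<^sub>q = 0)\<close> and
  dominated convergence give the limit \<open>2 M\<close>.

  On paths that avoid \<open>0\<close> after time \<open>k\<close> only the term \<open>\<phi>(S\<^bsub>g\<^esub>) \<bar>X\<bar> / 2\<close> of \<open>M\<close> survives as
  time grows, and \<open>\<bar>x\<bar>\<close> is harmonic for the walk killed at \<open>0\<close>.  So a path \<open>w\<close> up to the last zero
  followed by \<open>v\<close> has \<open>Q\<close>-probability equal to that of \<open>w\<close> under the walk times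
  \<open>\<phi>(max w) / 2\<close> times the \<open>\<bar>x\<bar>\<close>-transform of \<open>v\<close>: this product gives the independence, the
  3-Bessel* walks and the conditional law up to the last zero.  The law of \<open>S\<close> at the \<open>a\<close>-th zero
  under the walk comes from gambler's ruin; it shows that these weights sum to \<open>1\<close>, that is, that
  the last zero is finite.
\<close>

section \<open>The maximum of the simple random walk\<close>

text \<open>The last zero is not a stopping time, so the strong Markov property says nothing about
  it. Countability takes its place: the events that a given finite history ends at the last zero are
  disjoint and each has an explicit probability. Once these are known to sum to 1, every statement
  about the last zero is a sum over histories. The limit 2 M carries the factor 2 only because
  \<open>maxp q 0\<close> is the normalisation; since M is 1 at time 0, the factor cancels in the
  quotient. The one-step relation for M need not be checked by hand, as it is inherited from the
  quotients whose limit M is. The moment condition on \<phi> enters through the term \<phi>(S) (S -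
  X^+): it makes all of M except the term with \<bar>X\<bar> bounded, hence negligible on an event
  whose probability under the walk vanishes. The law Q is constructed on an infinite product space
  by driving a path with independent inputs. The plain walk arises in the same way, so both laws are
  instances of one locale and differ only in the weight attached to a history.\<close>

definition maxp :: "nat \<Rightarrow> nat \<Rightarrow> real" where
  "maxp q y = real (q choose ((q + y + 1) div 2)) / 2 ^ q"

text \<open>\<open>surv q y\<close> is the probability that S_q < y, or equally that a walk at
  distance y from a level misses it for q steps. The argument is an integer so that distances such
  as 2 j - x can be inserted directly; for y \<le> 0 the level counts as reached and the value is
  0.\<close>

definition surv :: "nat \<Rightarrow> int \<Rightarrow> real" where
  "surv q y = (\<Sum>i<nat y. maxp q i)"

lemma maxp_nonneg: "maxp q y \<ge> 0"
  by (simp add: maxp_def)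

lemma maxp_0: "maxp 0 y = (if y = 0 then 1 else 0)"
  by (auto simp: maxp_def)

text \<open>First-step analysis of the event S_{q+1} = 0: the first step goes down, and the
  remaining walk rises by at most 1.\<close>

lemma maxp_Suc_0: "maxp (Suc q) 0 = (maxp q 0 + maxp q 1) / 2"
proof -
  have "q choose ((q + 1) div 2) = q choose (q div 2)"
    by (subst binomial_symmetric) (auto intro!: arg_cong2[where f = binomial])
  then show ?thesis
    by (simp add: maxp_def field_simps)
qed

lemma maxp_Suc_Suc: "maxp (Suc q) (Suc y) = (maxp q y + maxp q (y + 2)) / 2"
proof -
  have "(Suc q + Suc y + 1) div 2 = Suc ((q + y + 1) div 2)" "(q + (y + 2) + 1) div 2 = Suc ((q + y + 1) div 2)"
    by simp_all
  then show ?thesis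
    by (simp add: maxp_def field_simps)
qed

lemma maxp_antimono_Suc: "maxp q (Suc y) \<le> maxp q y"
proof (induction q arbitrary: y)
  case 0
  then show ?case by (simp add: maxp_0)
next
  case (Suc q)
  show ?case
  proof (cases y)
    case 0
    then show ?thesis using Suc[of 1] by (simp add: maxp_Suc_0 maxp_Suc_Suc numeral_2_eq_2)
  next
    case (Suc z)
    then show ?thesis using Suc.IH[of z] Suc.IH[of "z + 2"] by (simp add: maxp_Suc_Suc)
  qed
qed

lemma maxp_le_0: "maxp q y \<le> maxp q 0"
  by (induction y) (auto intro: order_trans[OF maxp_antimono_Suc])

lemma maxp_0_pos: "maxp q 0 > 0"
  by (simp add: maxp_def zero_less_binomial)

text \<open>For q + y even, consecutive binomial coefficients give (q + y + 2)
  \<open>maxp q (Suc y)\<close> = (q - y) \<open>maxp q y\<close>; for q + y odd the two values of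
  \<open>maxp\<close> coincide. The inequality weakens both relations to one form free of parity,
  and its coefficients still have ratio tending to 1.\<close>

lemma maxp_ratio_Suc:
  "(real q - real y - 1) * maxp q y \<le> (real q + real y + 3) * maxp q (Suc y)"
proof (cases "q \<le> y + 1")
  case True
  then show ?thesis
    by (intro order.trans[OF mult_nonpos_nonneg mult_nonneg_nonneg]) (auto simp: maxp_nonneg)
next
  case False
  show ?thesis
  proof (cases "even (q + y)")
    case True
    define i where "i = (q + y) div 2"
    have qy: "q + y = 2 * i" using True by (auto simp: i_def)
    have e: "(q + y + 1) div 2 = i" "(q + Suc y + 1) div 2 = Suc i" using qy by auto
    have iq: "i < q" using False qy by linarith
    have "Suc i * (q choose Suc i) = (q - i) * (q choose i)"
      using binomial_absorption[of i q] binomial_absorb_comp[of q i] by (rule trans[OF _ sym])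
    then have "real (Suc i) * real (q choose Suc i) = real (q - i) * real (q choose i)"
      by (simp only: of_nat_mult[symmetric])
    then have "real (2 * Suc i) * maxp q (Suc y) = real (2 * (q - i)) * maxp q y"
      unfolding maxp_def e of_nat_mult by (simp add: algebra_simps)
    moreover have "real q + real y = 2 * real i"
      by (metis of_nat_add of_nat_mult of_nat_numeral qy)
    then have "real (2 * Suc i) = real q + real y + 2" "real (2 * (q - i)) = real q - real y"
      using iq by (simp_all add: of_nat_diff)
    ultimately have *: "(real q + real y + 2) * maxp q (Suc y) = (real q - real y) * maxp q y" by (simp only:)
    show ?thesis using * maxp_nonneg[of q y] maxp_nonneg[of q "Suc y"] by (simp add: algebra_simps)
  next
    case False
    then have e: "(q + Suc y + 1) div 2 = (q + y + 1) div 2" by auto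
    then have "maxp q (Suc y) = maxp q y" by (simp add: maxp_def)
    then show ?thesis by (auto intro!: mult_right_mono simp: maxp_nonneg)
  qed
qed

section \<open>Asymptotics of the law of the maximum\<close>

lemma maxp_ratio_tendsto: "(\<lambda>q. maxp q y / maxp q 0) \<longlonglongrightarrow> 1"
proof (induction y)
  case 0
  then show ?case using maxp_0_pos by (simp add: less_imp_neq[symmetric])
next
  case (Suc y)
  have l: "(\<lambda>q. (real q - real y - 1) / (real q + real y + 3)) \<longlonglongrightarrow> 1"
    by real_asymp
  show ?case
  proof (rule tendsto_sandwich[OF _ _ _ tendsto_const])
    show "\<forall>\<^sub>F q in sequentially. (real q - real y - 1) / (real q + real y + 3) * (maxp q y / maxp q 0)
        \<le> maxp q (Suc y) / maxp q 0"
    proof (rule always_eventually, rule allI)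
      fix q
      have "(real q - real y - 1) / (real q + real y + 3) * maxp q y \<le> maxp q (Suc y)"
        using maxp_ratio_Suc[of q y] by (simp add: field_simps)
      then show "(real q - real y - 1) / (real q + real y + 3) * (maxp q y / maxp q 0)
        \<le> maxp q (Suc y) / maxp q 0"
        using maxp_0_pos[of q]
        by (metis divide_right_mono less_imp_le times_divide_eq_right)
    qed
    show "\<forall>\<^sub>F q in sequentially. maxp q (Suc y) / maxp q 0 \<le> 1"
      using maxp_0_pos maxp_le_0 by (intro always_eventually allI) (simp add: divide_le_eq_1)
    show "(\<lambda>q. (real q - real y - 1) / (real q + real y + 3) * (maxp q y / maxp q 0)) \<longlonglongrightarrow> 1"
      using tendsto_mult[OF l Suc] by simp
  qed
qed

lemma maxp_Suc_ratio_tendsto: "(\<lambda>q. maxp (Suc q) 0 / maxp q 0) \<longlonglongrightarrow> 1"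
proof -
  have "(\<lambda>q. (1 + maxp q 1 / maxp q 0) / 2) \<longlonglongrightarrow> (1 + 1) / 2"
    by (intro tendsto_intros maxp_ratio_tendsto) simp
  moreover have "(1 + maxp q 1 / maxp q 0) / 2 = maxp (Suc q) 0 / maxp q 0" for q
    using maxp_0_pos[of q] by (simp add: maxp_Suc_0 field_simps)
  ultimately show ?thesis by simp
qed

text \<open>Compares the normalisations of a numerator with q steps to go and a denominator with q +
  n steps.\<close>

lemma maxp_shift_ratio_tendsto: "(\<lambda>q. maxp q 0 / maxp (q + n) 0) \<longlonglongrightarrow> 1"
proof (induction n)
  case 0
  then show ?case using maxp_0_pos by (simp add: less_imp_neq[symmetric])
next
  case (Suc n)
  have "(\<lambda>q. maxp (Suc (q + n)) 0 / maxp (q + n) 0) \<longlonglongrightarrow> 1"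
    using LIMSEQ_ignore_initial_segment[OF maxp_Suc_ratio_tendsto, of n] .
  from tendsto_divide[OF Suc this]
  have "(\<lambda>q. maxp q 0 / maxp (q + n) 0 / (maxp (Suc (q + n)) 0 / maxp (q + n) 0)) \<longlonglongrightarrow> 1"
    by simp
  moreover have "(\<lambda>q. maxp q 0 / maxp (q + n) 0 / (maxp (Suc (q + n)) 0 / maxp (q + n) 0))
      = (\<lambda>q. maxp q 0 / maxp (q + Suc n) 0)"
  proof
    show "maxp q 0 / maxp (q + n) 0 / (maxp (Suc (q + n)) 0 / maxp (q + n) 0)
      = maxp q 0 / maxp (q + Suc n) 0" for q
      using maxp_0_pos[of "q + n"] by simp
  qed
  ultimately show ?case by (simp only:)
qed

lemma surv_nonpos: "y \<le> 0 \<Longrightarrow> surv q y = 0"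
  by (simp add: surv_def)

lemma surv_0: "y \<ge> 1 \<Longrightarrow> surv 0 y = 1"
  by (auto simp: surv_def maxp_0 sum.delta)

lemma surv_plus_1: "y \<ge> 0 \<Longrightarrow> surv q (y + 1) = surv q y + maxp q (nat y)"
  by (simp add: surv_def nat_add_distrib)

text \<open>The recursions of \<open>maxp\<close> summed over the levels below y; in probability
  terms, the first step of a walk at distance y. At y = 0 the relation fails, because a level that
  has been reached stays reached.\<close>

lemma surv_Suc:
  assumes "y \<ge> 1"
  shows "surv (Suc q) y = (surv q (y - 1) + surv q (y + 1)) / 2"
proof -
  have "surv (Suc q) (int z + 1) = (surv q (int z) + surv q (int z + 2)) / 2" for z
  proof (induction z)
    case 0
    then show ?case by (simp add: surv_def maxp_Suc_0 numeral_2_eq_2)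
  next
    case (Suc z)
    have "surv (Suc q) (int (Suc z) + 1) = surv (Suc q) (int z + 1) + maxp (Suc q) (Suc z)"
      using surv_plus_1[of "int z + 1" "Suc q"] by (simp add: nat_add_distrib algebra_simps)
    moreover have "surv q (int (Suc z)) = surv q (int z) + maxp q z"
      using surv_plus_1[of "int z" q] by (simp add: algebra_simps)
    moreover have "surv q (int (Suc z) + 2) = surv q (int z + 2) + maxp q (z + 2)"
      using surv_plus_1[of "int z + 2" q] by (simp add: nat_add_distrib algebra_simps)
    ultimately show ?case using Suc by (simp add: maxp_Suc_Suc field_simps)
  qed
  from this[of "nat (y - 1)"] assms show ?thesis by (simp add: algebra_simps)
qed

lemma surv_nonneg: "surv q y \<ge> 0"
  by (simp add: surv_def sum_nonneg maxp_nonneg)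

lemma surv_mono: "x \<le> y \<Longrightarrow> surv q x \<le> surv q y"
  unfolding surv_def by (intro sum_mono2) (auto simp: maxp_nonneg)

lemma surv_le_1: "surv q y \<le> 1"
proof (induction q arbitrary: y)
  case 0
  show ?case by (cases "y \<ge> 1") (auto simp: surv_0 surv_nonpos)
next
  case (Suc q)
  show ?case
    using Suc[of "y - 1"] Suc[of "y + 1"] by (cases "y \<ge> 1") (auto simp: surv_Suc surv_nonpos)
qed

text \<open>Supplies the dominating series for \<open>above\<close> after division by
  \<open>maxp q 0\<close>.\<close>

lemma surv_diff_le: "y \<ge> 0 \<Longrightarrow> surv q (y + 2) - surv q y \<le> 2 * maxp q 0"
  using surv_plus_1[of y q] surv_plus_1[of "y + 1" q] maxp_le_0[of q "nat y"] maxp_le_0[of q "nat (y + 1)"]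
  by (simp add: algebra_simps)

lemma surv_le: "y \<ge> 0 \<Longrightarrow> surv q y \<le> real_of_int y * maxp q 0"
  using sum_mono[of "{..<nat y}" "maxp q" "\<lambda>_. maxp q 0"] by (simp add: surv_def maxp_le_0)

lemma surv_ratio_tendsto:
  assumes "y \<ge> 0"
  shows "(\<lambda>q. surv q y / maxp q 0) \<longlonglongrightarrow> real_of_int y"
proof -
  have "(\<lambda>q. \<Sum>i<nat y. maxp q i / maxp q 0) \<longlonglongrightarrow> (\<Sum>i<nat y. 1)"
    by (intro tendsto_sum maxp_ratio_tendsto)
  then show ?thesis using assms by (simp add: surv_def sum_divide_distrib)
qed

text \<open>No Stirling formula is involved: \<open>surv q y\<close> behaves like y times
  \<open>maxp q 0\<close>, so a positive limit would push the probability \<open>surv q y\<close>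
  above 1 for large y.\<close>

lemma maxp_0_tendsto: "(\<lambda>q. maxp q 0) \<longlonglongrightarrow> 0"
proof -
  have "maxp (Suc q) 0 \<le> maxp q 0" for q
    using maxp_le_0[of q 1] by (simp add: maxp_Suc_0)
  then have "decseq (\<lambda>q. maxp q 0)" by (simp add: decseq_Suc_iff)
  then obtain l where l: "(\<lambda>q. maxp q 0) \<longlonglongrightarrow> l"
    using decseq_convergent[of "\<lambda>q. maxp q 0" 0] maxp_nonneg by metis
  have "real y * l \<le> 1" for y
  proof -
    have "(\<lambda>q. surv q (int y) / maxp q 0 * maxp q 0) \<longlonglongrightarrow> real y * l"
      using tendsto_mult[OF surv_ratio_tendsto[of "int y"] l] by simp
    moreover have "surv q (int y) / maxp q 0 * maxp q 0 \<le> 1" for q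
      using surv_le_1[of q] maxp_0_pos[of q] by simp
    ultimately show ?thesis by (intro LIMSEQ_le_const2) auto
  qed
  moreover have "l \<ge> 0" using l maxp_nonneg by (intro LIMSEQ_le_const) auto
  ultimately have "l = 0"
    using reals_Archimedean3[of l] by (meson linorder_not_less order_le_imp_less_or_eq)
  then show ?thesis using l by simp
qed

lemma surv_tendsto_0: "(\<lambda>q. surv q y) \<longlonglongrightarrow> 0"
proof (cases "y \<ge> 0")
  case True
  have "(\<lambda>q. real_of_int y * maxp q 0) \<longlonglongrightarrow> 0"
    using tendsto_mult[OF tendsto_const maxp_0_tendsto] by simp
  with True show ?thesis
    by (intro tendsto_sandwich[OF _ _ tendsto_const, of _ "\<lambda>q. surv q y" _ "\<lambda>q. real_of_int y * maxp q 0"])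
      (auto simp: surv_nonneg surv_le)
qed (simp add: surv_nonpos)

section \<open>Walk histories\<close>

text \<open>Histories are reversed: the head of the list is the current position.\<close>

definition mx :: "int list \<Rightarrow> int" where
  "mx h = Max (set h)"

text \<open>The maximum at the last zero. The clause \<open>h = []\<close> makes \<open>sg\<close>
  agree with \<open>Smax\<close> at \<open>last_zero_upto\<close> also for histories without zeros,
  where that time is 0.\<close>

fun sg :: "int list \<Rightarrow> int" where
  "sg [] = 0"
| "sg (x # h) = (if x = 0 \<or> h = [] then mx (x # h) else sg h)"

fun reach :: "int list \<Rightarrow> bool" where
  "reach [] \<longleftrightarrow> False"
| "reach [x] \<longleftrightarrow> x = 0"
| "reach (x # y # h) \<longleftrightarrow> \<bar>x - y\<bar> = 1 \<and> reach (y # h)"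

primrec avg :: "nat \<Rightarrow> int list \<Rightarrow> (int list \<Rightarrow> real) \<Rightarrow> real" where
  "avg 0 h f = f h"
| "avg (Suc n) h f = (avg n ((hd h + 1) # h) f + avg n ((hd h - 1) # h) f) / 2"

lemma reach_neq_Nil: "reach h \<Longrightarrow> h \<noteq> []"
  by auto

lemma mx_single [simp]: "mx [x] = x"
  by (simp add: mx_def)

lemma mx_Cons: "h \<noteq> [] \<Longrightarrow> mx (x # h) = max x (mx h)"
  by (simp add: mx_def)

lemma reach_Cons: "h \<noteq> [] \<Longrightarrow> reach (x # h) \<longleftrightarrow> \<bar>x - hd h\<bar> = 1 \<and> reach h"
  by (cases h) auto

lemma reach_up: "reach h \<Longrightarrow> reach ((hd h + 1) # h)"
  and reach_down: "reach h \<Longrightarrow> reach ((hd h - 1) # h)"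
  by (auto simp: reach_Cons reach_neq_Nil)

lemma hd_le_mx: "h \<noteq> [] \<Longrightarrow> hd h \<le> mx h"
  by (simp add: mx_def)

lemma mx_nonneg: "reach h \<Longrightarrow> mx h \<ge> 0"
proof (induction h rule: reach.induct)
  case (3 x y h)
  then show ?case by (simp add: mx_Cons)
qed auto

lemma sg_zero: "h \<noteq> [] \<Longrightarrow> hd h = 0 \<Longrightarrow> sg h = mx h"
  by (cases h) auto

lemma avg_add: "avg (m + n) h f = avg m h (\<lambda>g. avg n g f)"
  by (induction m arbitrary: h) auto

lemma avg_mono:
  assumes "\<And>u. length u = n \<Longrightarrow> reach (u @ h) \<Longrightarrow> f (u @ h) \<le> f' (u @ h)" "reach h"
  shows "avg n h f \<le> avg n h f'"
  using assms
proof (induction n arbitrary: h)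
  case (Suc n)
  have "avg n ((hd h + 1) # h) f \<le> avg n ((hd h + 1) # h) f'"
    using Suc.prems(1)[of "_ @ [hd h + 1]"] by (intro Suc.IH) (auto intro!: reach_up Suc.prems(2))
  moreover have "avg n ((hd h - 1) # h) f \<le> avg n ((hd h - 1) # h) f'"
    using Suc.prems(1)[of "_ @ [hd h - 1]"] by (intro Suc.IH) (auto intro!: reach_down Suc.prems(2))
  ultimately show ?case by simp
qed (use assms in auto)

lemma avg_cong:
  assumes "\<And>u. length u = n \<Longrightarrow> reach (u @ h) \<Longrightarrow> f (u @ h) = f' (u @ h)" "reach h"
  shows "avg n h f = avg n h f'"
  by (intro antisym avg_mono) (auto simp: assms)

lemma avg_const [simp]: "avg n h (\<lambda>_. c) = c"
  by (induction n arbitrary: h) auto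

lemma avg_cmult: "avg n h (\<lambda>g. c * f g) = c * avg n h f"
  by (induction n arbitrary: h) (auto simp: algebra_simps)

lemma avg_plus: "avg n h (\<lambda>g. f g + f' g) = avg n h f + avg n h f'"
  by (induction n arbitrary: h) (auto simp: field_simps)

lemma avg_nonneg: "reach h \<Longrightarrow> (\<And>g. reach g \<Longrightarrow> f g \<ge> 0) \<Longrightarrow> avg n h f \<ge> 0"
  using avg_mono[of n h "\<lambda>_. 0" f] by simp

lemma avg_tendsto:
  assumes "\<And>u. length u = n \<Longrightarrow> reach (u @ h) \<Longrightarrow> (\<lambda>p. f p (u @ h)) \<longlonglongrightarrow> f' (u @ h)" "reach h"
  shows "(\<lambda>p. avg n h (f p)) \<longlonglongrightarrow> avg n h f'"
  using assms
proof (induction n arbitrary: h)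
  case 0
  then show ?case using "0"(1)[of "[]"] by auto
next
  case (Suc n)
  have "(\<lambda>p. avg n ((hd h + 1) # h) (f p)) \<longlonglongrightarrow> avg n ((hd h + 1) # h) f'"
    using Suc.prems(1)[of "_ @ [hd h + 1]"] by (intro Suc.IH) (auto intro!: reach_up Suc.prems(2))
  moreover have "(\<lambda>p. avg n ((hd h - 1) # h) (f p)) \<longlonglongrightarrow> avg n ((hd h - 1) # h) f'"
    using Suc.prems(1)[of "_ @ [hd h - 1]"] by (intro Suc.IH) (auto intro!: reach_down Suc.prems(2))
  ultimately show ?case by (auto intro!: tendsto_intros)
qed

text \<open>The invariant \<open>I\<close> admits functions that are harmonic along certain
  histories only, such as functions killed at a zero.\<close>

lemma avg_harmonic:
  assumes "\<And>g. I g \<Longrightarrow> I ((hd g + 1) # g) \<and> I ((hd g - 1) # g)"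
    and "\<And>g. I g \<Longrightarrow> f ((hd g + 1) # g) + f ((hd g - 1) # g) = 2 * f g" and "I h"
  shows "avg n h f = f h"
  using assms(3)
proof (induction n arbitrary: h)
  case (Suc n)
  then show ?case using assms(1,2)[of h] by simp
qed simp

text \<open>The weight \<open>\<bar>x\<bar> + 2 r - 2\<close> reflects that, in law, each excursion away from \<open>0\<close> is shorter than
  the passage time of two further levels.\<close>

lemma avg_zeros_le:
  assumes "reach h" "count_list h 0 < a"
  shows "avg n h (\<lambda>g. of_bool (count_list g 0 < a))
    \<le> surv n (\<bar>hd h\<bar> + 2 * int (a - count_list h 0) - (if hd h = 0 then 0 else 2))"
  using assms
proof (induction n arbitrary: h)
  case 0
  then show ?case by (auto simp: surv_0)
next
  case (Suc n)
  let ?b = "int (a - count_list h 0)"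
  let ?A = "\<lambda>h. avg n h (\<lambda>g. of_bool (count_list g 0 < a))"
  have b: "?b \<ge> 1" using Suc.prems by simp
  \<comment> \<open>After the a-th zero the event is impossible. This covers the step to 0 that
    supplies the last missing zero.\<close>
  have zero: "?A h = 0" if "count_list h 0 \<ge> a" for h :: "int list"
    using that
  proof (induction n arbitrary: h)
    case (Suc n)
    then show ?case using Suc.IH[of "(hd h + 1) # h"] Suc.IH[of "(hd h - 1) # h"] by simp
  qed simp
  consider "hd h = 0" | "hd h > 0" | "hd h < 0" by linarith
  then show ?case
  proof cases
    case 1
    have "?A (1 # h) \<le> surv n (2 * ?b - 1)" "?A (-1 # h) \<le> surv n (2 * ?b - 1)"
      using Suc.IH[of "1 # h"] Suc.IH[of "-1 # h"] Suc.prems 1 reach_up[of h] reach_down[of h]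
      by (simp_all add: algebra_simps)
    \<comment> \<open>The bound loses something only at 0: both neighbours have level 2 b - 1,
      whereas the recursion of \<open>surv\<close> at 2 b would allow 2 b + 1 for one of them. Off 0
      the levels match the recursion exactly.\<close>
    then show ?thesis
      using 1 b surv_Suc[of "2 * ?b" n] surv_mono[of "2 * ?b - 1" "2 * ?b + 1" n] by simp
  next
    case 2
    have 3: "?A ((hd h + 1) # h) \<le> surv n (hd h + 2 * ?b - 1)"
      using Suc.IH[of "(hd h + 1) # h"] Suc.prems 2 reach_up[of h] by (simp add: algebra_simps)
    have 4: "?A ((hd h - 1) # h) \<le> surv n (hd h + 2 * ?b - 3)"
    proof (cases "hd h = 1")
      case True
      show ?thesis
      proof (cases "Suc (count_list h 0) < a")
        case True
        then show ?thesis
          using Suc.IH[of "0 # h"] Suc.prems reach_down[of h] \<open>hd h = 1\<close>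
          by (simp add: of_nat_diff algebra_simps)
      next
        case False
        then show ?thesis using zero[of "(hd h - 1) # h"] \<open>hd h = 1\<close> by (simp add: surv_nonneg)
      qed
    next
      case False
      then show ?thesis
        using Suc.IH[of "(hd h - 1) # h"] Suc.prems reach_down[of h] 2 by (simp add: algebra_simps)
    qed
    show ?thesis
      using 2 3 4 b surv_Suc[of "hd h + 2 * ?b - 2" n] by (simp add: algebra_simps)
  next
    case n3: 3
    have 3: "?A ((hd h - 1) # h) \<le> surv n (- hd h + 2 * ?b - 1)"
      using Suc.IH[of "(hd h - 1) # h"] Suc.prems n3 reach_down[of h] by (simp add: algebra_simps)
    have 4: "?A ((hd h + 1) # h) \<le> surv n (- hd h + 2 * ?b - 3)"
    proof (cases "hd h = -1")
      case True
      show ?thesis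
      proof (cases "Suc (count_list h 0) < a")
        case True
        then show ?thesis
          using Suc.IH[of "0 # h"] Suc.prems reach_up[of h] \<open>hd h = -1\<close>
          by (simp add: of_nat_diff algebra_simps)
      next
        case False
        then show ?thesis using zero[of "(hd h + 1) # h"] \<open>hd h = -1\<close> by (simp add: surv_nonneg)
      qed
    next
      case False
      then show ?thesis
        using Suc.IH[of "(hd h + 1) # h"] Suc.prems reach_up[of h] n3 by (simp add: algebra_simps)
    qed
    show ?thesis
      using n3 3 4 b surv_Suc[of "- hd h + 2 * ?b - 2" n] by (simp add: algebra_simps)
  qed
qed

lemma avg_zeros_tendsto:
  assumes "reach h"
  shows "(\<lambda>n. avg n h (\<lambda>g. of_bool (count_list g 0 < a))) \<longlonglongrightarrow> 0"
proof -
  \<comment> \<open>\<open>avg_zeros_le\<close> requires at least one missing zero, so the threshold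
    is raised above the number of zeros already present.\<close>
  define a' where "a' = Suc (max a (count_list h 0))"
  have "avg n h (\<lambda>g. of_bool (count_list g 0 < a)) \<le> avg n h (\<lambda>g. of_bool (count_list g 0 < a'))" for n
    using assms by (intro avg_mono) (auto simp: a'_def)
  also have "\<dots> n \<le> surv n (\<bar>hd h\<bar> + 2 * int (a' - count_list h 0) - (if hd h = 0 then 0 else 2))" for n
    using assms by (intro avg_zeros_le) (auto simp: a'_def)
  finally show ?thesis
    by (intro tendsto_sandwich[OF _ _ tendsto_const surv_tendsto_0] always_eventually allI avg_nonneg assms)
      auto
qed

section \<open>The expected weight at the last zero\<close>

locale weight =
  fixes \<phi> :: "nat \<Rightarrow> real"
  assumes \<phi>_nonneg: "\<And>k. \<phi> k \<ge> 0"
    and \<phi>_sums: "\<phi> sums 1"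
    and \<phi>_moment: "summable (\<lambda>k. real k * \<phi> k)"
begin

definition pen :: "int list \<Rightarrow> real" where
  "pen h = 1/2 * \<phi> (nat (sg h)) * \<bar>real_of_int (hd h)\<bar>
     + \<phi> (nat (mx h)) * real_of_int (mx h - max (hd h) 0)
     + tail \<phi> (nat (mx h))"

text \<open>With x the position and j = s + k \<ge> x, the difference of the two \<open>surv\<close>
  values is the probability that within q steps the walk reaches j and then 0, but does not reach j
  + 1 and then 0.\<close>

definition above :: "nat \<Rightarrow> int \<Rightarrow> nat \<Rightarrow> real" where
  "above q x s = (\<Sum>k. \<phi> (s + k) * (surv q (2 * int (s + k) + 2 - x) - surv q (2 * int (s + k) - x)))"

text \<open>The number c is the weight at the last zero so far; it survives if 0 is avoided, with
  probability \<open>surv q \<bar>x\<bar>\<close>. The weight \<phi> s belongs to a return to 0 with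
  no new maximum before the last zero, of probability
  \<open>surv q (2 * s + 2 - x) - surv q \<bar>x\<bar>\<close>. This difference is split at 2 s - x:
  its upper part is the first summand of \<open>above\<close>. As 2 s - x - \<bar>x\<bar> = 2 (s -
  x^+), the three terms correspond to those of M.\<close>

definition lastw :: "nat \<Rightarrow> int \<Rightarrow> nat \<Rightarrow> real \<Rightarrow> real" where
  "lastw q x s c = c * surv q \<bar>x\<bar> + \<phi> s * (surv q (2 * int s - x) - surv q \<bar>x\<bar>) + above q x s"

lemma \<phi>_summable: "summable \<phi>"
  using \<phi>_sums by (rule sums_summable)

lemma \<phi>_shift_summable: "summable (\<lambda>k. \<phi> (s + k))"
  using summable_ignore_initial_segment[OF \<phi>_summable, of s] by (simp add: add.commute)

lemma \<phi>_le_1: "\<phi> k \<le> 1"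
  using sum_le_suminf[OF \<phi>_summable, of "{k}"] \<phi>_sums \<phi>_nonneg by (simp add: sums_iff)

lemma tail_Suc: "tail \<phi> s = \<phi> s + tail \<phi> (Suc s)"
  unfolding tail_def using suminf_split_head[OF \<phi>_shift_summable[of s]] by simp

lemma tail_0: "tail \<phi> 0 = 1"
  using \<phi>_sums by (simp add: tail_def sums_iff)

lemma tail_nonneg: "tail \<phi> s \<ge> 0"
  unfolding tail_def by (intro suminf_nonneg \<phi>_shift_summable \<phi>_nonneg)

lemma tail_le_1: "tail \<phi> s \<le> 1"
proof (induction s)
  case (Suc s)
  then show ?case using tail_Suc[of s] \<phi>_nonneg[of s] by linarith
qed (simp add: tail_0)

section \<open>The mean weight at the last zero after q further steps\<close>

lemma above_summable:
  "summable (\<lambda>k. \<phi> (s + k) * (surv q (2 * int (s + k) + 2 - x) - surv q (2 * int (s + k) - x)))"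
proof (rule summable_comparison_test'[OF \<phi>_shift_summable[of s], of 0])
  fix k
  have "\<bar>surv q (2 * int (s + k) + 2 - x) - surv q (2 * int (s + k) - x)\<bar> \<le> 1"
    using surv_nonneg[of q] surv_le_1[of q] by (smt (verit))
  then show "norm (\<phi> (s + k) * (surv q (2 * int (s + k) + 2 - x) - surv q (2 * int (s + k) - x))) \<le> \<phi> (s + k)"
    using \<phi>_nonneg[of "s + k"] by (simp add: abs_mult mult_left_le)
qed

lemma above_step:
  "above q x s = \<phi> s * (surv q (2 * int s + 2 - x) - surv q (2 * int s - x)) + above q x (Suc s)"
  unfolding above_def using suminf_split_head[OF above_summable[of s q x]] by simp

lemma above_0: "x \<le> int s \<Longrightarrow> s > 0 \<Longrightarrow> above 0 x s = 0"
  unfolding above_def by (simp add: surv_0)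

text \<open>The hypothesis keeps every level 2 (s + k) - x positive, so that first-step analysis
  applies to each summand. Among positions x \<le> s with s \<ge> 0 it excludes only x = s =
  0.\<close>

lemma above_Suc:
  assumes "2 * int s - x \<ge> 1"
  shows "above (Suc q) x s = (above q (x + 1) s + above q (x - 1) s) / 2"
proof -
  have "above q (x + 1) s + above q (x - 1) s =
     (\<Sum>k. \<phi> (s + k) * (surv q (2 * int (s + k) + 2 - (x + 1)) - surv q (2 * int (s + k) - (x + 1)))
        + \<phi> (s + k) * (surv q (2 * int (s + k) + 2 - (x - 1)) - surv q (2 * int (s + k) - (x - 1))))"
    unfolding above_def by (rule suminf_add[OF above_summable above_summable])
  also have "\<dots> = (\<Sum>k. 2 * (\<phi> (s + k) * (surv (Suc q) (2 * int (s + k) + 2 - x) - surv (Suc q) (2 * int (s + k) - x))))"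
  proof (rule arg_cong[where f = suminf], rule ext)
    fix k
    define y where "y = 2 * int (s + k) - x"
    have e: "2 * int (s + k) = y + x" "y + x + 2 - x = y + 2" "y + x - x = y"
      "y + x + 2 - (x + 1) = y + 1" "y + x - (x + 1) = y - 1" "y + x + 2 - (x - 1) = y + 3" "y + x - (x - 1) = y + 1"
      by (auto simp: y_def)
    have "y \<ge> 1" using assms by (simp add: y_def)
    then have S: "surv (Suc q) y = (surv q (y - 1) + surv q (y + 1)) / 2"
      "surv (Suc q) (y + 2) = (surv q (y + 1) + surv q (y + 3)) / 2"
      using surv_Suc[of y q] surv_Suc[of "y + 2" q] by (simp_all add: algebra_simps)
    show "\<phi> (s + k) * (surv q (2 * int (s + k) + 2 - (x + 1)) - surv q (2 * int (s + k) - (x + 1)))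
        + \<phi> (s + k) * (surv q (2 * int (s + k) + 2 - (x - 1)) - surv q (2 * int (s + k) - (x - 1)))
      = 2 * (\<phi> (s + k) * (surv (Suc q) (2 * int (s + k) + 2 - x) - surv (Suc q) (2 * int (s + k) - x)))"
      unfolding e S by (simp add: field_simps)
  qed
  also have "\<dots> = 2 * above (Suc q) x s"
    unfolding above_def by (rule suminf_mult[OF above_summable])
  finally show ?thesis by simp
qed

text \<open>Both sides obey the same one-step recursion. Replacing c by \<phi> s at a zero has no
  effect, since c is multiplied there by \<open>surv q 0\<close>, which is 0. The cases separate the
  positions at which a step can raise the maximum from the others, and the latter by the sign of
  x.\<close>

lemma avg_last_weight:
  assumes "reach h"
  shows "avg q h (\<lambda>g. \<phi> (nat (sg g))) = lastw q (hd h) (nat (mx h)) (\<phi> (nat (sg h)))"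
  using assms
proof (induction q arbitrary: h)
  case 0
  have h: "h \<noteq> []" "hd h \<le> mx h" "mx h \<ge> 0" using 0 reach_neq_Nil hd_le_mx mx_nonneg by auto
  show ?case
  proof (cases "hd h = 0")
    case True
    then have sg: "sg h = mx h" using h by (simp add: sg_zero)
    show ?thesis
    proof (cases "mx h = 0")
      case True
      \<comment> \<open>Since \<open>surv 0 0\<close> is 0, the other two terms vanish and the
        summand of level 0 carries the whole weight.\<close>
      have "above 0 0 0 = \<phi> 0"
        using above_step[of 0 0 0] above_0[of 0 1] by (simp add: surv_0 surv_nonpos)
      then show ?thesis using \<open>hd h = 0\<close> sg True by (simp add: lastw_def surv_nonpos)
    next
      case False
      then show ?thesis using \<open>hd h = 0\<close> sg h by (simp add: lastw_def surv_0 surv_nonpos above_0)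
    qed
  next
    case False
    then have "above 0 (hd h) (nat (mx h)) = 0"
      using h above_0[of "hd h" "nat (mx h)"]
      by (cases "mx h = 0") (auto simp: above_def surv_0)
    moreover have "surv 0 (2 * mx h - hd h) = 1" "surv 0 \<bar>hd h\<bar> = 1" using h False by (auto simp: surv_0)
    ultimately show ?thesis using h by (simp add: lastw_def)
  qed
next
  case (Suc q)
  define x s c where "x = hd h" and "s = nat (mx h)" and "c = \<phi> (nat (sg h))"
  have h: "h \<noteq> []" "x \<le> int s" "mx h = int s"
    using Suc.prems reach_neq_Nil hd_le_mx mx_nonneg by (auto simp: x_def s_def)
  have c: "c = \<phi> s" if "x = 0" using that sg_zero[OF h(1)] by (simp add: x_def c_def s_def)
  let ?up = "lastw q (x + 1) (nat (max (x + 1) (int s))) (if x + 1 = 0 then \<phi> s else c)"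
  let ?dn = "lastw q (x - 1) s (if x - 1 = 0 then \<phi> s else c)"
  have "avg (Suc q) h (\<lambda>g. \<phi> (nat (sg g))) = (?up + ?dn) / 2"
  proof -
    have "avg q ((x + 1) # h) (\<lambda>g. \<phi> (nat (sg g))) = ?up"
      using Suc.IH[OF reach_up[OF Suc.prems]] h by (auto simp: mx_Cons x_def[symmetric] c_def)
    moreover have "avg q ((x - 1) # h) (\<lambda>g. \<phi> (nat (sg g))) = ?dn"
      using Suc.IH[OF reach_down[OF Suc.prems]] h by (auto simp: mx_Cons x_def[symmetric] c_def)
    ultimately show ?thesis by (simp add: x_def)
  qed
  also have "\<dots> = lastw (Suc q) x s c"
  proof -
    consider "x = int s" "s = 0" | "x = int s" "s > 0" | "x < int s" "x = 0" | "x < int s" "x > 0" | "x < 0" 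
      using h by linarith
    then show ?thesis
    proof cases
      case 1
      \<comment> \<open>At x = s = 0 the recursion \<open>above_Suc\<close> does not apply; level 0
        is split off and the recursion is used from level 1 on.\<close>
      have "above (Suc q) 0 0 = \<phi> 0 * surv (Suc q) 2 + above (Suc q) 0 1"
        using above_step[of "Suc q" 0 0] by (simp add: surv_nonpos)
      moreover have "above (Suc q) 0 1 = (above q 1 1 + above q (-1) 1) / 2"
        using above_Suc[of 1 0 q] by simp
      moreover have "above q (-1) 0 = \<phi> 0 * (surv q 3 - surv q 1) + above q (-1) 1"
        using above_step[of q "-1" 0] by simp
      ultimately show ?thesis using 1 c surv_Suc[of 2 q]
        by (simp add: lastw_def surv_nonpos field_simps)
    next
      case 2
      have a: "above (Suc q) x s = (above q (x + 1) s + above q (x - 1) s) / 2"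
        using 2 by (intro above_Suc) auto
      \<comment> \<open>A step up from x = s makes the new position the maximum, and there the
        middle term of \<open>lastw\<close> vanishes. Removing the summand of level s from
        \<open>above\<close> supplies exactly the middle term that belongs to the old
        maximum.\<close>
      have b: "above q (x + 1) s = \<phi> s * (surv q (x + 1) - surv q (x - 1)) + above q (x + 1) (Suc s)"
        using above_step[of q "x + 1" s] 2 by (simp add: algebra_simps)
      have c: "surv (Suc q) x = (surv q (x - 1) + surv q (x + 1)) / 2" using 2 by (intro surv_Suc) auto
      have d: "nat (1 + int s) = Suc s" by simp
      show ?thesis
      proof (cases "x = 1")
        case True
        then show ?thesis using 2 a b c by (simp add: lastw_def surv_nonpos field_simps numeral_2_eq_2)
      next
        case False
        then show ?thesis using 2 a b c d
          by (simp add: lastw_def surv_nonpos algebra_simps add_divide_distrib)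
      qed
    next
      case 3
      have a: "above (Suc q) x s = (above q (x + 1) s + above q (x - 1) s) / 2"
        using 3 by (intro above_Suc) auto
      have b: "surv (Suc q) (2 * int s) = (surv q (2 * int s - 1) + surv q (2 * int s + 1)) / 2"
        using 3 by (intro surv_Suc) auto
      show ?thesis using 3 a b c
        by (simp add: lastw_def surv_nonpos max_def algebra_simps add_divide_distrib)
    next
      case 4
      have a: "above (Suc q) x s = (above q (x + 1) s + above q (x - 1) s) / 2"
        using 4 by (intro above_Suc) auto
      have b: "surv (Suc q) (2 * int s - x) = (surv q (2 * int s - x - 1) + surv q (2 * int s - x + 1)) / 2"
        using 4 by (intro surv_Suc) auto
      have c: "surv (Suc q) x = (surv q (x - 1) + surv q (x + 1)) / 2"
        using 4 by (intro surv_Suc) auto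
      have up: "?up = c * surv q (x + 1) + \<phi> s * (surv q (2 * int s - x - 1) - surv q (x + 1)) + above q (x + 1) s"
        using 4 by (simp add: lastw_def max_def algebra_simps)
      have dn: "?dn = c * surv q (x - 1) + \<phi> s * (surv q (2 * int s - x + 1) - surv q (x - 1)) + above q (x - 1) s"
        using 4 by (cases "x = 1") (simp_all add: lastw_def surv_nonpos algebra_simps)
      have "lastw (Suc q) x s c = c * surv (Suc q) x + \<phi> s * (surv (Suc q) (2 * int s - x) - surv (Suc q) x)
          + above (Suc q) x s"
        using 4 by (simp add: lastw_def)
      then show ?thesis unfolding up dn a b c by (simp add: field_simps)
    next
      case 5
      have a: "above (Suc q) x s = (above q (x + 1) s + above q (x - 1) s) / 2"
        using 5 by (intro above_Suc) auto
      have b: "surv (Suc q) (2 * int s - x) = (surv q (2 * int s - x - 1) + surv q (2 * int s - x + 1)) / 2"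
        using 5 by (intro surv_Suc) auto
      have c: "surv (Suc q) (-x) = (surv q (-x - 1) + surv q (-x + 1)) / 2"
        using 5 by (intro surv_Suc) auto
      have up: "?up = c * surv q (-x - 1) + \<phi> s * (surv q (2 * int s - x - 1) - surv q (-x - 1)) + above q (x + 1) s"
      proof -
        have "\<bar>x + 1\<bar> = - x - 1" "nat (max (x + 1) (int s)) = s" "2 * int s - (x + 1) = 2 * int s - x - 1"
          using 5 by auto
        moreover have "(if x + 1 = 0 then \<phi> s else c) * surv q (- x - 1) = c * surv q (- x - 1)"
          by (auto simp: surv_nonpos)
        ultimately show ?thesis by (simp only: lastw_def)
      qed
      have dn: "?dn = c * surv q (-x + 1) + \<phi> s * (surv q (2 * int s - x + 1) - surv q (-x + 1)) + above q (x - 1) s"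
        using 5 by (simp add: lastw_def algebra_simps)
      have "lastw (Suc q) x s c = c * surv (Suc q) (-x) + \<phi> s * (surv (Suc q) (2 * int s - x) - surv (Suc q) (-x))
          + above (Suc q) x s"
        using 5 by (simp add: lastw_def)
      then show ?thesis unfolding up dn a b c by (simp add: field_simps)
    qed
  qed
  finally show ?case by (simp add: x_def s_def c_def)
qed

text \<open>Each \<open>surv q y\<close> behaves like y times \<open>maxp q 0\<close>. In
  \<open>above\<close> every level j contributes (2 j + 2 - x) - (2 j - x) = 2, which yields twice
  the tail of \<phi>.\<close>

lemma lastw_tendsto:
  assumes "x \<le> int s"
  shows "(\<lambda>q. lastw q x s c / maxp q 0) \<longlonglongrightarrow>
    c * \<bar>real_of_int x\<bar> + 2 * \<phi> s * real_of_int (int s - max x 0) + 2 * tail \<phi> s"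
proof -
  let ?d = "\<lambda>q k. surv q (2 * int (s + k) + 2 - x) - surv q (2 * int (s + k) - x)"
  have "(\<lambda>q. \<Sum>k. \<phi> (s + k) * (?d q k / maxp q 0)) \<longlonglongrightarrow> (\<Sum>k. \<phi> (s + k) * 2)"
  proof (rule tannerys_theorem[THEN conjunct2, THEN conjunct2])
    show "(\<lambda>q. \<phi> (s + k) * (?d q k / maxp q 0)) \<longlonglongrightarrow> \<phi> (s + k) * 2" for k
    proof -
      have "(\<lambda>q. surv q (2 * int (s + k) + 2 - x) / maxp q 0 - surv q (2 * int (s + k) - x) / maxp q 0)
        \<longlonglongrightarrow> real_of_int (2 * int (s + k) + 2 - x) - real_of_int (2 * int (s + k) - x)"
        using assms by (intro tendsto_diff surv_ratio_tendsto) auto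
      then show ?thesis
        by (intro tendsto_mult tendsto_const) (simp add: diff_divide_distrib)
    qed
    show "\<forall>\<^sub>F (k, q) in at_top \<times>\<^sub>F sequentially. norm (\<phi> (s + k) * (?d q k / maxp q 0)) \<le> \<phi> (s + k) * 2"
    proof (rule always_eventually, clarify)
      fix k q
      have "0 \<le> ?d q k" "?d q k \<le> 2 * maxp q 0"
        using surv_diff_le[of "2 * int (s + k) - x" q] surv_mono assms by (auto simp: algebra_simps)
      then have "\<bar>?d q k / maxp q 0\<bar> \<le> 2"
        using maxp_0_pos[of q] by (simp add: field_simps)
      then show "norm (\<phi> (s + k) * (?d q k / maxp q 0)) \<le> \<phi> (s + k) * 2"
        using \<phi>_nonneg[of "s + k"] unfolding real_norm_def abs_mult by (intro mult_mono) auto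
    qed
    show "summable (\<lambda>k. \<phi> (s + k) * 2)" by (intro summable_mult2 \<phi>_shift_summable)
  qed simp
  moreover have "(\<Sum>k. \<phi> (s + k) * 2) = 2 * tail \<phi> s"
    unfolding tail_def by (simp add: suminf_mult[OF \<phi>_shift_summable, symmetric] mult.commute)
  moreover have "(\<Sum>k. \<phi> (s + k) * (?d q k / maxp q 0)) = above q x s / maxp q 0" for q
    unfolding above_def using suminf_divide[OF above_summable[of s q x], of "maxp q 0"] by simp
  ultimately have 1: "(\<lambda>q. above q x s / maxp q 0) \<longlonglongrightarrow> 2 * tail \<phi> s" by simp
  have "(\<lambda>q. c * (surv q \<bar>x\<bar> / maxp q 0) + \<phi> s * (surv q (2 * int s - x) / maxp q 0 - surv q \<bar>x\<bar> / maxp q 0)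
      + above q x s / maxp q 0)
    \<longlonglongrightarrow> c * real_of_int \<bar>x\<bar> + \<phi> s * (real_of_int (2 * int s - x) - real_of_int \<bar>x\<bar>) + 2 * tail \<phi> s"
    using assms by (intro tendsto_intros 1 surv_ratio_tendsto) auto
  moreover have "\<phi> s * (real_of_int (2 * int s - x) - real_of_int \<bar>x\<bar>) = 2 * \<phi> s * real_of_int (int s - max x 0)"
    by (auto simp: max_def algebra_simps)
  ultimately have "(\<lambda>q. c * (surv q \<bar>x\<bar> / maxp q 0) + \<phi> s * (surv q (2 * int s - x) / maxp q 0 - surv q \<bar>x\<bar> / maxp q 0)
      + above q x s / maxp q 0)
    \<longlonglongrightarrow> c * real_of_int \<bar>x\<bar> + 2 * \<phi> s * real_of_int (int s - max x 0) + 2 * tail \<phi> s"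
    by (simp only:)
  moreover have "lastw q x s c / maxp q 0 = c * (surv q \<bar>x\<bar> / maxp q 0)
      + \<phi> s * (surv q (2 * int s - x) / maxp q 0 - surv q \<bar>x\<bar> / maxp q 0) + above q x s / maxp q 0" for q
    by (simp add: lastw_def add_divide_distrib diff_divide_distrib right_diff_distrib)
  ultimately show ?thesis by simp
qed

section \<open>The limit of the normalised weights\<close>

lemma avg_last_weight_tendsto:
  assumes "reach h"
  shows "(\<lambda>q. avg q h (\<lambda>g. \<phi> (nat (sg g))) / maxp q 0) \<longlonglongrightarrow> 2 * pen h"
proof -
  have h: "hd h \<le> int (nat (mx h))" "mx h \<ge> 0"
    using assms reach_neq_Nil hd_le_mx mx_nonneg[OF assms] by auto
  from lastw_tendsto[OF h(1), of "\<phi> (nat (sg h))"] h(2) show ?thesis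
    by (simp add: avg_last_weight[OF assms] pen_def algebra_simps)
qed

text \<open>The mean with q + 1 steps to go is exactly half the sum of the two means with q steps to
  go. Dividing by \<open>maxp q 0\<close> and computing the limit in both ways gives the relation,
  with no case distinction on the history.\<close>

lemma pen_harmonic:
  assumes "reach g"
  shows "pen ((hd g + 1) # g) + pen ((hd g - 1) # g) = 2 * pen g"
proof (rule LIMSEQ_unique)
  let ?a = "\<lambda>q h. avg q h (\<lambda>g. \<phi> (nat (sg g)))"
  have r: "(\<lambda>q. maxp (Suc q) 0 / maxp q 0) \<longlonglongrightarrow> 1" by (rule maxp_Suc_ratio_tendsto)
  have "(\<lambda>q. ?a (Suc q) g / maxp (Suc q) 0 * (maxp (Suc q) 0 / maxp q 0)) \<longlonglongrightarrow> 2 * pen g * 1"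
    by (intro tendsto_mult r LIMSEQ_Suc[OF avg_last_weight_tendsto] assms)
  moreover have "?a (Suc q) g / maxp (Suc q) 0 * (maxp (Suc q) 0 / maxp q 0) = ?a (Suc q) g / maxp q 0" for q
    using maxp_0_pos[of "Suc q"] by simp
  ultimately show "(\<lambda>q. ?a (Suc q) g / maxp q 0) \<longlonglongrightarrow> 2 * pen g" by simp
  have "(\<lambda>q. (?a q ((hd g + 1) # g) / maxp q 0 + ?a q ((hd g - 1) # g) / maxp q 0) / 2)
    \<longlonglongrightarrow> (2 * pen ((hd g + 1) # g) + 2 * pen ((hd g - 1) # g)) / 2"
    by (intro tendsto_intros avg_last_weight_tendsto reach_up reach_down assms) auto
  then show "(\<lambda>q. ?a (Suc q) g / maxp q 0) \<longlonglongrightarrow> pen ((hd g + 1) # g) + pen ((hd g - 1) # g)"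
    by (simp add: add_divide_distrib mult.commute)
qed

lemma avg_pen: "reach h \<Longrightarrow> avg n h pen = pen h"
  by (rule avg_harmonic[of reach]) (auto simp: pen_harmonic reach_up reach_down)

lemma pen_start: "pen [0] = 1"
  by (simp add: pen_def tail_0)

lemma pen_nonneg: "reach h \<Longrightarrow> pen h \<ge> 0"
  using hd_le_mx[of h] mx_nonneg[of h] reach_neq_Nil[of h]
  by (auto simp: pen_def intro!: add_nonneg_nonneg mult_nonneg_nonneg \<phi>_nonneg tail_nonneg)

text \<open>With q = p - n, the numerator is divided by \<open>maxp q 0\<close> and the denominator
  by \<open>maxp (q + n) 0\<close>. The two normalisations are equivalent, the factors 2 cancel, and
  the denominator contributes only \<open>pen [0]\<close>, which is 1.\<close>

lemma avg_weight_ratio_tendsto: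
  "(\<lambda>p. avg n [0] (\<lambda>h. f h * avg (p - n) h (\<lambda>g. \<phi> (nat (sg g)))) / avg p [0] (\<lambda>g. \<phi> (nat (sg g))))
    \<longlonglongrightarrow> avg n [0] (\<lambda>h. f h * pen h)"
proof -
  let ?a = "\<lambda>q h. avg q h (\<lambda>g. \<phi> (nat (sg g)))"
  have "(\<lambda>q. avg n [0] (\<lambda>h. f h * (?a q h / maxp q 0))) \<longlonglongrightarrow> avg n [0] (\<lambda>h. f h * (2 * pen h))"
    by (intro avg_tendsto tendsto_mult tendsto_const avg_last_weight_tendsto) auto
  moreover have "(\<lambda>q. maxp q 0 / maxp (q + n) 0 / (?a (q + n) [0] / maxp (q + n) 0)) \<longlonglongrightarrow> 1 / (2 * pen [0])"
    by (intro tendsto_divide maxp_shift_ratio_tendsto LIMSEQ_ignore_initial_segment avg_last_weight_tendsto)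
      (auto simp: pen_start)
  ultimately have "(\<lambda>q. avg n [0] (\<lambda>h. f h * (?a q h / maxp q 0)) * (maxp q 0 / maxp (q + n) 0 / (?a (q + n) [0] / maxp (q + n) 0)))
    \<longlonglongrightarrow> avg n [0] (\<lambda>h. f h * (2 * pen h)) * (1 / (2 * pen [0]))"
    by (rule tendsto_mult)
  moreover have "avg n [0] (\<lambda>h. f h * (2 * pen h)) = 2 * avg n [0] (\<lambda>h. f h * pen h)"
    by (simp add: avg_cmult[symmetric] mult.left_commute)
  moreover have "avg n [0] (\<lambda>h. f h * (?a q h / maxp q 0)) = avg n [0] (\<lambda>h. f h * ?a q h) / maxp q 0" for q
    using avg_cmult[of n "[0]" "1 / maxp q 0" "\<lambda>h. f h * ?a q h"] by simp
  ultimately have "(\<lambda>q. avg n [0] (\<lambda>h. f h * ?a q h) / maxp q 0 * (maxp q 0 / maxp (q + n) 0 / (?a (q + n) [0] / maxp (q + n) 0)))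
    \<longlonglongrightarrow> avg n [0] (\<lambda>h. f h * pen h)"
    by (simp add: pen_start)
  moreover have "avg n [0] (\<lambda>h. f h * ?a q h) / maxp q 0 * (maxp q 0 / maxp (q + n) 0 / (?a (q + n) [0] / maxp (q + n) 0))
     = avg n [0] (\<lambda>h. f h * ?a (q + n - n) h) / ?a (q + n) [0]" for q
    using maxp_0_pos[of q] maxp_0_pos[of "q + n"] by simp
  ultimately have "(\<lambda>q. avg n [0] (\<lambda>h. f h * ?a (q + n - n) h) / ?a (q + n) [0])
     \<longlonglongrightarrow> avg n [0] (\<lambda>h. f h * pen h)" by (simp only:)
  from LIMSEQ_offset[OF this] show ?thesis .
qed

end

section \<open>The maximum at the successive zeros\<close>

lemma LIMSEQ_squeeze:
  fixes a b c :: "nat \<Rightarrow> real"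
  assumes "\<And>n. a n \<le> b n" "\<And>n. b n \<le> c n" "a \<longlonglongrightarrow> l" "c \<longlonglongrightarrow> l'" "l = l'"
  shows "b \<longlonglongrightarrow> l"
  using assms by (intro tendsto_sandwich[of a b sequentially c]) auto

lemma reach_count_zeros: "reach h \<Longrightarrow> count_list h 0 \<ge> 1"
  by (induction h rule: reach.induct) auto

text \<open>For a \<ge> 1 this is the running maximum until the a-th zero and is frozen from then
  on: the entries newer than that zero are skipped.\<close>

primrec stopped_mx :: "nat \<Rightarrow> int list \<Rightarrow> int" where
  "stopped_mx a [] = 0"
| "stopped_mx a (x # h) = (if count_list h 0 < a then mx (x # h) else stopped_mx a h)"

lemma stopped_mx_eq: "h \<noteq> [] \<Longrightarrow> count_list h 0 < a \<Longrightarrow> stopped_mx a h = mx h"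
  by (cases h) (auto split: if_splits)

text \<open>The conditional probability, given the history, that the maximum at the a-th zero is at
  most k. By gambler's ruin the walk from x > 0 reaches 0 before k + 1 with probability 1 - x / (k +
  1). Hence an excursion from 0 avoids k + 1 with probability 1/2 + 1/2 * k / (k + 1) = 1 - 1 / (2
  (k + 1)). Off 0 the next zero is accounted for by the first factor, so one full excursion fewer
  remains.\<close>

definition stay_below :: "nat \<Rightarrow> nat \<Rightarrow> int list \<Rightarrow> real" where
  "stay_below a k h =
     (if stopped_mx a h > int k then 0 else if count_list h 0 \<ge> a then 1
      else (1 - real_of_int (max (hd h) 0) / (real k + 1))
        * (1 - 1 / (2 * (real k + 1))) ^ (a - count_list h 0 - (if hd h = 0 then 0 else 1)))"

lemma stay_below_harmonic:
  assumes "reach h"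
  shows "stay_below a k ((hd h + 1) # h) + stay_below a k ((hd h - 1) # h) = 2 * stay_below a k h"
proof -
  define x where "x = hd h"
  have ne: "h \<noteq> []" using assms by auto
  show ?thesis
  proof (cases "count_list h 0 \<ge> a")
    case True
    then show ?thesis by (simp add: stay_below_def)
  next
    case False
    define r where "r = a - Suc (count_list h 0)"
    have r: "a - count_list h 0 = Suc r" using False by (simp add: r_def)
    have sm: "stopped_mx a h = mx h" using False ne by (simp add: stopped_mx_eq)
    have sm': "stopped_mx a (y # h) = max y (mx h)" for y using False ne by (simp add: mx_Cons)
    show ?thesis
    proof (cases "mx h > int k")
      case True
      then show ?thesis using False sm sm' by (simp add: stay_below_def less_max_iff_disj)
    next
      case le: False
      define \<rho> :: real where "\<rho> = 1 - 1 / (2 * (real k + 1))"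
      have x: "x \<le> mx h" "x \<le> int k" using hd_le_mx[OF ne] le by (auto simp: x_def)
      \<comment> \<open>The exponent is r whether or not y is 0: a new zero is counted, while a
        nonzero position has 1 subtracted. At y = k + 1 the ruin factor is 0, in agreement with the
        exceeded maximum.\<close>
      have ind: "stay_below a k (y # h) = (1 - real_of_int (max y 0) / (real k + 1)) * \<rho> ^ r"
        if "y \<le> int k + 1" "y = 0 \<longrightarrow> x \<noteq> 0" for y
      proof (cases "y = int k + 1")
        case True
        then show ?thesis using le sm' False by (simp add: stay_below_def)
      next
        case ne: False
        have "\<not> max y (mx h) > int k" using that ne le by auto
        then show ?thesis
          using sm'[of y] False by (auto simp: stay_below_def \<rho>_def r_def)
      qed
      have h: "stay_below a k h = (1 - real_of_int (max x 0) / (real k + 1)) * \<rho> ^ (if x = 0 then Suc r else r)"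
        using le False sm r by (auto simp: stay_below_def x_def \<rho>_def)
      consider "x = 0" | "x > 0" | "x < 0" by linarith
      then show ?thesis
      proof cases
        case 1
        have "stay_below a k (1 # h) + stay_below a k (-1 # h) = (2 - 1 / (real k + 1)) * \<rho> ^ r"
          using 1 ind[of 1] ind[of "-1"] by (simp add: algebra_simps)
        also have "2 - 1 / (real k + 1) = 2 * \<rho>" by (simp add: \<rho>_def field_simps)
        finally show ?thesis using h 1 by (simp add: x_def)
      next
        case 2
        have "stay_below a k ((x + 1) # h) + stay_below a k ((x - 1) # h)
          = ((1 - (real_of_int x + 1) / (real k + 1)) + (1 - (real_of_int x - 1) / (real k + 1))) * \<rho> ^ r"
        proof -
          have "max (x - 1) 0 = x - 1" "max (x + 1) 0 = x + 1" using 2 by auto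
          then have "stay_below a k ((x + 1) # h) = (1 - (real_of_int x + 1) / (real k + 1)) * \<rho> ^ r"
            "stay_below a k ((x - 1) # h) = (1 - (real_of_int x - 1) / (real k + 1)) * \<rho> ^ r"
            using ind[of "x + 1"] ind[of "x - 1"] 2 x by simp_all
          then show ?thesis by (simp only: distrib_right)
        qed
        also have "(1 - (real_of_int x + 1) / (real k + 1)) + (1 - (real_of_int x - 1) / (real k + 1))
            = 2 * (1 - real_of_int x / (real k + 1))" by (simp add: diff_divide_distrib add_divide_distrib)
        finally show ?thesis using h 2 by (simp add: x_def max_def)
      next
        case 3
        then show ?thesis using h x ind[of "x + 1"] ind[of "x - 1"] by (simp add: x_def max_def)
      qed
    qed
  qed
qed

lemma stay_below_bounds:
  assumes "reach h"
  shows "0 \<le> stay_below a k h" "stay_below a k h \<le> 1"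
proof -
  let ?c = "1 - real_of_int (max (hd h) 0) / (real k + 1)"
  let ?p = "\<lambda>n::nat. (1 - 1 / (2 * (real k + 1))) ^ n"
  have \<rho>: "0 \<le> 1 - 1 / (2 * (real k + 1))" "1 - 1 / (2 * (real k + 1)) \<le> 1" by (auto simp: field_simps)
  have p: "0 \<le> ?p n" "?p n \<le> 1" for n
    using \<rho> by (auto simp: power_le_one del: power_mono)
  have c: "0 \<le> ?c \<and> ?c \<le> 1" if "stopped_mx a h \<le> int k" "count_list h 0 < a"
  proof -
    have "hd h \<le> int k" using that hd_le_mx[of h] stopped_mx_eq[of h a] assms by fastforce
    then have "real_of_int (hd h) \<le> real k" by linarith
    then show ?thesis by (simp add: field_simps max_def)
  qed
  show "0 \<le> stay_below a k h" "stay_below a k h \<le> 1"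
    using c p by (auto simp: stay_below_def intro!: mult_nonneg_nonneg mult_le_one)
qed

text \<open>The mean of \<open>stay_below\<close> is constant in time. It differs from the
  indicator, by at most 1, only on histories with fewer than a zeros, whose probability
  vanishes.\<close>

lemma avg_stopped_mx_tendsto:
  assumes "a \<ge> 1"
  shows "(\<lambda>n. avg n [0] (\<lambda>g. of_bool (count_list g 0 \<ge> a \<and> stopped_mx a g \<le> int k)))
    \<longlonglongrightarrow> (1 - 1 / (2 * (real k + 1))) ^ (a - 1)"
proof -
  let ?f = "\<lambda>g. of_bool (count_list g 0 \<ge> a \<and> stopped_mx a g \<le> int k) :: real"
  let ?z = "\<lambda>g::int list. of_bool (count_list g 0 < a) :: real"
  have start: "stay_below a k [0] = (1 - 1 / (2 * (real k + 1))) ^ (a - 1)"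
    using assms by (auto simp: stay_below_def)
  have e: "avg n [0] (stay_below a k) = stay_below a k [0]" for n
    by (rule avg_harmonic[of reach]) (auto simp: stay_below_harmonic reach_up reach_down)
  have z: "(\<lambda>n. avg n [0] ?z) \<longlonglongrightarrow> 0" by (rule avg_zeros_tendsto) simp
  have l: "(\<lambda>n. stay_below a k [0] + (-1) * avg n [0] ?z) \<longlonglongrightarrow> stay_below a k [0] + (-1) * 0"
    by (intro tendsto_intros z)
  have lo: "stay_below a k [0] + (-1) * avg n [0] ?z \<le> avg n [0] ?f" for n
  proof -
    have "avg n [0] (\<lambda>g. stay_below a k g + (-1) * ?z g) \<le> avg n [0] ?f"
    proof (rule avg_mono)
      fix u assume "reach (u @ [0])"
      then show "stay_below a k (u @ [0]) + (-1) * ?z (u @ [0]) \<le> ?f (u @ [0])"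
        using stay_below_bounds(2)[of "u @ [0]" a k]
        by (cases "count_list (u @ [0]) 0 < a") (simp_all add: stay_below_def)
    qed simp
    then show ?thesis using e[of n] by (simp only: avg_plus avg_cmult)
  qed
  have up: "avg n [0] ?f \<le> stay_below a k [0]" for n
  proof -
    have "avg n [0] ?f \<le> avg n [0] (stay_below a k)"
    proof (rule avg_mono)
      fix u assume "reach (u @ [0])"
      then show "?f (u @ [0]) \<le> stay_below a k (u @ [0])"
        using stay_below_bounds(1)[of "u @ [0]" a k]
        by (cases "count_list (u @ [0]) 0 < a") (simp_all add: stay_below_def)
    qed simp
    then show ?thesis using e[of n] by simp
  qed
  show ?thesis
    using LIMSEQ_squeeze[OF lo up l tendsto_const] unfolding start by simp
qed

context weight
begin

text \<open>Bounds the second and third terms of M: \<phi>(S) (S - X^+) is at most S \<phi>(S), a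
  single term of the moment series, and the tail is at most 1.\<close>

definition pen_bound :: real where
  "pen_bound = (\<Sum>k. real k * \<phi> k) + 1"

lemma pen_split:
  assumes "reach h"
  shows "1/2 * \<phi> (nat (sg h)) * \<bar>real_of_int (hd h)\<bar> \<le> pen h"
    and "pen h \<le> 1/2 * \<phi> (nat (sg h)) * \<bar>real_of_int (hd h)\<bar> + pen_bound"
proof -
  let ?m = "nat (mx h)"
  have h: "hd h \<le> mx h" "mx h \<ge> 0" using assms hd_le_mx mx_nonneg reach_neq_Nil by auto
  have "\<phi> ?m * real_of_int (mx h - max (hd h) 0) \<le> real ?m * \<phi> ?m"
    using h \<phi>_nonneg[of ?m] by (subst mult.commute) (intro mult_right_mono, auto)
  also have "\<dots> \<le> (\<Sum>k. real k * \<phi> k)"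
    using sum_le_suminf[OF \<phi>_moment, of "{?m}"] \<phi>_nonneg by simp
  finally show "pen h \<le> 1/2 * \<phi> (nat (sg h)) * \<bar>real_of_int (hd h)\<bar> + pen_bound"
    using tail_le_1[of ?m] by (simp add: pen_def pen_bound_def)
  show "1/2 * \<phi> (nat (sg h)) * \<bar>real_of_int (hd h)\<bar> \<le> pen h"
    using h \<phi>_nonneg tail_nonneg by (simp add: pen_def)
qed

lemma pen_bound_nonneg: "pen_bound \<ge> 0"
  using \<phi>_nonneg by (simp add: pen_bound_def suminf_nonneg \<phi>_moment)

text \<open>Off 0 the function \<bar>x\<bar> is harmonic, and \<phi>(S_g) is frozen until the next
  zero. Killing there costs nothing, as \<bar>x\<bar> vanishes. The invariant includes the killed
  histories, on which the function is 0.\<close>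

lemma avg_no_zero:
  assumes "reach h" "hd h \<noteq> 0"
  shows "avg n h (\<lambda>g. of_bool (count_list g 0 \<le> count_list h 0) * (1/2 * \<phi> (nat (sg g)) * \<bar>real_of_int (hd g)\<bar>))
    = 1/2 * \<phi> (nat (sg h)) * \<bar>real_of_int (hd h)\<bar>"
proof -
  let ?z = "count_list h 0"
  let ?I = "\<lambda>g::int list. g \<noteq> [] \<and> (count_list g 0 > ?z \<or> count_list g 0 = ?z \<and> hd g \<noteq> 0)"
  let ?f = "\<lambda>g. of_bool (count_list g 0 \<le> ?z) * (1/2 * \<phi> (nat (sg g)) * \<bar>real_of_int (hd g)\<bar>)"
  have "avg n h ?f = ?f h"
  proof (rule avg_harmonic[of ?I])
    fix g assume I: "?I g"
    show "?f ((hd g + 1) # g) + ?f ((hd g - 1) # g) = 2 * ?f g"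
    proof (cases "count_list g 0 > ?z")
      case False
      have y: "?f (y # g) = 1/2 * \<phi> (nat (sg g)) * \<bar>real_of_int y\<bar>" for y
        using I False by auto
      have "\<bar>real_of_int (hd g + 1)\<bar> + \<bar>real_of_int (hd g - 1)\<bar> = 2 * \<bar>real_of_int (hd g)\<bar>"
        using I False by auto
      moreover have "?f g = 1/2 * \<phi> (nat (sg g)) * \<bar>real_of_int (hd g)\<bar>"
        using I False by auto
      ultimately show ?thesis unfolding y by (simp only: distrib_left[symmetric])
    qed auto
  next
    show "?I ((hd g + 1) # g) \<and> ?I ((hd g - 1) # g)" if "?I g" for g
      using that by auto
  next
    show "?I h" using assms by auto
  qed
  then show ?thesis by simp
qed

text \<open>The term with \<bar>x\<bar> keeps its mean, and the remainder of \<open>pen\<close> is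
  at most \<open>pen_bound\<close> on an event of vanishing probability.\<close>

lemma avg_no_zero_pen_tendsto:
  assumes "reach h" "hd h \<noteq> 0"
  shows "(\<lambda>n. avg n h (\<lambda>g. of_bool (count_list g 0 \<le> count_list h 0) * pen g))
    \<longlonglongrightarrow> 1/2 * \<phi> (nat (sg h)) * \<bar>real_of_int (hd h)\<bar>"
proof -
  let ?z = "\<lambda>g. of_bool (count_list g 0 \<le> count_list h 0) :: real"
  let ?f = "\<lambda>g. ?z g * (1/2 * \<phi> (nat (sg g)) * \<bar>real_of_int (hd g)\<bar>)"
  let ?l = "1/2 * \<phi> (nat (sg h)) * \<bar>real_of_int (hd h)\<bar>"
  have "(\<lambda>n. avg n h ?z) \<longlonglongrightarrow> 0"
    using avg_zeros_tendsto[OF assms(1), of "Suc (count_list h 0)"] by (simp add: less_Suc_eq_le)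
  then have l: "(\<lambda>n. ?l + pen_bound * avg n h ?z) \<longlonglongrightarrow> ?l + pen_bound * 0"
    by (intro tendsto_intros)
  have lo: "?l \<le> avg n h (\<lambda>g. ?z g * pen g)" for n
    unfolding avg_no_zero[OF assms, of n, symmetric]
    using pen_split(1) assms(1) by (intro avg_mono mult_left_mono) auto
  have up: "avg n h (\<lambda>g. ?z g * pen g) \<le> ?l + pen_bound * avg n h ?z" for n
  proof -
    have "avg n h (\<lambda>g. ?z g * pen g) \<le> avg n h (\<lambda>g. ?f g + pen_bound * ?z g)"
    proof (rule avg_mono)
      fix u assume "reach (u @ h)"
      then show "?z (u @ h) * pen (u @ h) \<le> ?f (u @ h) + pen_bound * ?z (u @ h)"
        using pen_split(2)[of "u @ h"] by (simp only: of_bool_def) simp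
    qed (rule assms)
    then show ?thesis by (simp only: avg_plus avg_cmult avg_no_zero[OF assms])
  qed
  show ?thesis
    by (rule LIMSEQ_squeeze[OF lo up tendsto_const l]) simp
qed

text \<open>Serves to show that under Q a path that is positive after its last zero is unbounded:
  for positions between 0 and k the weight \<open>pen\<close> is bounded, while having few zeros
  becomes improbable.\<close>

lemma avg_bounded_pen_tendsto:
  "(\<lambda>n. avg n [0] (\<lambda>g. of_bool (count_list g 0 < a \<and> mx g \<le> k \<and> hd g > 0) * pen g)) \<longlonglongrightarrow> 0"
proof -
  let ?z = "\<lambda>g::int list. of_bool (count_list g 0 < a) :: real"
  let ?C = "\<bar>real_of_int k\<bar> + pen_bound"
  have l: "(\<lambda>n. ?C * avg n [0] ?z) \<longlonglongrightarrow> ?C * 0"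
    by (intro tendsto_mult tendsto_const avg_zeros_tendsto) simp
  have up: "avg n [0] (\<lambda>g. of_bool (count_list g 0 < a \<and> mx g \<le> k \<and> hd g > 0) * pen g) \<le> ?C * avg n [0] ?z" for n
    unfolding avg_cmult[symmetric]
  proof (rule avg_mono)
    fix u assume r: "reach (u @ [0])"
    define g where "g = u @ [0::int]"
    have "pen g \<le> ?C" if "mx g \<le> k" "hd g > 0"
    proof -
      have "hd g \<le> k" using hd_le_mx[of g] that by (auto simp: g_def)
      then have "\<bar>real_of_int (hd g)\<bar> \<le> \<bar>real_of_int k\<bar>" using that by auto
      then have "1/2 * \<phi> (nat (sg g)) * \<bar>real_of_int (hd g)\<bar> \<le> 1 * \<bar>real_of_int k\<bar>"
        using \<phi>_le_1[of "nat (sg g)"] \<phi>_nonneg[of "nat (sg g)"] by (intro mult_mono) auto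
      then show ?thesis using pen_split(2)[of g] r by (simp add: g_def)
    qed
    then show "of_bool (count_list (u @ [0]) 0 < a \<and> mx (u @ [0]) \<le> k \<and> hd (u @ [0]) > 0) * pen (u @ [0])
        \<le> ?C * ?z (u @ [0])"
      using pen_bound_nonneg by (simp add: g_def[symmetric] of_bool_def)
  qed simp
  have lo: "0 \<le> avg n [0] (\<lambda>g. of_bool (count_list g 0 < a \<and> mx g \<le> k \<and> hd g > 0) * pen g)" for n
    by (rule avg_nonneg) (auto intro!: mult_nonneg_nonneg pen_nonneg)
  show ?thesis
    by (rule LIMSEQ_squeeze[OF lo up tendsto_const l]) simp
qed

end

section \<open>Events of the path space\<close>

primrec hist :: "nat \<Rightarrow> (nat \<Rightarrow> int) \<Rightarrow> int list" where
  "hist 0 \<omega> = [\<omega> 0]"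
| "hist (Suc n) \<omega> = \<omega> (Suc n) # hist n \<omega>"

lemma length_hist [simp]: "length (hist n \<omega>) = Suc n"
  by (induction n) auto

lemma hist_neq_Nil [simp]: "hist n \<omega> \<noteq> []"
  by (cases n) auto

lemma hd_hist [simp]: "hd (hist n \<omega>) = \<omega> n"
  by (cases n) auto

lemma set_hist: "set (hist n \<omega>) = \<omega> ` {0..n}"
  by (induction n) (auto simp: atLeast0_atMost_Suc)

lemma rev_hist: "path_upto n \<omega> = rev (hist n \<omega>)"
  unfolding path_upto_def by (induction n) auto

lemma hist_eq_iff: "hist n \<omega> = h \<longleftrightarrow> length h = Suc n \<and> (\<forall>k\<le>n. \<omega> k = h ! (n - k))"
proof (induction n arbitrary: h)
  case 0
  then show ?case by (cases h) auto
next
  case (Suc n)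
  show ?case
  proof (cases h)
    case (Cons x g)
    then show ?thesis using Suc[of g] by (auto simp: le_Suc_eq Suc_diff_le)
  qed auto
qed

lemma nth_hist: "k \<le> n \<Longrightarrow> hist n \<omega> ! (n - k) = \<omega> k"
  using hist_eq_iff[of n \<omega> "hist n \<omega>"] by simp

lemma drop_hist: "drop n (hist (k + n) \<omega>) = hist k \<omega>"
  by (induction n) auto

lemma Smax_hist: "Smax n \<omega> = mx (hist n \<omega>)"
  by (simp add: Smax_def mx_def set_hist)

lemma zeros_Suc: "zeros (Suc n) \<omega> = zeros n \<omega> + (if \<omega> (Suc n) = 0 then 1 else 0)"
proof -
  have "{k. k \<le> Suc n \<and> \<omega> k = 0} = {k. k \<le> n \<and> \<omega> k = 0} \<union> (if \<omega> (Suc n) = 0 then {Suc n} else {})"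
    by (auto simp: le_Suc_eq)
  then show ?thesis by (simp add: zeros_def)
qed

lemma zeros_hist: "zeros n \<omega> = count_list (hist n \<omega>) 0"
proof (induction n)
  case 0
  have "{k. k = 0 \<and> \<omega> k = 0} = (if \<omega> 0 = 0 then {0} else {})" by auto
  then show ?case by (simp add: zeros_def)
qed (simp add: zeros_Suc)

lemma Smax_last_zero_hist: "Smax (last_zero_upto n \<omega>) \<omega> = sg (hist n \<omega>)"
proof (induction n)
  case 0
  have "{k. k \<le> 0 \<and> \<omega> k = 0} = (if \<omega> 0 = 0 then {0} else {})" by auto
  then have "last_zero_upto 0 \<omega> = 0" by (simp add: last_zero_upto_def Sup_nat_def)
  then show ?case by (simp add: Smax_hist)
next
  case (Suc n)
  show ?case
  proof (cases "\<omega> (Suc n) = 0")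
    case True
    then have "last_zero_upto (Suc n) \<omega> = Suc n"
      unfolding last_zero_upto_def by (intro cSup_eq_maximum) auto
    then show ?thesis using True by (simp add: Smax_hist)
  next
    case False
    then have "{k. k \<le> Suc n \<and> \<omega> k = 0} = {k. k \<le> n \<and> \<omega> k = 0}" by (auto simp: le_Suc_eq)
    then show ?thesis using False Suc by (simp add: last_zero_upto_def)
  qed
qed

lemma (in weight) Mart_hist: "Mart \<phi> n \<omega> = pen (hist n \<omega>)"
  unfolding Mart_def pen_def Smax_last_zero_hist by (simp add: Smax_hist)

lemma reach_hist: "\<omega> \<in> paths \<Longrightarrow> reach (hist n \<omega>) \<longleftrightarrow> \<omega> 0 = 0"
  by (induction n) (auto simp: paths_def reach_Cons)

lemma space_Fil [simp]: "space (Fil n) = paths"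
  unfolding Fil_def by (rule space_measure_of) auto

lemma space_Fil_inf [simp]: "space Fil_inf = paths"
  unfolding Fil_inf_def by (rule space_measure_of) (use sets.space_closed[of "Fil _"] in auto)

text \<open>Histories are countable in number, so an arbitrary set \<open>B\<close> of them yields
  an event. Preimages under \<open>hist n\<close> are closed under complements and countable unions,
  so nothing else is generated.\<close>

lemma sets_Fil: "sets (Fil n) = {{\<omega> \<in> paths. hist n \<omega> \<in> B} | B. True}"
proof -
  let ?G = "{{\<omega> \<in> paths. \<omega> k \<in> A} | k A. k \<le> n}"
  have S: "sets (Fil n) = sigma_sets paths ?G" unfolding Fil_def by (rule sets_measure_of) auto
  have "A \<in> sigma_sets paths ?G" if "A = {\<omega> \<in> paths. hist n \<omega> \<in> B}" for A B
  proof -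
    interpret sigma_algebra paths "sigma_sets paths ?G" by (rule sigma_algebra_sigma_sets) auto
    have "{\<omega> \<in> paths. hist n \<omega> = h} \<in> sigma_sets paths ?G" for h
    proof (cases "length h = Suc n")
      case True
      then have "{\<omega> \<in> paths. hist n \<omega> = h} = (\<Inter>k\<in>{..n}. {\<omega> \<in> paths. \<omega> k \<in> {h ! (n - k)}})"
        by (auto simp: hist_eq_iff[of n _ h])
      also have "\<dots> \<in> sigma_sets paths ?G"
        by (rule finite_INT) (blast intro: sigma_sets.Basic)+
      finally show ?thesis .
    next
      case False
      then have "{\<omega> \<in> paths. hist n \<omega> = h} = {}" by auto
      then show ?thesis by (simp only: sigma_sets.Empty)
    qed
    then have "(\<Union>h\<in>B. {\<omega> \<in> paths. hist n \<omega> = h}) \<in> sigma_sets paths ?G"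
      by (intro countable_UN') auto
    also have "(\<Union>h\<in>B. {\<omega> \<in> paths. hist n \<omega> = h}) = {\<omega> \<in> paths. hist n \<omega> \<in> B}" by auto
    finally show ?thesis using that by simp
  qed
  moreover have "\<exists>B. A = {\<omega> \<in> paths. hist n \<omega> \<in> B}" if "A \<in> sigma_sets paths ?G" for A
    using that
  proof induction
    case (Basic a)
    then obtain k A where "a = {\<omega> \<in> paths. \<omega> k \<in> A}" "k \<le> n" by auto
    then have "a = {\<omega> \<in> paths. hist n \<omega> \<in> {h. h ! (n - k) \<in> A}}"
      by (auto simp: nth_hist)
    then show ?case by blast
  next
    case Empty
    show ?case by (rule exI[of _ "{}"]) auto
  next
    case (Compl a)
    then obtain B where "a = {\<omega> \<in> paths. hist n \<omega> \<in> B}" by auto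
    then show ?case by (intro exI[of _ "- B"]) auto
  next
    case (Union a)
    then obtain B where "\<And>i. a i = {\<omega> \<in> paths. hist n \<omega> \<in> B i}" by metis
    then show ?case by (intro exI[of _ "\<Union>i. B i"]) auto
  qed
  ultimately show ?thesis unfolding S by blast
qed

lemma Fil_mono: "m \<le> n \<Longrightarrow> sets (Fil m) \<subseteq> sets (Fil n)"
proof -
  assume "m \<le> n"
  then have "drop (n - m) (hist n \<omega>) = hist m \<omega>" for \<omega>
    using drop_hist[of "n - m" m] by simp
  then have "{\<omega> \<in> paths. hist m \<omega> \<in> B} = {\<omega> \<in> paths. hist n \<omega> \<in> {h. drop (n - m) h \<in> B}}" for B
    by simp
  then show ?thesis unfolding sets_Fil by blast
qed

lemma sets_Fil_inf: "sets Fil_inf = sigma_sets paths (\<Union>n. sets (Fil n))"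
  unfolding Fil_inf_def by (rule sets_measure_of) (use sets.space_closed[of "Fil _"] in auto)

lemma sets_Fil_subset: "sets (Fil n) \<subseteq> sets Fil_inf"
  unfolding sets_Fil_inf by (auto intro: sigma_sets.Basic)

lemma hist_event: "{\<omega> \<in> paths. hist n \<omega> \<in> B} \<in> sets Fil_inf"
  using sets_Fil_subset[of n] by (auto simp: sets_Fil)

lemma measurable_hist:
  assumes "\<And>k. (\<lambda>x. f x k) \<in> M \<rightarrow>\<^sub>M count_space UNIV"
  shows "(\<lambda>x. hist n (f x)) \<in> M \<rightarrow>\<^sub>M count_space UNIV"
proof (subst measurable_count_space_eq2_countable, intro conjI ballI)
  fix h
  note [measurable] = assms
  have "(\<lambda>x. hist n (f x)) -` {h} \<inter> space M = {x \<in> space M. length h = Suc n \<and> (\<forall>k\<in>{..n}. f x k = h ! (n - k))}"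
    by (auto simp: hist_eq_iff nth_hist)
  also have "\<dots> \<in> sets M" by measurable
  finally show "(\<lambda>x. hist n (f x)) -` {h} \<inter> space M \<in> sets M" .
qed auto

lemma measurable_Fil_inf_coord: "(\<lambda>\<omega>. \<omega> k) \<in> Fil_inf \<rightarrow>\<^sub>M count_space UNIV"
proof (rule measurableI)
  fix A :: "int set"
  have "(\<lambda>\<omega>. \<omega> k) -` A \<inter> space Fil_inf = {\<omega> \<in> paths. hist k \<omega> \<in> {h. hd h \<in> A}}" by auto
  also have "\<dots> \<in> sets (Fil k)" unfolding sets_Fil by blast
  finally show "(\<lambda>\<omega>. \<omega> k) -` A \<inter> space Fil_inf \<in> sets Fil_inf" using sets_Fil_subset by blast
qed auto

lemma measurable_into_Fil_inf:
  assumes "f \<in> space M \<rightarrow> paths" "\<And>k. (\<lambda>x. f x k) \<in> M \<rightarrow>\<^sub>M count_space UNIV"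
  shows "f \<in> M \<rightarrow>\<^sub>M Fil_inf"
proof (rule measurable_sigma_sets[OF sets_Fil_inf _ assms(1)])
  fix A assume "A \<in> (\<Union>n. sets (Fil n))"
  then obtain n B where A: "A = {\<omega> \<in> paths. hist n \<omega> \<in> B}" by (auto simp: sets_Fil)
  have "f -` A \<inter> space M = (\<lambda>x. hist n (f x)) -` B \<inter> space M" using assms(1) by (auto simp: A)
  also have "\<dots> \<in> sets M" by (rule measurable_sets[OF measurable_hist[OF assms(2)]]) auto
  finally show "f -` A \<inter> space M \<in> sets M" .
qed (use sets.space_closed[of "Fil _"] in auto)

section \<open>Laws with prescribed cylinder probabilities\<close>

definition reachable :: "nat \<Rightarrow> int list set" where
  "reachable n = {h. reach h \<and> length h = Suc n}"

lemma reachable_0: "reachable 0 = {[0]}"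
  by (auto simp: reachable_def length_Suc_conv)

lemma reachable_Suc:
  "reachable (Suc n) = (\<lambda>h. (hd h + 1) # h) ` reachable n \<union> (\<lambda>h. (hd h - 1) # h) ` reachable n"
proof (intro equalityI subsetI)
  fix h assume "h \<in> reachable (Suc n)"
  then obtain x g where "h = x # g" "reach (x # g)" "length g = Suc n"
    by (auto simp: reachable_def length_Suc_conv)
  moreover from this have "g \<noteq> []" by auto
  ultimately have "g \<in> reachable n" "h = (hd g + 1) # g \<or> h = (hd g - 1) # g"
    by (auto simp: reachable_def reach_Cons)
  then show "h \<in> (\<lambda>h. (hd h + 1) # h) ` reachable n \<union> (\<lambda>h. (hd h - 1) # h) ` reachable n" by auto
qed (auto simp: reachable_def reach_up reach_down)

lemma finite_reachable: "finite (reachable n)"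
  by (induction n) (auto simp: reachable_0 reachable_Suc)

lemma avg_eq_sum: "avg n [0] f = (\<Sum>h\<in>reachable n. f h) / 2 ^ n"
proof (induction n arbitrary: f)
  case (Suc n)
  have "avg (Suc n) [0] f = avg n [0] (\<lambda>h. (f ((hd h + 1) # h) + f ((hd h - 1) # h)) / 2)"
    using avg_add[of n 1 "[0]" f] by simp
  also have "\<dots> = (\<Sum>h\<in>reachable n. f ((hd h + 1) # h) + f ((hd h - 1) # h)) / 2 ^ Suc n"
    by (simp add: Suc sum_divide_distrib)
  also have "(\<Sum>h\<in>reachable n. f ((hd h + 1) # h) + f ((hd h - 1) # h)) = (\<Sum>h\<in>reachable (Suc n). f h)"
    unfolding reachable_Suc sum.distrib
    by (subst sum.union_disjoint) (auto simp: finite_reachable sum.reindex inj_on_def)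
  finally show ?case .
qed (simp add: reachable_0)

text \<open>Conditioning on the first m steps. The newest entries come first, so dropping n of them
  recovers the history at time m.\<close>

lemma avg_drop:
  "avg (m + n) [0] (\<lambda>h. of_bool (drop n h \<in> B) * f h) = avg m [0] (\<lambda>g. of_bool (g \<in> B) * avg n g f)"
  unfolding avg_add
proof (rule avg_cong)
  fix u assume "length u = m" "reach (u @ [0])"
  have "avg n (u @ [0]) (\<lambda>h. of_bool (drop n h \<in> B) * f h) = avg n (u @ [0]) (\<lambda>h. of_bool (u @ [0] \<in> B) * f h)"
    using \<open>reach (u @ [0])\<close> by (intro avg_cong) auto
  then show "avg n (u @ [0]) (\<lambda>h. of_bool (drop n h \<in> B) * f h) = of_bool (u @ [0] \<in> B) * avg n (u @ [0]) f"
    by (simp only: avg_cmult)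
qed simp

text \<open>A common frame for the walk, with c = 1, and for the penalised law, with c =
  \<open>pen\<close>. By \<open>total\<close>, the cylinders of histories started at 0 carry the
  whole mass.\<close>

locale weighted_law = prob_space Q for Q :: "(nat \<Rightarrow> int) measure" +
  fixes c :: "int list \<Rightarrow> real"
  assumes sets_Q: "sets Q = sets Fil_inf"
    and cylinder: "\<And>n h. h \<in> reachable n \<Longrightarrow> measure Q {\<omega> \<in> paths. hist n \<omega> = h} = c h / 2 ^ n"
    and total: "\<And>n. avg n [0] c = 1"
begin

lemma space_Q [simp]: "space Q = paths"
  using sets_eq_imp_space_eq[OF sets_Q] by simp

lemma measurable_coord [measurable]: "(\<lambda>\<omega>. \<omega> k) \<in> Q \<rightarrow>\<^sub>M count_space UNIV"
  using measurable_Fil_inf_coord measurable_cong_sets[OF sets_Q refl] by blast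

lemma measurable_hist_Q [measurable]: "hist n \<in> Q \<rightarrow>\<^sub>M count_space UNIV"
  using measurable_hist[of "\<lambda>\<omega>. \<omega>" Q n] by simp

lemma AE_reachable: "AE \<omega> in Q. hist n \<omega> \<in> reachable n"
proof -
  have "prob {\<omega> \<in> space Q. hist n \<omega> \<in> reachable n} = (\<Sum>h\<in>reachable n. prob {\<omega> \<in> space Q. hist n \<omega> = h})"
  proof -
    have "{\<omega> \<in> space Q. hist n \<omega> \<in> reachable n} = (\<Union>h\<in>reachable n. {\<omega> \<in> space Q. hist n \<omega> = h})" by auto
    moreover have "prob (\<Union>h\<in>reachable n. {\<omega> \<in> space Q. hist n \<omega> = h}) = (\<Sum>h\<in>reachable n. prob {\<omega> \<in> space Q. hist n \<omega> = h})"
    proof (rule finite_measure_finite_Union[OF finite_reachable])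
      have "{\<omega> \<in> space Q. hist n \<omega> = h} \<in> sets Q" for h by measurable
      then show "(\<lambda>h. {\<omega> \<in> space Q. hist n \<omega> = h}) ` reachable n \<subseteq> events" by blast
    qed (auto simp: disjoint_family_on_def)
    ultimately show ?thesis by (simp only:)
  qed
  also have "\<dots> = avg n [0] c" by (simp add: avg_eq_sum cylinder sum_divide_distrib)
  finally have "prob {\<omega> \<in> space Q. hist n \<omega> \<in> reachable n} = 1" by (simp add: total)
  then have "AE \<omega> in Q. \<omega> \<in> {\<omega> \<in> space Q. hist n \<omega> \<in> reachable n}"
    by (subst prob_eq_1[symmetric]) (auto simp del: space_Q)
  then show ?thesis by auto
qed

lemma AE_start: "AE \<omega> in Q. \<omega> 0 = 0"
  using AE_reachable[of 0] by (simp add: reachable_0)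

lemma integral_hist:
  fixes f :: "int list \<Rightarrow> real"
  shows "integrable Q (\<lambda>\<omega>. f (hist n \<omega>))" "(\<integral>\<omega>. f (hist n \<omega>) \<partial>Q) = avg n [0] (\<lambda>h. f h * c h)"
proof -
  let ?s = "\<lambda>\<omega>. \<Sum>h\<in>reachable n. f h * indicator {\<omega> \<in> space Q. hist n \<omega> = h} \<omega>"
  have m: "(\<lambda>\<omega>. f (hist n \<omega>)) \<in> borel_measurable Q" "{\<omega> \<in> space Q. hist n \<omega> = h} \<in> sets Q" for h
    by measurable
  have e: "AE \<omega> in Q. f (hist n \<omega>) = ?s \<omega>"
    using AE_reachable[of n] AE_space
  proof eventually_elim
    case (elim \<omega>)
    have "?s \<omega> = (\<Sum>h\<in>reachable n. if h = hist n \<omega> then f h else 0)"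
      using elim by (intro sum.cong) (auto simp: indicator_def)
    then show ?case using elim finite_reachable[of n] by (simp add: sum.delta)
  qed
  have i: "integrable Q ?s"
    by (intro Bochner_Integration.integrable_sum) (use m(2) in \<open>auto simp: emeasure_eq_measure simp del: space_Q\<close>)
  then show "integrable Q (\<lambda>\<omega>. f (hist n \<omega>))"
    using e m(1) by (subst integrable_cong_AE[OF _ _ e]) auto
  have "(\<integral>\<omega>. f (hist n \<omega>) \<partial>Q) = (\<integral>\<omega>. ?s \<omega> \<partial>Q)"
    using m(1) e i by (intro integral_cong_AE) auto
  also have "\<dots> = (\<Sum>h\<in>reachable n. f h * prob {\<omega> \<in> space Q. hist n \<omega> = h})"
    using m(2) by (subst Bochner_Integration.integral_sum) (auto simp: emeasure_eq_measure simp del: space_Q)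
  also have "\<dots> = avg n [0] (\<lambda>h. f h * c h)"
    by (simp add: avg_eq_sum cylinder sum_divide_distrib)
  finally show "(\<integral>\<omega>. f (hist n \<omega>) \<partial>Q) = avg n [0] (\<lambda>h. f h * c h)" .
qed

lemma prob_hist: "prob {\<omega> \<in> paths. hist n \<omega> \<in> B} = avg n [0] (\<lambda>h. of_bool (h \<in> B) * c h)"
proof -
  have "prob {\<omega> \<in> paths. hist n \<omega> \<in> B} = (\<integral>\<omega>. indicator {\<omega> \<in> paths. hist n \<omega> \<in> B} \<omega> \<partial>Q)"
    by (auto intro!: arg_cong[where f = prob])
  also have "\<dots> = (\<integral>\<omega>. of_bool (hist n \<omega> \<in> B) \<partial>Q)"
    by (intro Bochner_Integration.integral_cong) (auto simp: indicator_def)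
  also have "\<dots> = avg n [0] (\<lambda>h. of_bool (h \<in> B) * c h)" by (rule integral_hist(2))
  finally show ?thesis .
qed

lemma prob_extension:
  assumes "h \<in> reachable k"
  shows "prob {\<omega> \<in> paths. hist k \<omega> = h \<and> hist (k + n) \<omega> \<in> B} = avg n h (\<lambda>g. of_bool (g \<in> B) * c g) / 2 ^ k"
proof -
  let ?f = "\<lambda>g. of_bool (g \<in> B) * c g"
  have "prob {\<omega> \<in> paths. hist k \<omega> = h \<and> hist (k + n) \<omega> \<in> B} = prob {\<omega> \<in> paths. hist (k + n) \<omega> \<in> {g. drop n g = h \<and> g \<in> B}}"
    by (simp add: drop_hist)
  also have "\<dots> = avg (k + n) [0] (\<lambda>g. of_bool (drop n g \<in> {h}) * ?f g)"
    unfolding prob_hist by (auto intro!: arg_cong[where f = "avg _ _"] simp: of_bool_def)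
  also have "\<dots> = avg k [0] (\<lambda>g. if g = h then avg n h ?f else 0)"
    unfolding avg_drop by (auto intro!: arg_cong[where f = "avg _ _"])
  also have "\<dots> = avg n h ?f / 2 ^ k"
    using assms finite_reachable[of k] by (simp add: avg_eq_sum sum.delta)
  finally show ?thesis .
qed

end

section \<open>Paths driven by independent inputs\<close>

text \<open>Each step depends on the whole past and on one fresh independent input, which is enough
  to realise prescribed conditional step probabilities.\<close>

primrec drive :: "(int list \<Rightarrow> 'b \<Rightarrow> int) \<Rightarrow> (nat \<Rightarrow> 'b) \<Rightarrow> nat \<Rightarrow> int list" where
  "drive st \<xi> 0 = [0]"
| "drive st \<xi> (Suc n) = (hd (drive st \<xi> n) + st (drive st \<xi> n) (\<xi> n)) # drive st \<xi> n"

lemma hist_drive: "hist n (\<lambda>k. hd (drive st \<xi> k)) = drive st \<xi> n"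
  by (induction n) auto

text \<open>The inputs that produce a given history form a box in the product space, and its measure
  telescopes to c h / 2^n. Condition \<open>c_st\<close> is a product and not a quotient, so
  histories of weight 0 need no separate treatment.\<close>

lemma driven_law:
  fixes \<nu> :: "'b measure" and st :: "int list \<Rightarrow> 'b \<Rightarrow> int" and c :: "int list \<Rightarrow> real"
  assumes \<nu>: "prob_space \<nu>"
    and st: "\<And>h. st h \<in> \<nu> \<rightarrow>\<^sub>M count_space UNIV" "\<And>h b. b \<in> space \<nu> \<Longrightarrow> \<bar>st h b\<bar> = 1"
    and c0: "c [0] = 1"
    and c_harm: "\<And>h. reach h \<Longrightarrow> c ((hd h + 1) # h) + c ((hd h - 1) # h) = 2 * c h"
    and c_st: "\<And>h x. reach (x # h) \<Longrightarrow> h \<noteq> [] \<Longrightarrow> c (x # h) = 2 * c h * measure \<nu> {b \<in> space \<nu>. st h b = x - hd h}"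
  shows "weighted_law (distr (\<Pi>\<^sub>M i\<in>(UNIV::nat set). \<nu>) Fil_inf (\<lambda>\<xi> k. hd (drive st \<xi> k))) c"
proof -
  interpret \<nu>: prob_space \<nu> by (rule \<nu>)
  let ?P = "\<Pi>\<^sub>M i\<in>(UNIV::nat set). \<nu>"
  interpret P: product_prob_space "\<lambda>_. \<nu>" "UNIV :: nat set" by (rule product_prob_spaceI) (rule \<nu>)
  have meas_drive: "(\<lambda>\<xi>. drive st \<xi> n) \<in> ?P \<rightarrow>\<^sub>M count_space UNIV" for n
  proof (induction n)
    case (Suc n)
    note [measurable] = Suc st(1)
    have "(\<lambda>\<xi>. (hd h + st h (\<xi> n)) # h) \<in> ?P \<rightarrow>\<^sub>M count_space UNIV" for h
      by measurable
    from measurable_compose_countable[OF this Suc] show ?case by simp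
  qed simp
  have path: "(\<lambda>k. hd (drive st \<xi> k)) \<in> paths" if "\<xi> \<in> space ?P" for \<xi>
    using that st(2) by (auto simp: paths_def space_PiM)
  have meas: "(\<lambda>\<xi> k. hd (drive st \<xi> k)) \<in> ?P \<rightarrow>\<^sub>M Fil_inf"
    using path measurable_compose[OF meas_drive, of hd "count_space UNIV"] by (intro measurable_into_Fil_inf) auto
  have box: "\<exists>A. (\<forall>i. A i \<in> sets \<nu>) \<and> (\<forall>\<xi>\<in>space ?P. drive st \<xi> n = h \<longleftrightarrow> (\<forall>i<n. \<xi> i \<in> A i))
      \<and> (\<Prod>i<n. measure \<nu> (A i)) = c h / 2 ^ n" if "h \<in> reachable n" for n h
    using that
  proof (induction n arbitrary: h)
    case 0
    then show ?case by (intro exI[of _ "\<lambda>_. {}"]) (simp add: reachable_0 c0)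
  next
    case (Suc n)
    then obtain x g where h': "h = x # g" "reach (x # g)" "length g = Suc n"
      by (auto simp: reachable_def length_Suc_conv)
    then have "g \<noteq> []" by auto
    with h' have h: "h = x # g" "reach (x # g)" "g \<noteq> []" "g \<in> reachable n"
      by (auto simp: reachable_def reach_Cons)
    obtain A where A: "\<And>i. A i \<in> sets \<nu>" "\<And>\<xi>. \<xi> \<in> space ?P \<Longrightarrow> drive st \<xi> n = g \<longleftrightarrow> (\<forall>i<n. \<xi> i \<in> A i)"
      "(\<Prod>i<n. measure \<nu> (A i)) = c g / 2 ^ n"
      using Suc.IH[OF h(4)] by auto
    define B where "B = {b \<in> space \<nu>. st g b = x - hd g}"
    note [measurable] = st(1)
    have B: "B \<in> sets \<nu>" unfolding B_def by measurable
    have eq: "(\<Prod>i<n. measure \<nu> ((A(n := B)) i)) = (\<Prod>i<n. measure \<nu> (A i))"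
      by (intro prod.cong) auto
    show ?case
    proof (intro exI[of _ "A(n := B)"] conjI allI ballI)
      fix \<xi> assume \<xi>: "\<xi> \<in> space ?P"
      then have "\<xi> n \<in> space \<nu>" by (auto simp: space_PiM)
      then show "drive st \<xi> (Suc n) = h \<longleftrightarrow> (\<forall>i<Suc n. \<xi> i \<in> (A(n := B)) i)"
        using A(2)[OF \<xi>] by (auto simp: h(1) less_Suc_eq B_def)
    next
      show "(\<Prod>i<Suc n. measure \<nu> ((A(n := B)) i)) = c h / 2 ^ Suc n"
        using c_st[OF h(2,3)] by (simp add: eq A(3) h(1) B_def)
    qed (use A B in auto)
  qed
  show ?thesis
  proof (intro weighted_law.intro weighted_law_axioms.intro)
    show "prob_space (distr ?P Fil_inf (\<lambda>\<xi> k. hd (drive st \<xi> k)))"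
      by (rule P.prob_space_distr) (rule meas)
    show "avg n [0] c = 1" for n
      using avg_harmonic[of reach c "[0]" n] c_harm c0 by (simp add: reach_up reach_down)
    fix n h assume h: "h \<in> reachable n"
    obtain A where A: "\<And>i. A i \<in> sets \<nu>" "\<And>\<xi>. \<xi> \<in> space ?P \<Longrightarrow> drive st \<xi> n = h \<longleftrightarrow> (\<forall>i<n. \<xi> i \<in> A i)"
      "(\<Prod>i<n. measure \<nu> (A i)) = c h / 2 ^ n"
      using box[OF h] by auto
    have e: "{\<omega> \<in> paths. hist n \<omega> = h} \<in> sets Fil_inf"
      using hist_event[of n "{h}"] by simp
    have "measure (distr ?P Fil_inf (\<lambda>\<xi> k. hd (drive st \<xi> k))) {\<omega> \<in> paths. hist n \<omega> = h}
      = measure ?P {\<xi> \<in> space ?P. \<forall>i\<in>{..<n}. \<xi> i \<in> A i}"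
      using path A(2) by (subst measure_distr[OF meas e]) (auto intro!: arg_cong[where f = "measure ?P"] simp: hist_drive)
    also have "\<dots> = (\<Prod>i<n. measure \<nu> (A i))"
      using P.emeasure_PiM_Collect[of "{..<n}" A] A(1)
      by (simp add: P.emeasure_eq_measure \<nu>.emeasure_eq_measure prod_ennreal measure_nonneg prod_nonneg)
    finally show "measure (distr ?P Fil_inf (\<lambda>\<xi> k. hd (drive st \<xi> k))) {\<omega> \<in> paths. hist n \<omega> = h} = c h / 2 ^ n"
      using A(3) by simp
  qed simp
qed

interpretation walk: weighted_law walk "\<lambda>_. 1"
proof -
  let ?\<nu> = "uniform_count_measure {-1, 1::int}"
  have \<nu>: "prob_space ?\<nu>" by (rule prob_space_uniform_count_measure) auto
  have sp: "space ?\<nu> = {-1, 1}" by (simp add: uniform_count_measure_def space_point_measure)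
  have e: "hd (drive (\<lambda>_ b. b) \<xi> n) = (\<Sum>k<n. \<xi> k)" for \<xi> n
    by (induction n) auto
  have "weighted_law (distr (\<Pi>\<^sub>M i\<in>(UNIV::nat set). ?\<nu>) Fil_inf (\<lambda>\<xi> k. hd (drive (\<lambda>_ b. b) \<xi> k))) (\<lambda>_. 1)"
  proof (rule driven_law[OF \<nu>])
    show "(\<lambda>b. b) \<in> ?\<nu> \<rightarrow>\<^sub>M count_space UNIV"
      by (auto simp: measurable_def uniform_count_measure_def sets_point_measure space_point_measure)
    fix h :: "int list" and x :: int assume "reach (x # h)" "h \<noteq> []"
    then have "\<bar>x - hd h\<bar> = 1" by (simp add: reach_Cons)
    then have "{b \<in> space ?\<nu>. b = x - hd h} = {x - hd h}" "{x - hd h} \<subseteq> {-1, 1}" by (auto simp: sp)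
    then have "measure ?\<nu> {b \<in> space ?\<nu>. b = x - hd h} = 1 / 2"
      using measure_uniform_count_measure[of "{-1, 1::int}" "{x - hd h}"] by simp
    then show "(1::real) = 2 * 1 * measure ?\<nu> {b \<in> space ?\<nu>. b = x - hd h}" by simp
  qed (auto simp: sp)
  then show "weighted_law walk (\<lambda>_. 1)" unfolding walk_def by (simp add: e)
qed

declare walk.measurable_coord [measurable del]

context weight
begin

lemma is_penalised_iff: "is_penalised \<phi> Q \<longleftrightarrow> weighted_law Q pen"
proof
  assume Q: "is_penalised \<phi> Q"
  then interpret prob_space Q by (simp add: is_penalised_def)
  show "weighted_law Q pen"
  proof (intro weighted_law.intro weighted_law_axioms.intro prob_space_axioms)
    fix n h assume h: "h \<in> reachable n"
    have "measure Q {\<omega> \<in> paths. hist n \<omega> \<in> {h}} = (\<integral>\<omega>. indicator {\<omega> \<in> paths. hist n \<omega> \<in> {h}} \<omega> * Mart \<phi> n \<omega> \<partial>walk)"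
      using Q unfolding is_penalised_def sets_Fil by blast
    also have "\<dots> = (\<integral>\<omega>. of_bool (hist n \<omega> = h) * pen (hist n \<omega>) \<partial>walk)"
      by (intro Bochner_Integration.integral_cong) (auto simp: Mart_hist indicator_def)
    also have "\<dots> = (\<Sum>g\<in>reachable n. of_bool (g = h) * pen g) / 2 ^ n"
      by (simp add: walk.integral_hist(2)[of "\<lambda>g. of_bool (g = h) * pen g"] avg_eq_sum)
    also have "\<dots> = pen h / 2 ^ n"
      using h finite_reachable[of n] by (simp add: of_bool_def if_distrib[of "\<lambda>x. x * _"] sum.delta cong: if_cong)
    finally show "measure Q {\<omega> \<in> paths. hist n \<omega> = h} = pen h / 2 ^ n" by simp
  qed (use Q in \<open>auto simp: is_penalised_def avg_pen pen_start\<close>)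
next
  assume "weighted_law Q pen"
  then interpret weighted_law Q pen .
  show "is_penalised \<phi> Q"
    unfolding is_penalised_def
  proof (intro conjI allI ballI prob_space_axioms sets_Q)
    fix n \<Lambda> assume "\<Lambda> \<in> sets (Fil n)"
    then obtain B where B: "\<Lambda> = {\<omega> \<in> paths. hist n \<omega> \<in> B}" by (auto simp: sets_Fil)
    have "(\<integral>\<omega>. indicator \<Lambda> \<omega> * Mart \<phi> n \<omega> \<partial>walk) = (\<integral>\<omega>. of_bool (hist n \<omega> \<in> B) * pen (hist n \<omega>) \<partial>walk)"
      by (intro Bochner_Integration.integral_cong) (auto simp: Mart_hist indicator_def B)
    then show "prob \<Lambda> = (\<integral>\<omega>. indicator \<Lambda> \<omega> * Mart \<phi> n \<omega> \<partial>walk)"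
      by (simp add: B prob_hist walk.integral_hist(2)[of "\<lambda>g. of_bool (g \<in> B) * pen g"])
  qed
qed

lemma penalised_exists: "\<exists>Q. weighted_law Q pen"
proof -
  \<comment> \<open>The conditional probability of a step up under Q. If \<open>pen h\<close> is 0,
    division by 0 gives p h = 0; both continuations then have weight 0 by harmonicity and
    nonnegativity, so any choice would do.\<close>
  define p where "p h = pen ((hd h + 1) # h) / (2 * pen h)" for h
  have p: "0 \<le> p h" "p h \<le> 1" "pen ((hd h + 1) # h) = 2 * pen h * p h"
    "pen ((hd h - 1) # h) = 2 * pen h * (1 - p h)" if "reach h" for h
  proof -
    have n: "pen h \<ge> 0" "pen ((hd h + 1) # h) \<ge> 0" "pen ((hd h - 1) # h) \<ge> 0"
      using that by (auto intro!: pen_nonneg reach_up reach_down)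
    note harm = pen_harmonic[OF that]
    show "0 \<le> p h" using n by (simp add: p_def)
    show "p h \<le> 1" using n harm by (cases "pen h = 0") (auto simp: p_def divide_le_eq)
    show u: "pen ((hd h + 1) # h) = 2 * pen h * p h" using n harm by (cases "pen h = 0") (auto simp: p_def)
    show "pen ((hd h - 1) # h) = 2 * pen h * (1 - p h)" using u harm by (simp add: algebra_simps)
  qed
  define st :: "int list \<Rightarrow> real \<Rightarrow> int" where "st h u = (if u \<le> p h then 1 else -1)" for h u
  let ?\<nu> = "uniform_measure lborel {0..1::real}"
  interpret \<nu>: prob_space ?\<nu> by (rule prob_space_uniform_measure) auto
  have up: "measure ?\<nu> {u. u \<le> p h} = p h" if "reach h" for h
  proof -
    have "{0..1} \<inter> {u. u \<le> p h} = {0..p h}" using p(2)[OF that] by auto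
    then show ?thesis using p(1)[OF that] by (simp add: measure_uniform_measure)
  qed
  have dn: "measure ?\<nu> {u. \<not> u \<le> p h} = 1 - p h" if "reach h" for h
  proof -
    have "{u. \<not> u \<le> p h} = space ?\<nu> - {u. u \<le> p h}" by auto
    then show ?thesis using \<nu>.prob_compl[of "{u. u \<le> p h}"] up[OF that] by simp
  qed
  have "weighted_law (distr (\<Pi>\<^sub>M i\<in>(UNIV::nat set). ?\<nu>) Fil_inf (\<lambda>\<xi> k. hd (drive st \<xi> k))) pen"
  proof (rule driven_law[OF \<nu>.prob_space_axioms])
    show "st h \<in> ?\<nu> \<rightarrow>\<^sub>M count_space UNIV" for h unfolding st_def by measurable
    show "\<bar>st h b\<bar> = 1" for h b by (simp add: st_def)
    fix h x assume "reach (x # h)" and h: "h \<noteq> []"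
    then have r: "reach h" and x: "x = hd h + 1 \<or> x = hd h - 1" by (auto simp: reach_Cons)
    have "{b \<in> space ?\<nu>. st h b = 1} = {u. u \<le> p h}" "{b \<in> space ?\<nu>. st h b = -1} = {u. \<not> u \<le> p h}"
      by (auto simp: st_def split: if_splits)
    then show "pen (x # h) = 2 * pen h * measure ?\<nu> {b \<in> space ?\<nu>. st h b = x - hd h}"
      using x up[OF r] dn[OF r] p(3,4)[OF r] by auto
  qed (auto simp: pen_start pen_harmonic)
  then show ?thesis by blast
qed

lemma penalised_unique:
  assumes "weighted_law Q pen" "weighted_law Q' pen"
  shows "Q = Q'"
proof -
  interpret Q: weighted_law Q pen by (rule assms)
  interpret Q': weighted_law Q' pen by (rule assms)
  show ?thesis
  proof (rule measure_eqI_generator_eq[where E = "\<Union>n. sets (Fil n)" and \<Omega> = paths and A = "\<lambda>_. paths"])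
    show "Int_stable (\<Union>n. sets (Fil n))"
    proof (rule Int_stableI)
      fix a b assume "a \<in> (\<Union>n. sets (Fil n))" "b \<in> (\<Union>n. sets (Fil n))"
      then obtain m n where "a \<in> sets (Fil m)" "b \<in> sets (Fil n)" by auto
      then have "a \<in> sets (Fil (max m n))" "b \<in> sets (Fil (max m n))"
        using Fil_mono[of m "max m n"] Fil_mono[of n "max m n"] by auto
      then show "a \<inter> b \<in> (\<Union>n. sets (Fil n))" by blast
    qed
    show "emeasure Q X = emeasure Q' X" if "X \<in> (\<Union>n. sets (Fil n))" for X
    proof -
      obtain n B where "X = {\<omega> \<in> paths. hist n \<omega> \<in> B}" using \<open>X \<in> _\<close> by (auto simp: sets_Fil)
      then show ?thesis by (simp add: Q.emeasure_eq_measure Q'.emeasure_eq_measure Q.prob_hist Q'.prob_hist)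
    qed
    show "range (\<lambda>_. paths) \<subseteq> (\<Union>n. sets (Fil n))"
      using sets.top[of "Fil 0"] by auto
    show "(\<Union>n. sets (Fil n)) \<subseteq> Pow paths" by (auto simp: sets_Fil)
  qed (auto simp: Q.sets_Q Q'.sets_Q sets_Fil_inf Q.emeasure_eq_measure)
qed

end

section \<open>The last zero and the successive zeros of a path\<close>

definition last_zero_at :: "nat \<Rightarrow> (nat \<Rightarrow> int) \<Rightarrow> bool" where
  "last_zero_at L \<omega> \<longleftrightarrow> \<omega> L = 0 \<and> (\<forall>i>L. \<omega> i \<noteq> 0)"

lemma last_zero_at_eq:
  assumes "last_zero_at L \<omega>"
  shows "last_zero \<omega> = ereal (real L)" "last_zero_time \<omega> = L"
proof -
  show e: "last_zero \<omega> = ereal (real L)"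
    unfolding last_zero_def
  proof (rule SUP_eqI)
    show "ereal (real k) \<le> ereal (real L)" if "k \<in> {k. \<omega> k = 0}" for k
      using assms that by (auto simp: last_zero_at_def not_less[symmetric])
    show "ereal (real L) \<le> y" if "\<And>k. k \<in> {k. \<omega> k = 0} \<Longrightarrow> ereal (real k) \<le> y" for y
      using assms that[of L] by (auto simp: last_zero_at_def)
  qed
  show "last_zero_time \<omega> = L" by (simp add: last_zero_time_def e)
qed

lemma last_zero_cases:
  obtains L where "last_zero_at L \<omega>" | "\<And>L. \<not> last_zero_at L \<omega>" "last_zero \<omega> = -\<infinity> \<or> last_zero \<omega> = \<infinity>" "last_zero_time \<omega> = 0"
proof -
  let ?Z = "{k. \<omega> k = 0}"
  consider "?Z = {}" | "?Z \<noteq> {}" "finite ?Z" | "infinite ?Z" by auto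
  then show ?thesis
  proof cases
    case 1
    then have "last_zero \<omega> = -\<infinity>" unfolding last_zero_def by (simp add: bot_ereal_def)
    then show ?thesis using 1 that(2) by (auto simp: last_zero_at_def last_zero_time_def)
  next
    case 2
    then have "last_zero_at (Max ?Z) \<omega>"
      using Max_in[of ?Z] Max_ge[of ?Z] unfolding last_zero_at_def by (fastforce simp: not_less[symmetric])
    then show ?thesis by (rule that(1))
  next
    case 3
    have "last_zero \<omega> = \<infinity>" unfolding last_zero_def
    proof (rule SUP_PInfty)
      fix n :: nat
      obtain k where "k > n" "k \<in> ?Z" using 3 infinite_nat_iff_unbounded by blast
      then show "\<exists>k\<in>?Z. ereal (real n) \<le> ereal (real k)" by (intro bexI[of _ k]) auto
    qed
    moreover have "\<not> last_zero_at L \<omega>" for L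
      using 3 infinite_nat_iff_unbounded[of ?Z] by (auto simp: last_zero_at_def)
    ultimately show ?thesis using that(2) by (auto simp: last_zero_time_def)
  qed
qed

text \<open>In this form \<open>last_zero_time\<close> is built from countably many measurable
  predicates, which gives its measurability.\<close>

lemma last_zero_time_eq:
  "last_zero_time \<omega> = (if \<exists>L. last_zero_at L \<omega> then LEAST L. last_zero_at L \<omega> else 0)"
proof (cases rule: last_zero_cases[of \<omega>])
  case (1 L)
  have "(LEAST L. last_zero_at L \<omega>) = L"
    using 1 last_zero_at_eq(2) by (intro Least_equality) (auto dest!: last_zero_at_eq(2))
  then show ?thesis using 1 last_zero_at_eq(2)[OF 1] by auto
qed auto

lemma last_zero_finite_iff: "0 \<le> last_zero \<omega> \<and> last_zero \<omega> < \<infinity> \<longleftrightarrow> (\<exists>L. last_zero_at L \<omega>)"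
proof (cases rule: last_zero_cases[of \<omega>])
  case (1 L)
  then show ?thesis using last_zero_at_eq(1)[OF 1] by auto
qed auto

lemma count_hist_mono: "m \<le> n \<Longrightarrow> count_list (hist m \<omega>) 0 \<le> count_list (hist n \<omega>) 0"
  by (induction rule: dec_induct) auto

lemma count_hist_le_iff:
  "count_list (hist (k + n) \<omega>) 0 \<le> count_list (hist k \<omega>) 0 \<longleftrightarrow> (\<forall>i. k < i \<and> i \<le> k + n \<longrightarrow> \<omega> i \<noteq> 0)"
proof (induction n)
  case (Suc n)
  have "(\<forall>i. k < i \<and> i \<le> k + Suc n \<longrightarrow> \<omega> i \<noteq> 0) \<longleftrightarrow> (\<forall>i. k < i \<and> i \<le> k + n \<longrightarrow> \<omega> i \<noteq> 0) \<and> \<omega> (Suc (k + n)) \<noteq> 0"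
    by (auto simp: le_Suc_eq)
  then show ?case using Suc count_hist_mono[of k "k + n" \<omega>] by auto
qed auto

text \<open>Histories that stop exactly at their a-th zero. A path has at most one of them for each
  a, so their cylinders are disjoint and probabilities become sums over histories.\<close>

definition zero_hist :: "nat \<Rightarrow> int list set" where
  "zero_hist a = {w. reach w \<and> hd w = 0 \<and> count_list w 0 = a}"

lemma zero_hist_unique_aux:
  assumes "hist m \<omega> \<in> zero_hist a" "hist n \<omega> \<in> zero_hist a" "m < n"
  shows False
proof -
  obtain k where k: "n = Suc k" "m \<le> k" using assms(3) by (cases n) auto
  then show False using assms count_hist_mono[of m k \<omega>] by (auto simp: zero_hist_def)
qed

lemma zero_hist_unique: "hist m \<omega> \<in> zero_hist a \<Longrightarrow> hist n \<omega> \<in> zero_hist a \<Longrightarrow> m = n"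
  using zero_hist_unique_aux by (metis linorder_neqE_nat)

lemma tau_eq:
  assumes "hist L \<omega> \<in> zero_hist a"
  shows "tau a \<omega> = enat L"
  unfolding tau_def
proof (rule INF_eqI)
  have L: "zeros L \<omega> = a" "\<omega> L = 0" using assms by (auto simp: zero_hist_def zeros_hist)
  show "enat L \<le> enat n" if "n \<in> {n. zeros n \<omega> = a}" for n
  proof (rule ccontr)
    assume "\<not> enat L \<le> enat n"
    then obtain k where k: "L = Suc k" "n \<le> k" by (cases L) auto
    then show False using L that count_hist_mono[of n k \<omega>] by (simp add: zeros_hist)
  qed
  show "y \<le> enat L" if "\<And>n. n \<in> {n. zeros n \<omega> = a} \<Longrightarrow> y \<le> enat n" for y
    using that[of L] L by simp
qed

text \<open>Turns the event that the a-th zero has occurred with maximum at most k into an event of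
  the history at the fixed time n, whose probability is a value of \<open>avg\<close>.\<close>

lemma zero_hist_iff_stopped:
  assumes "\<omega> \<in> paths" "\<omega> 0 = 0" "a \<ge> 1"
  shows "(\<exists>L\<le>n. hist L \<omega> \<in> zero_hist a \<and> mx (hist L \<omega>) \<le> k) \<longleftrightarrow>
    count_list (hist n \<omega>) 0 \<ge> a \<and> stopped_mx a (hist n \<omega>) \<le> k"
proof (induction n)
  case 0
  then show ?case using assms by (auto simp: zero_hist_def)
next
  case (Suc n)
  have r: "reach (hist (Suc n) \<omega>)" using assms reach_hist by blast
  have split: "(\<exists>L\<le>Suc n. P L) \<longleftrightarrow> (\<exists>L\<le>n. P L) \<or> P (Suc n)" for P
    by (auto simp: le_Suc_eq)
  show ?case
  proof (cases "count_list (hist n \<omega>) 0 \<ge> a")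
    case True
    then have "hist (Suc n) \<omega> \<notin> zero_hist a" by (auto simp: zero_hist_def)
    then show ?thesis using Suc True split by auto
  next
    case False
    then show ?thesis unfolding split using Suc r by (auto simp: zero_hist_def)
  qed
qed

definition hits :: "int list set \<Rightarrow> (nat \<Rightarrow> int) set" where
  "hits B = {\<omega> \<in> paths. \<exists>L. hist L \<omega> \<in> B}"

definition ends :: "int list set \<Rightarrow> (nat \<Rightarrow> int) set" where
  "ends B = {\<omega> \<in> paths. \<exists>L. hist L \<omega> \<in> B \<and> last_zero_at L \<omega>}"

section \<open>The walk stopped at its successive zeros\<close>

context weighted_law
begin

lemma sets_hist: "{\<omega> \<in> paths. hist n \<omega> \<in> B} \<in> sets Q"
  by (simp add: sets_Q hist_event)

lemma sets_hits: "hits B \<in> sets Q"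
proof -
  have "hits B = (\<Union>L. {\<omega> \<in> paths. hist L \<omega> \<in> B})" by (auto simp: hits_def)
  then show ?thesis using sets_hist by auto
qed

lemma pred_last_zero_at [measurable]: "Measurable.pred Q (last_zero_at L)"
  unfolding last_zero_at_def[abs_def] by measurable

lemma sets_ends: "ends B \<in> sets Q"
proof -
  have "ends B = (\<Union>L. {\<omega> \<in> space Q. hist L \<omega> \<in> B \<and> last_zero_at L \<omega>})" by (auto simp: ends_def)
  also have "\<dots> \<in> sets Q" by measurable
  finally show ?thesis .
qed

lemma measurable_last_zero_time [measurable]: "last_zero_time \<in> Q \<rightarrow>\<^sub>M count_space UNIV"
  unfolding last_zero_time_eq[abs_def] by measurable

lemma measurable_last_hist [measurable]: "(\<lambda>\<omega>. hist (last_zero_time \<omega>) \<omega>) \<in> Q \<rightarrow>\<^sub>M count_space UNIV"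
  by (rule measurable_compose_countable[OF _ measurable_last_zero_time]) measurable

lemma measurable_after [measurable]: "(\<lambda>\<omega>. \<omega> (last_zero_time \<omega> + 1 + n)) \<in> Q \<rightarrow>\<^sub>M count_space UNIV"
  by (rule measurable_compose_countable[OF _ measurable_last_zero_time, where f = "\<lambda>L \<omega>. \<omega> (L + 1 + n)"]) measurable

end

text \<open>Written as a sum over histories so that \<open>prob_ends\<close> can compare it term by
  term with the penalised law.\<close>

lemma emeasure_hits:
  assumes "B \<subseteq> zero_hist a"
  shows "emeasure walk (hits B) = (\<integral>\<^sup>+w. ennreal (1 / 2 ^ (length w - 1)) \<partial>count_space B)"
proof -
  have "hits B = (\<Union>w\<in>B. hits {w})" by (auto simp: hits_def)
  moreover have "disjoint_family_on (\<lambda>w. hits {w}) B"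
    unfolding disjoint_family_on_def
  proof (intro ballI impI)
    fix w w' assume w: "w \<in> B" "w' \<in> B" "w \<noteq> w'"
    have False if \<omega>: "hist m \<omega> = w" "hist n \<omega> = w'" for m n \<omega>
      using zero_hist_unique[of m \<omega> a n] \<omega> w assms by auto
    then show "hits {w} \<inter> hits {w'} = {}" by (auto simp: hits_def)
  qed
  moreover have "hits {w} \<in> sets walk" for w by (rule walk.sets_hits)
  ultimately have "emeasure walk (hits B) = (\<integral>\<^sup>+w. emeasure walk (hits {w}) \<partial>count_space B)"
    by (simp add: emeasure_UN_countable)
  also have "\<dots> = (\<integral>\<^sup>+w. ennreal (1 / 2 ^ (length w - 1)) \<partial>count_space B)"
  proof (rule nn_integral_cong)
    fix w assume "w \<in> space (count_space B)"
    then have w: "w \<in> zero_hist a" using assms by auto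
    then have r: "w \<in> reachable (length w - 1)" by (cases w) (auto simp: zero_hist_def reachable_def)
    have "hits {w} = {\<omega> \<in> paths. hist (length w - 1) \<omega> = w}"
      by (auto simp: hits_def)
    then show "emeasure walk (hits {w}) = ennreal (1 / 2 ^ (length w - 1))"
      using walk.cylinder[OF r] by (simp add: walk.emeasure_eq_measure)
  qed
  finally show ?thesis .
qed

lemma prob_hits_le:
  assumes "a \<ge> 1"
  shows "measure walk (hits {w \<in> zero_hist a. mx w \<le> int k}) = (1 - 1 / (2 * (real k + 1))) ^ (a - 1)"
proof (rule LIMSEQ_unique[OF _ avg_stopped_mx_tendsto[OF assms]])
  let ?A = "\<lambda>n. {\<omega> \<in> paths. \<exists>L\<le>n. hist L \<omega> \<in> {w \<in> zero_hist a. mx w \<le> int k}}"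
  have "?A n = (\<Union>L\<in>{..n}. {\<omega> \<in> paths. hist L \<omega> \<in> {w \<in> zero_hist a. mx w \<le> int k}})" for n by auto
  then have A: "?A n \<in> sets walk" for n using walk.sets_hist by (auto simp del: mem_Collect_eq)
  have "(\<lambda>n. measure walk (?A n)) \<longlonglongrightarrow> measure walk (\<Union>n. ?A n)"
  proof (rule walk.finite_Lim_measure_incseq)
    show "incseq ?A" unfolding incseq_def using order_trans by blast
  qed (use A in blast)
  also have "(\<Union>n. ?A n) = hits {w \<in> zero_hist a. mx w \<le> int k}" by (auto simp: hits_def)
  finally have "(\<lambda>n. measure walk (?A n)) \<longlonglongrightarrow> measure walk (hits {w \<in> zero_hist a. mx w \<le> int k})" .
  moreover have "measure walk (?A n) = avg n [0] (\<lambda>g. of_bool (count_list g 0 \<ge> a \<and> stopped_mx a g \<le> int k))" for n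
  proof -
    let ?B = "{g. count_list g 0 \<ge> a \<and> stopped_mx a g \<le> int k}"
    have "measure walk (?A n) = measure walk {\<omega> \<in> paths. hist n \<omega> \<in> ?B}"
    proof (rule walk.finite_measure_eq_AE[OF _ A walk.sets_hist])
      show "AE \<omega> in walk. (\<omega> \<in> ?A n) = (\<omega> \<in> {\<omega> \<in> paths. hist n \<omega> \<in> ?B})"
        using walk.AE_start AE_space
      proof eventually_elim
        case (elim \<omega>)
        then show ?case using zero_hist_iff_stopped[of \<omega> a n "int k"] assms by simp
      qed
    qed
    then show ?thesis unfolding walk.prob_hist by simp
  qed
  ultimately show "(\<lambda>n. avg n [0] (\<lambda>g. of_bool (count_list g 0 \<ge> a \<and> stopped_mx a g \<le> int k)))
      \<longlonglongrightarrow> measure walk (hits {w \<in> zero_hist a. mx w \<le> int k})" by simp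
qed

text \<open>A difference of two consecutive values of the distribution function. For k = 0 nothing
  is subtracted, because the maximum at a zero is never negative.\<close>

lemma prob_hits_eq:
  assumes "a \<ge> 1"
  shows "measure walk (hits {w \<in> zero_hist a. mx w = int k}) =
    (if k = 0 then (1/2) ^ (a - 1)
     else (1 - 1 / (2 * (real k + 1))) ^ (a - 1) - (1 - 1 / (2 * real k)) ^ (a - 1))"
proof (cases k)
  case 0
  have "{w \<in> zero_hist a. mx w = int k} = {w \<in> zero_hist a. mx w \<le> int k}"
    using mx_nonneg by (force simp: 0 zero_hist_def)
  then show ?thesis using prob_hits_le[OF assms, of k] by (simp add: 0)
next
  case (Suc j)
  have "hits {w \<in> zero_hist a. mx w \<le> int k} = hits {w \<in> zero_hist a. mx w = int k} \<union> hits {w \<in> zero_hist a. mx w \<le> int j}"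
  proof -
    have "{w \<in> zero_hist a. mx w \<le> int k} = {w \<in> zero_hist a. mx w = int k} \<union> {w \<in> zero_hist a. mx w \<le> int j}"
      by (auto simp: Suc)
    then show ?thesis by (auto simp: hits_def)
  qed
  moreover have "hits {w \<in> zero_hist a. mx w = int k} \<inter> hits {w \<in> zero_hist a. mx w \<le> int j} = {}"
    using zero_hist_unique by (fastforce simp: hits_def Suc)
  ultimately have "measure walk (hits {w \<in> zero_hist a. mx w \<le> int k}) =
      measure walk (hits {w \<in> zero_hist a. mx w = int k}) + measure walk (hits {w \<in> zero_hist a. mx w \<le> int j})"
    using walk.sets_hits by (simp add: walk.finite_measure_Union)
  then show ?thesis using prob_hits_le[OF assms, of k] prob_hits_le[OF assms, of j] by (simp add: Suc add.commute)
qed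

lemma AE_hits:
  assumes "a \<ge> 1"
  shows "AE \<omega> in walk. \<omega> \<in> hits (zero_hist a)"
proof -
  let ?N = "{\<omega> \<in> paths. \<forall>n. count_list (hist n \<omega>) 0 < a}"
  have N: "?N \<in> sets walk"
  proof -
    have "?N = {\<omega> \<in> space walk. \<forall>n. count_list (hist n \<omega>) 0 < a}" by simp
    also have "\<dots> \<in> sets walk" by measurable
    finally show ?thesis .
  qed
  have "measure walk ?N \<le> 0"
  proof (rule LIMSEQ_le_const)
    show "(\<lambda>n. avg n [0] (\<lambda>g. of_bool (count_list g 0 < a))) \<longlonglongrightarrow> 0" by (rule avg_zeros_tendsto) simp
    have "measure walk ?N \<le> measure walk {\<omega> \<in> paths. hist n \<omega> \<in> {g. count_list g 0 < a}}" for n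
      by (rule walk.finite_measure_mono[OF _ walk.sets_hist]) auto
    then have "measure walk ?N \<le> avg n [0] (\<lambda>g. of_bool (count_list g 0 < a))" for n
      unfolding walk.prob_hist by simp
    then show "\<exists>N. \<forall>n\<ge>N. measure walk ?N \<le> avg n [0] (\<lambda>g. of_bool (count_list g 0 < a))"
      by blast
  qed
  then have "?N \<in> null_sets walk"
    using N measure_le_0_iff by (auto simp: null_sets_def walk.emeasure_eq_measure)
  then have "AE \<omega> in walk. \<omega> \<notin> ?N" by (rule AE_not_in)
  then show ?thesis using walk.AE_start AE_space
  proof eventually_elim
    case (elim \<omega>)
    then obtain n where n: "count_list (hist n \<omega>) 0 \<ge> a" by (auto simp: not_less)
    then have "\<exists>L\<le>n. hist L \<omega> \<in> zero_hist a \<and> mx (hist L \<omega>) \<le> stopped_mx a (hist n \<omega>)"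
      using zero_hist_iff_stopped[of \<omega> a n] elim assms by simp
    then show ?case using elim by (auto simp: hits_def)
  qed
qed

section \<open>The path before and after the last zero\<close>

lemma (in prob_space) emeasure_countable_partition:
  fixes Y :: "'a \<Rightarrow> 'b :: countable"
  assumes [measurable]: "Y \<in> M \<rightarrow>\<^sub>M count_space UNIV" "Measurable.pred M P"
  shows "emeasure M {x \<in> space M. Y x \<in> C \<and> P x} = (\<integral>\<^sup>+w. emeasure M {x \<in> space M. Y x = w \<and> P x} \<partial>count_space C)"
proof -
  have "{x \<in> space M. Y x \<in> C \<and> P x} = (\<Union>w\<in>C. {x \<in> space M. Y x = w \<and> P x})" by auto
  then show ?thesis by (simp only:) (rule emeasure_UN_countable, auto simp: disjoint_family_on_def)
qed

lemma (in prob_space) prob_countable_indep: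
  fixes Y :: "'a \<Rightarrow> 'b :: countable" and V :: "'a \<Rightarrow> 'c :: countable"
  assumes [measurable]: "Y \<in> M \<rightarrow>\<^sub>M count_space UNIV" "V \<in> M \<rightarrow>\<^sub>M count_space UNIV"
    and eq: "\<And>w v. prob {x \<in> space M. Y x = w \<and> V x = v} = prob {x \<in> space M. Y x = w} * prob {x \<in> space M. V x = v}"
  shows "prob {x \<in> space M. Y x \<in> C \<and> V x \<in> B} = prob {x \<in> space M. Y x \<in> C} * prob {x \<in> space M. V x \<in> B}"
proof -
  let ?a = "\<lambda>w. emeasure M {x \<in> space M. Y x = w}" and ?b = "\<lambda>v. emeasure M {x \<in> space M. V x = v}"
  have Y: "emeasure M {x \<in> space M. Y x \<in> C} = (\<integral>\<^sup>+w. ?a w \<partial>count_space C)"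
    using emeasure_countable_partition[of Y "\<lambda>_. True" C] by simp
  have V: "emeasure M {x \<in> space M. V x \<in> B} = (\<integral>\<^sup>+v. ?b v \<partial>count_space B)"
    using emeasure_countable_partition[of V "\<lambda>_. True" B] by simp
  have "emeasure M {x \<in> space M. Y x \<in> C \<and> V x \<in> B}
    = (\<integral>\<^sup>+w. emeasure M {x \<in> space M. V x \<in> B \<and> Y x = w} \<partial>count_space C)"
    by (subst emeasure_countable_partition) (auto simp: conj_commute)
  also have "\<dots> = (\<integral>\<^sup>+w. \<integral>\<^sup>+v. emeasure M {x \<in> space M. V x = v \<and> Y x = w} \<partial>count_space B \<partial>count_space C)"
    by (subst emeasure_countable_partition) auto
  also have "\<dots> = (\<integral>\<^sup>+w. \<integral>\<^sup>+v. ?a w * ?b v \<partial>count_space B \<partial>count_space C)"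
  proof (intro nn_integral_cong)
    fix w v
    have "{x \<in> space M. V x = v \<and> Y x = w} = {x \<in> space M. Y x = w \<and> V x = v}" by auto
    then show "emeasure M {x \<in> space M. V x = v \<and> Y x = w} = ?a w * ?b v"
      by (simp only: emeasure_eq_measure eq) (simp add: ennreal_mult)
  qed
  also have "\<dots> = emeasure M {x \<in> space M. Y x \<in> C} * emeasure M {x \<in> space M. V x \<in> B}"
    by (simp add: Y V nn_integral_cmult nn_integral_multc)
  finally show ?thesis by (simp add: emeasure_eq_measure ennreal_mult[symmetric])
qed

text \<open>At the zero that heads \<open>w\<close> the path starts afresh, so the later part
  \<open>v\<close> is checked as a path from 0.\<close>

lemma reach_append_zero:
  assumes "hd w = 0" "w \<noteq> []" "v \<noteq> []"
  shows "reach (v @ w) \<longleftrightarrow> reach w \<and> reach (v @ [0])"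
  using assms(3)
proof (induction v)
  case (Cons x v)
  show ?case
  proof (cases "v = []")
    case True
    then show ?thesis using assms by (auto simp: reach_Cons)
  next
    case False
    then show ?thesis using Cons assms(2) by (auto simp: reach_Cons)
  qed
qed simp

lemma sg_append: "0 \<notin> set v \<Longrightarrow> w \<noteq> [] \<Longrightarrow> sg (v @ w) = sg w"
  by (induction v) auto

lemma hist_shift: "hist n (\<lambda>i. \<omega> (L + 1 + i)) @ hist L \<omega> = hist (L + 1 + n) \<omega>"
  by (induction n) auto

definition after :: "(nat \<Rightarrow> int) \<Rightarrow> nat \<Rightarrow> int" where
  "after \<omega> n = \<omega> (last_zero_time \<omega> + 1 + n)"

text \<open>The probability that the path after the last zero has the history \<open>v\<close>: the fair weight
  \<open>2\<^sup>-\<^sup>n\<close> times the harmonic function \<open>\<bar>x\<bar>\<close> of the walk killed at \<open>0\<close>.\<close>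

definition afterp :: "int list \<Rightarrow> real" where
  "afterp v = (if 0 \<notin> set v \<and> reach (v @ [0]) then \<bar>real_of_int (hd v)\<bar> / 2 ^ length v else 0)"

locale penalised = weight \<phi> + weighted_law Q "weight.pen \<phi>" for \<phi> Q
begin

text \<open>The event is the decreasing limit of those with no zero between k and k + n, and their
  probabilities converge by \<open>avg_no_zero_pen_tendsto\<close>.\<close>

lemma prob_no_more_zeros:
  assumes "h \<in> reachable k" "hd h \<noteq> 0"
  shows "prob {\<omega> \<in> paths. hist k \<omega> = h \<and> (\<forall>i>k. \<omega> i \<noteq> 0)} = 1/2 * \<phi> (nat (sg h)) * \<bar>real_of_int (hd h)\<bar> / 2 ^ k"
proof (rule LIMSEQ_unique)
  let ?A = "\<lambda>n. {\<omega> \<in> paths. hist k \<omega> = h \<and> hist (k + n) \<omega> \<in> {g. count_list g 0 \<le> count_list h 0}}"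
  have A_eq: "?A n = {\<omega> \<in> space Q. hist k \<omega> = h \<and> (\<forall>i. k < i \<and> i \<le> k + n \<longrightarrow> \<omega> i \<noteq> 0)}" for n
    using count_hist_le_iff[of k n] by auto
  have "?A n \<in> sets Q" for n unfolding A_eq by measurable
  moreover have "decseq ?A" unfolding decseq_def A_eq by (auto simp del: space_Q)
  ultimately have "(\<lambda>n. prob (?A n)) \<longlonglongrightarrow> prob (\<Inter>n. ?A n)"
    by (intro finite_Lim_measure_decseq) auto
  moreover have "(\<Inter>n. ?A n) = {\<omega> \<in> paths. hist k \<omega> = h \<and> (\<forall>i>k. \<omega> i \<noteq> 0)}"
    unfolding A_eq by (auto, metis le_add_diff_inverse less_imp_le_nat order_refl)
  ultimately show "(\<lambda>n. prob (?A n)) \<longlonglongrightarrow> prob {\<omega> \<in> paths. hist k \<omega> = h \<and> (\<forall>i>k. \<omega> i \<noteq> 0)}" by simp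
  have h: "reach h" using assms by (simp add: reachable_def)
  have "(\<lambda>n. avg n h (\<lambda>g. of_bool (count_list g 0 \<le> count_list h 0) * pen g) / 2 ^ k)
    \<longlonglongrightarrow> 1/2 * \<phi> (nat (sg h)) * \<bar>real_of_int (hd h)\<bar> / 2 ^ k"
    by (intro tendsto_divide avg_no_zero_pen_tendsto h assms tendsto_const) simp
  then show "(\<lambda>n. prob (?A n)) \<longlonglongrightarrow> 1/2 * \<phi> (nat (sg h)) * \<bar>real_of_int (hd h)\<bar> / 2 ^ k"
    unfolding prob_extension[OF assms(1)] by simp
qed

text \<open>\<open>prob_no_more_zeros\<close> needs a nonzero position, so the step after the zero
  is included. Steps to 1 and to -1 contribute equally, each at distance 1 from 0.\<close>

lemma prob_last_zero_hist:
  assumes "w \<in> reachable L" "hd w = 0"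
  shows "prob {\<omega> \<in> paths. hist L \<omega> = w \<and> last_zero_at L \<omega>} = \<phi> (nat (mx w)) / 2 / 2 ^ L"
proof -
  let ?E = "\<lambda>x. {\<omega> \<in> paths. hist (Suc L) \<omega> = x # w \<and> (\<forall>i>Suc L. \<omega> i \<noteq> 0)}"
  have w: "w \<noteq> []" "reach w" using assms by (auto simp: reachable_def)
  have r: "x # w \<in> reachable (Suc L)" if "\<bar>x\<bar> = 1" for x
    using assms w that by (simp add: reachable_def reach_Cons)
  have p: "prob (?E x) = \<phi> (nat (mx w)) / 2 / 2 ^ Suc L" if "\<bar>x\<bar> = 1" for x
  proof -
    have x: "x \<noteq> 0" "\<bar>real_of_int x\<bar> = 1" using that by auto
    show ?thesis
      using prob_no_more_zeros[OF r[OF that]] x w assms(2) by (simp add: sg_zero)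
  qed
  have "{\<omega> \<in> paths. hist L \<omega> = w \<and> last_zero_at L \<omega>} = ?E 1 \<union> ?E (-1)"
  proof (intro equalityI subsetI)
    fix \<omega> assume \<omega>: "\<omega> \<in> {\<omega> \<in> paths. hist L \<omega> = w \<and> last_zero_at L \<omega>}"
    then have "\<bar>\<omega> (Suc L) - \<omega> L\<bar> = 1" unfolding paths_def by blast
    moreover have "\<omega> L = 0" using \<omega> by (simp add: last_zero_at_def)
    ultimately have "\<omega> (Suc L) = 1 \<or> \<omega> (Suc L) = -1" by auto
    then show "\<omega> \<in> ?E 1 \<union> ?E (-1)" using \<omega> by (auto simp: last_zero_at_def)
  next
    fix \<omega> assume \<omega>: "\<omega> \<in> ?E 1 \<union> ?E (-1)"
    then have "\<omega> L = 0" using assms(2) hd_hist[of L \<omega>] by auto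
    moreover have "\<omega> i \<noteq> 0" if "i > L" for i
      using \<omega> that by (cases "i = Suc L") auto
    ultimately show "\<omega> \<in> {\<omega> \<in> paths. hist L \<omega> = w \<and> last_zero_at L \<omega>}" using \<omega> by (auto simp: last_zero_at_def)
  qed
  moreover have "?E x \<in> sets Q" for x
  proof -
    have "?E x = {\<omega> \<in> space Q. hist (Suc L) \<omega> = x # w \<and> (\<forall>i>Suc L. \<omega> i \<noteq> 0)}" by simp
    also have "\<dots> \<in> sets Q" by measurable
    finally show ?thesis .
  qed
  moreover have "?E 1 \<inter> ?E (-1) = {}" by auto
  ultimately have "prob {\<omega> \<in> paths. hist L \<omega> = w \<and> last_zero_at L \<omega>} = prob (?E 1) + prob (?E (-1))"
    by (simp only: finite_measure_Union)
  then show ?thesis using p[of 1] p[of "-1"] by simp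
qed

lemma emeasure_ends_single:
  assumes "reach w" "hd w = 0"
  shows "emeasure Q (ends {w}) = ennreal (\<phi> (nat (mx w)) / 2) * ennreal (1 / 2 ^ (length w - 1))"
proof -
  have r: "w \<in> reachable (length w - 1)" using assms by (cases w) (auto simp: reachable_def)
  have "ends {w} = {\<omega> \<in> paths. hist (length w - 1) \<omega> = w \<and> last_zero_at (length w - 1) \<omega>}"
    by (auto simp: ends_def)
  then show ?thesis
    using prob_last_zero_hist[OF r assms(2)] \<phi>_nonneg
    by (simp add: emeasure_eq_measure ennreal_mult[symmetric])
qed

lemma ends_disjoint: "B \<inter> B' = {} \<Longrightarrow> ends B \<inter> ends B' = {}"
  using last_zero_at_eq(2) by (fastforce simp: ends_def)

text \<open>With the maximum constant on \<open>B\<close>, the factor \<phi> b / 2 comes out of the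
  sum over histories, and what remains is the sum for the walk.\<close>

lemma prob_ends:
  assumes "B \<subseteq> zero_hist a" "\<And>w. w \<in> B \<Longrightarrow> mx w = int b"
  shows "prob (ends B) = \<phi> b / 2 * measure walk (hits B)"
proof -
  have "ends B = (\<Union>w\<in>B. ends {w})" by (auto simp: ends_def)
  moreover have "disjoint_family_on (\<lambda>w. ends {w}) B"
    using ends_disjoint unfolding disjoint_family_on_def by auto
  ultimately have "emeasure Q (ends B) = (\<integral>\<^sup>+w. emeasure Q (ends {w}) \<partial>count_space B)"
    using sets_ends by (simp add: emeasure_UN_countable)
  also have "\<dots> = (\<integral>\<^sup>+w. ennreal (\<phi> b / 2) * ennreal (1 / 2 ^ (length w - 1)) \<partial>count_space B)"
    using assms by (intro nn_integral_cong) (auto simp: emeasure_ends_single zero_hist_def subset_eq)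
  also have "\<dots> = ennreal (\<phi> b / 2) * emeasure walk (hits B)"
    by (simp add: nn_integral_cmult emeasure_hits[OF assms(1)])
  finally show ?thesis
    using \<phi>_nonneg[of b] by (simp add: emeasure_eq_measure walk.emeasure_eq_measure ennreal_mult[symmetric])
qed

section \<open>The number of zeros and the maximum at the last zero\<close>

definition zero_max :: "nat \<Rightarrow> nat \<Rightarrow> int list set" where
  "zero_max a k = {w \<in> zero_hist a. mx w = int k}"

definition endp :: "nat \<Rightarrow> nat \<Rightarrow> real" where
  "endp a k = (if k = 0 then (1/2) ^ a * \<phi> 0
      else 1/2 * ((1 - 1 / (2 * (real k + 1))) ^ (a - 1) - (1 - 1 / (2 * real k)) ^ (a - 1)) * \<phi> k)"

lemma prob_ends_zero_max:
  assumes "a \<ge> 1"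
  shows "prob (ends (zero_max a k)) = endp a k"
proof -
  have "prob (ends (zero_max a k)) = \<phi> k / 2 * measure walk (hits (zero_max a k))"
    by (rule prob_ends) (auto simp: zero_max_def)
  also have "\<dots> = endp a k"
    using assms prob_hits_eq[OF assms, of k] by (cases a) (auto simp: endp_def zero_max_def)
  finally show ?thesis .
qed

lemma ends_zero_max_disjoint: "(a, k) \<noteq> (a', k') \<Longrightarrow> ends (zero_max a k) \<inter> ends (zero_max a' k') = {}"
  by (intro ends_disjoint) (auto simp: zero_max_def zero_hist_def)

text \<open>For k \<ge> 1 the two geometric series have sums 2 (k + 1) and 2 k, and their difference
  2 cancels the factor 1/2. For k = 0 there is one series, with sum 2.\<close>

lemma endp_sums: "(\<lambda>a. endp (Suc a) k) sums \<phi> k"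
proof (cases "k = 0")
  case True
  have "(\<lambda>a. 1/2 * \<phi> 0 * (1/2::real) ^ a) sums (1/2 * \<phi> 0 * (1 / (1 - 1/2)))"
    by (intro sums_mult geometric_sums) simp
  then show ?thesis using True by (simp add: endp_def mult_ac)
next
  case False
  have "(\<lambda>a. \<phi> k / 2 * ((1 - 1 / (2 * (real k + 1))) ^ a - (1 - 1 / (2 * real k)) ^ a)) sums
    (\<phi> k / 2 * (1 / (1 - (1 - 1 / (2 * (real k + 1)))) - 1 / (1 - (1 - 1 / (2 * real k)))))"
    using False by (intro sums_mult sums_diff geometric_sums) (auto simp: abs_if field_simps)
  then show ?thesis using False by (simp add: endp_def mult_ac)
qed

lemma prob_ends_max: "prob (\<Union>a. ends (zero_max (Suc a) k)) = \<phi> k"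
proof -
  have "(\<lambda>a. prob (ends (zero_max (Suc a) k))) sums prob (\<Union>a. ends (zero_max (Suc a) k))"
    by (rule finite_measure_UNION) (auto simp: sets_ends disjoint_family_on_def ends_zero_max_disjoint)
  then show ?thesis using sums_unique2[OF _ endp_sums] by (simp add: prob_ends_zero_max)
qed

text \<open>For different k these disjoint events have probabilities \<phi> k, which sum to 1.
  Finiteness of the last zero is thus a statement about total mass.\<close>

lemma AE_ends: "AE \<omega> in Q. \<exists>L w. last_zero_at L \<omega> \<and> hist L \<omega> = w \<and> reach w \<and> hd w = 0"
proof -
  have "ends (zero_max (Suc a) m) \<inter> ends (zero_max (Suc b) n) = {}" if "m \<noteq> n" for a b m n
    using that by (intro ends_zero_max_disjoint) auto
  then have "(\<Union>a. ends (zero_max (Suc a) m)) \<inter> (\<Union>a. ends (zero_max (Suc a) n)) = {}" if "m \<noteq> n" for m n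
    using that by blast
  then have "(\<lambda>k. prob (\<Union>a. ends (zero_max (Suc a) k))) sums prob (\<Union>k. \<Union>a. ends (zero_max (Suc a) k))"
    by (intro finite_measure_UNION) (auto simp: disjoint_family_on_def sets_ends)
  then have "prob (\<Union>k. \<Union>a. ends (zero_max (Suc a) k)) = 1"
    using sums_unique2[OF _ \<phi>_sums] by (simp add: prob_ends_max)
  moreover have "(\<Union>k. \<Union>a. ends (zero_max (Suc a) k)) \<in> sets Q"
    by (intro sets.countable_UN image_subsetI) (rule sets_ends)
  ultimately have "AE \<omega> in Q. \<omega> \<in> (\<Union>k. \<Union>a. ends (zero_max (Suc a) k))"
    by (simp only: prob_eq_1)
  then show ?thesis by (auto simp: ends_def zero_max_def zero_hist_def)
qed

lemma AE_last_zero: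
  "AE \<omega> in Q. last_zero_at (last_zero_time \<omega>) \<omega> \<and> reach (hist (last_zero_time \<omega>) \<omega>) \<and> \<omega> (last_zero_time \<omega>) = 0"
  using AE_ends
proof eventually_elim
  case (elim \<omega>)
  then obtain L where "last_zero_at L \<omega>" "reach (hist L \<omega>)" by auto
  then show ?case using last_zero_at_eq(2)[of L \<omega>] by (simp add: last_zero_at_def)
qed

lemma measurable_after' [measurable]: "(\<lambda>\<omega>. after \<omega> n) \<in> Q \<rightarrow>\<^sub>M count_space UNIV"
  unfolding after_def by measurable

lemma measurable_hist_after [measurable]: "(\<lambda>\<omega>. hist n (after \<omega>)) \<in> Q \<rightarrow>\<^sub>M count_space UNIV"
  by (rule measurable_hist) measurable

section \<open>The joint law of the path before and after the last zero\<close>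

lemma prob_last_hist:
  "prob {\<omega> \<in> paths. hist (last_zero_time \<omega>) \<omega> = w} = (if reach w \<and> hd w = 0 then \<phi> (nat (mx w)) / 2 / 2 ^ (length w - 1) else 0)"
proof (cases "reach w \<and> hd w = 0")
  case True
  then have "measure Q (ends {w}) = \<phi> (nat (mx w)) / 2 / 2 ^ (length w - 1)"
    using emeasure_ends_single[of w] \<phi>_nonneg by (simp add: emeasure_eq_measure ennreal_mult[symmetric])
  moreover have "prob {\<omega> \<in> paths. hist (last_zero_time \<omega>) \<omega> = w} = prob (ends {w})"
  proof (rule finite_measure_eq_AE)
    show "AE \<omega> in Q. (\<omega> \<in> {\<omega> \<in> paths. hist (last_zero_time \<omega>) \<omega> = w}) = (\<omega> \<in> ends {w})"
      using AE_last_zero AE_space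
      by eventually_elim (auto simp: ends_def dest: last_zero_at_eq(2))
    have "{\<omega> \<in> space Q. hist (last_zero_time \<omega>) \<omega> = w} \<in> sets Q" by measurable
    then show "{\<omega> \<in> paths. hist (last_zero_time \<omega>) \<omega> = w} \<in> sets Q" by simp
  qed (rule sets_ends)
  ultimately show ?thesis using True by simp
next
  case False
  have "AE \<omega> in Q. \<omega> \<notin> {\<omega> \<in> paths. hist (last_zero_time \<omega>) \<omega> = w}"
    using AE_last_zero by eventually_elim (use False in auto)
  moreover have "{\<omega> \<in> space Q. hist (last_zero_time \<omega>) \<omega> = w} \<in> sets Q" by measurable
  ultimately have "prob {\<omega> \<in> paths. hist (last_zero_time \<omega>) \<omega> = w} = 0"
    by (subst prob_eq_0) auto
  then show ?thesis using False by auto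
qed

text \<open>For admissible \<open>w\<close> and \<open>v\<close> the event says, up to a null set,
  that the path begins with \<open>v @ w\<close> and has no later zero. Its weight factorises
  because \<open>sg (v @ w)\<close> depends on \<open>w\<close> only and the final position on
  \<open>v\<close> only.\<close>

lemma prob_last_hist_after:
  assumes "length v = Suc n"
  shows "prob {\<omega> \<in> space Q. hist (last_zero_time \<omega>) \<omega> = w \<and> hist n (after \<omega>) = v}
    = prob {\<omega> \<in> space Q. hist (last_zero_time \<omega>) \<omega> = w} * afterp v"
proof -
  let ?E = "{\<omega> \<in> space Q. hist (last_zero_time \<omega>) \<omega> = w \<and> hist n (after \<omega>) = v}"
  have null: "prob ?E = 0" if "AE \<omega> in Q. \<omega> \<notin> ?E"
  proof -
    have "?E \<in> sets Q" by measurable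
    then show ?thesis using that by (subst prob_eq_0) auto
  qed
  have v: "v \<noteq> []" using assms by auto
  show ?thesis
  proof (cases "reach w \<and> hd w = 0")
    case False
    have "AE \<omega> in Q. \<omega> \<notin> ?E" using AE_last_zero by eventually_elim (use False in auto)
    then show ?thesis using null False by (auto simp: prob_last_hist)
  next
    case w: True
    have wl: "length w = Suc (length w - 1)" using w by (cases w) auto
    define L where "L = length w - 1"
    show ?thesis
    proof (cases "0 \<notin> set v \<and> reach (v @ [0])")
      case False
      have "AE \<omega> in Q. \<forall>n. hist n \<omega> \<in> reachable n"
        using AE_reachable by (simp add: AE_all_countable)
      with AE_last_zero have "AE \<omega> in Q. \<omega> \<notin> ?E"
      proof eventually_elim
        case (elim \<omega>)
        show ?case
        proof
          assume E: "\<omega> \<in> ?E"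
          have "0 \<notin> set (hist n (after \<omega>))"
            using elim by (auto simp: set_hist after_def last_zero_at_def)
          moreover have "hist n (after \<omega>) @ hist (last_zero_time \<omega>) \<omega> = hist (last_zero_time \<omega> + 1 + n) \<omega>"
            using hist_shift[of n \<omega> "last_zero_time \<omega>"] by (simp add: after_def[abs_def])
          then have "reach (v @ w)"
            using E elim(2)[rule_format, of "last_zero_time \<omega> + 1 + n"] by (simp add: reachable_def)
          then have "reach (v @ [0])" using reach_append_zero[of w v] w v reach_neq_Nil by blast
          ultimately show False using E False by auto
        qed
      qed
      then show ?thesis using null False by (auto simp: afterp_def)
    next
      case True
      have "reach (v @ w)" using reach_append_zero[of w v] w v True reach_neq_Nil by blast
      then have vw: "v @ w \<in> reachable (L + 1 + n)"
        using assms wl by (auto simp: reachable_def L_def)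
      have sg: "sg (v @ w) = mx w" using True w by (subst sg_append) (auto simp: sg_zero reach_neq_Nil)
      have hd: "hd (v @ w) \<noteq> 0" using True v by (cases v) auto
      have "prob ?E = prob {\<omega> \<in> paths. hist (L + 1 + n) \<omega> = v @ w \<and> (\<forall>i>L + 1 + n. \<omega> i \<noteq> 0)}"
      proof (rule finite_measure_eq_AE)
        show "AE \<omega> in Q. (\<omega> \<in> ?E) = (\<omega> \<in> {\<omega> \<in> paths. hist (L + 1 + n) \<omega> = v @ w \<and> (\<forall>i>L + 1 + n. \<omega> i \<noteq> 0)})"
          using AE_last_zero AE_space
        proof eventually_elim
          case (elim \<omega>)
          show ?case
          proof
            assume E: "\<omega> \<in> ?E"
            then have L: "last_zero_time \<omega> = L" using length_hist[of "last_zero_time \<omega>" \<omega>] by (simp add: L_def del: length_hist)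
            have "hist (L + 1 + n) \<omega> = v @ w"
              using hist_shift[of n \<omega> L] E L by (simp add: after_def[abs_def])
            then show "\<omega> \<in> {\<omega> \<in> paths. hist (L + 1 + n) \<omega> = v @ w \<and> (\<forall>i>L + 1 + n. \<omega> i \<noteq> 0)}"
              using E elim L by (auto simp: last_zero_at_def)
          next
            assume E: "\<omega> \<in> {\<omega> \<in> paths. hist (L + 1 + n) \<omega> = v @ w \<and> (\<forall>i>L + 1 + n. \<omega> i \<noteq> 0)}"
            have "hist n (\<lambda>i. \<omega> (L + 1 + i)) @ hist L \<omega> = v @ w" using E hist_shift[of n \<omega> L] by simp
            then have h: "hist n (\<lambda>i. \<omega> (L + 1 + i)) = v" "hist L \<omega> = w"
              using assms by (auto simp: append_eq_append_conv)
            have "last_zero_at L \<omega>"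
              unfolding last_zero_at_def
            proof (intro conjI allI impI)
              show "\<omega> L = 0" using h(2) w hd_hist[of L \<omega>] by simp
              fix i assume "i > L"
              show "\<omega> i \<noteq> 0"
              proof (cases "i \<le> L + 1 + n")
                case True
                then have "\<omega> i \<in> set v"
                  unfolding h(1)[symmetric] set_hist using \<open>i > L\<close> by (intro image_eqI[of _ _ "i - (L + 1)"]) auto
                then show ?thesis using \<open>0 \<notin> set v \<and> _\<close> by auto
              qed (use E in auto)
            qed
            then have "last_zero_time \<omega> = L" by (rule last_zero_at_eq(2))
            then show "\<omega> \<in> ?E" using E h by (simp add: after_def[abs_def])
          qed
        qed
        show "?E \<in> sets Q" by measurable
        have "{\<omega> \<in> space Q. hist (L + 1 + n) \<omega> = v @ w \<and> (\<forall>i>L + 1 + n. \<omega> i \<noteq> 0)} \<in> sets Q" by measurable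
        then show "{\<omega> \<in> paths. hist (L + 1 + n) \<omega> = v @ w \<and> (\<forall>i>L + 1 + n. \<omega> i \<noteq> 0)} \<in> sets Q" by (simp only: space_Q)
      qed
      also have "\<dots> = 1/2 * \<phi> (nat (mx w)) * \<bar>real_of_int (hd v)\<bar> / 2 ^ (L + 1 + n)"
        using prob_no_more_zeros[OF vw hd] by (simp only: sg hd_append2[OF v])
      finally show ?thesis
        using True w assms by (simp add: prob_last_hist afterp_def L_def power_add)
    qed
  qed
qed

lemma prob_hist_after:
  assumes "length v = Suc n"
  shows "prob {\<omega> \<in> space Q. hist n (after \<omega>) = v} = afterp v"
proof -
  have a: "afterp v \<ge> 0" by (simp add: afterp_def)
  have "emeasure Q {\<omega> \<in> space Q. hist (last_zero_time \<omega>) \<omega> \<in> UNIV \<and> hist n (after \<omega>) = v}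
    = (\<integral>\<^sup>+w. emeasure Q {\<omega> \<in> space Q. hist (last_zero_time \<omega>) \<omega> = w \<and> hist n (after \<omega>) = v} \<partial>count_space UNIV)"
    by (rule emeasure_countable_partition) measurable
  also have "\<dots> = (\<integral>\<^sup>+w. emeasure Q {\<omega> \<in> space Q. hist (last_zero_time \<omega>) \<omega> = w \<and> True} * ennreal (afterp v) \<partial>count_space UNIV)"
    using a by (simp add: emeasure_eq_measure prob_last_hist_after[OF assms] ennreal_mult del: space_Q)
  also have "\<dots> = emeasure Q {\<omega> \<in> space Q. hist (last_zero_time \<omega>) \<omega> \<in> UNIV \<and> True} * ennreal (afterp v)"
    by (subst emeasure_countable_partition) (auto simp: nn_integral_multc)
  also have "{\<omega> \<in> space Q. hist (last_zero_time \<omega>) \<omega> \<in> UNIV \<and> True} = space Q" by auto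
  finally show ?thesis using a by (simp add: emeasure_eq_measure prob_space del: space_Q)
qed

lemma prob_last_hist_after_indep:
  "prob {\<omega> \<in> space Q. hist (last_zero_time \<omega>) \<omega> \<in> C \<and> hist n (after \<omega>) \<in> B}
    = prob {\<omega> \<in> space Q. hist (last_zero_time \<omega>) \<omega> \<in> C} * prob {\<omega> \<in> space Q. hist n (after \<omega>) \<in> B}"
proof (rule prob_countable_indep)
  fix w v
  show "prob {\<omega> \<in> space Q. hist (last_zero_time \<omega>) \<omega> = w \<and> hist n (after \<omega>) = v}
    = prob {\<omega> \<in> space Q. hist (last_zero_time \<omega>) \<omega> = w} * prob {\<omega> \<in> space Q. hist n (after \<omega>) = v}"
  proof (cases "length v = Suc n")
    case True
    then show ?thesis by (simp only: prob_last_hist_after prob_hist_after)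
  next
    case False
    then have "hist n (after \<omega>) \<noteq> v" for \<omega> by auto
    then show ?thesis by simp
  qed
qed measurable

end

section \<open>The zeros and the maximum at the last zero under the penalised law\<close>

context penalised
begin

lemma prob_finite_last_zero: "\<P>(\<omega> in Q. 0 \<le> last_zero \<omega> \<and> last_zero \<omega> < \<infinity>) = 1"
proof -
  have "{\<omega> \<in> space Q. \<exists>L. last_zero_at L \<omega>} \<in> sets Q" by measurable
  moreover have "AE \<omega> in Q. \<exists>L. last_zero_at L \<omega>" using AE_last_zero by eventually_elim auto
  ultimately show ?thesis unfolding last_zero_finite_iff by (subst prob_Collect_eq_1) auto
qed

lemma sets_last_hist: "{\<omega> \<in> space Q. hist (last_zero_time \<omega>) \<omega> \<in> B} \<in> sets Q"
  by measurable

lemma sets_hist_after: "{\<omega> \<in> space Q. hist n (after \<omega>) \<in> B} \<in> sets Q"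
  by measurable

lemma AE_ends_iff: "AE \<omega> in Q. \<omega> \<in> ends B \<longleftrightarrow> hist (last_zero_time \<omega>) \<omega> \<in> B"
  using AE_last_zero AE_space
proof eventually_elim
  case (elim \<omega>)
  then show ?case using last_zero_at_eq(2)[of _ \<omega>] by (auto simp: ends_def)
qed

lemma prob_zeros_max:
  assumes "a \<ge> 1"
  shows "\<P>(\<omega> in Q. zeros (last_zero_time \<omega>) \<omega> = a \<and> Smax (last_zero_time \<omega>) \<omega> = int k) = endp a k"
proof -
  let ?B = "{w. count_list w 0 = a \<and> mx w = int k}"
  have "prob {\<omega> \<in> space Q. hist (last_zero_time \<omega>) \<omega> \<in> ?B} = prob (ends (zero_max a k))"
  proof (rule finite_measure_eq_AE[OF _ sets_last_hist sets_ends])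
    show "AE \<omega> in Q. (\<omega> \<in> {\<omega> \<in> space Q. hist (last_zero_time \<omega>) \<omega> \<in> ?B}) = (\<omega> \<in> ends (zero_max a k))"
      using AE_last_zero AE_ends_iff[of "zero_max a k"] AE_space
      by eventually_elim (auto simp: zero_max_def zero_hist_def)
  qed
  then show ?thesis using prob_ends_zero_max[OF assms] by (simp add: zeros_hist Smax_hist)
qed

lemma prob_max: "\<P>(\<omega> in Q. Smax (last_zero_time \<omega>) \<omega> = int k) = \<phi> k"
proof -
  let ?U = "\<Union>a. ends (zero_max (Suc a) k)"
  have "prob {\<omega> \<in> space Q. hist (last_zero_time \<omega>) \<omega> \<in> {w. mx w = int k}} = prob ?U"
  proof (rule finite_measure_eq_AE[OF _ sets_last_hist])
    show "AE \<omega> in Q. (\<omega> \<in> {\<omega> \<in> space Q. hist (last_zero_time \<omega>) \<omega> \<in> {w. mx w = int k}}) = (\<omega> \<in> ?U)"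
      using AE_last_zero AE_ends_iff[of "\<Union>a. zero_max (Suc a) k"] AE_space
    proof eventually_elim
      case (elim \<omega>)
      have "ends (\<Union>a. zero_max (Suc a) k) = ?U" by (auto simp: ends_def)
      moreover have "\<exists>a. count_list (hist (last_zero_time \<omega>) \<omega>) 0 = Suc a"
        using elim reach_count_zeros[of "hist (last_zero_time \<omega>) \<omega>"] by (intro exI[of _ "count_list (hist (last_zero_time \<omega>) \<omega>) 0 - 1"]) auto
      ultimately show ?case using elim by (auto simp: zero_max_def zero_hist_def)
    qed
    show "?U \<in> sets Q" using sets_ends by auto
  qed
  then show ?thesis using prob_ends_max by (simp add: Smax_hist)
qed

section \<open>The 3-Bessel* walks after the last zero\<close>

lemma prob_after_start:
  assumes "\<bar>s\<bar> = 1"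
  shows "\<P>(\<omega> in Q. after \<omega> 0 = s) = 1/2"
proof -
  have "\<P>(\<omega> in Q. after \<omega> 0 = s) = \<P>(\<omega> in Q. hist 0 (after \<omega>) = [s])" by simp
  also have "\<dots> = afterp [s]" by (rule prob_hist_after) simp
  also have "\<dots> = 1/2"
  proof -
    have "s \<noteq> 0" "\<bar>real_of_int s\<bar> = 1" using assms by auto
    then show ?thesis using assms by (simp add: afterp_def)
  qed
  finally show ?thesis .
qed

lemma after_path:
  assumes "\<omega> \<in> paths" "last_zero_at (last_zero_time \<omega>) \<omega>"
  shows "after \<omega> n \<noteq> 0" "\<bar>after \<omega> (Suc n) - after \<omega> n\<bar> = 1" "\<bar>after \<omega> 0\<bar> = 1"
proof -
  have p: "\<bar>\<omega> (Suc n) - \<omega> n\<bar> = 1" for n using assms(1) by (simp add: paths_def)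
  show "after \<omega> n \<noteq> 0" using assms(2) by (simp add: after_def last_zero_at_def)
  show "\<bar>after \<omega> (Suc n) - after \<omega> n\<bar> = 1" using p[of "last_zero_time \<omega> + 1 + n"] by (simp add: after_def)
  show "\<bar>after \<omega> 0\<bar> = 1" using p[of "last_zero_time \<omega>"] assms(2) by (simp add: after_def last_zero_at_def)
qed

lemma after_sign:
  assumes "\<omega> \<in> paths" "last_zero_at (last_zero_time \<omega>) \<omega>" "\<bar>s\<bar> = 1" "after \<omega> 0 = s"
  shows "s * after \<omega> n \<ge> 1"
proof (induction n)
  case 0
  then show ?case using assms(3,4) by (simp add: abs_if split: if_splits)
next
  case (Suc n)
  have "after \<omega> (Suc n) \<noteq> 0" "\<bar>after \<omega> (Suc n) - after \<omega> n\<bar> = 1" using after_path[OF assms(1,2)] by auto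
  moreover have "s = 1 \<or> s = -1" using assms(3) by auto
  ultimately show ?case using Suc by auto
qed

text \<open>The sign s handles both half-lines at once. Extending a history from y to z multiplies
  \<open>afterp\<close> by z / (2 y), the fair step transformed by \<bar>x\<bar>; this is the
  3-Bessel* kernel and does not involve earlier values.\<close>

lemma bessel_after:
  assumes s: "\<bar>s\<bar> = 1"
  shows "bessel_star_walk_from_1 (uniform_measure Q {\<omega> \<in> space Q. after \<omega> 0 = s}) (\<lambda>n \<omega>. s * after \<omega> n)"
proof -
  let ?A = "{\<omega> \<in> space Q. after \<omega> 0 = s}"
  let ?R = "uniform_measure Q ?A"
  have ss: "s * (s * x) = x" for x using s by (auto simp: abs_if split: if_splits)
  have A: "?A \<in> sets Q" by measurable
  have pA: "prob ?A = 1/2" using prob_after_start[OF s] by simp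
  then have eA: "emeasure Q ?A \<noteq> 0" "emeasure Q ?A \<noteq> \<infinity>" by (auto simp: emeasure_eq_measure)
  have AE_A: "AE \<omega> in ?R. \<omega> \<in> paths \<and> last_zero_at (last_zero_time \<omega>) \<omega> \<and> after \<omega> 0 = s"
  proof (rule AE_uniform_measureI[OF A])
    show "AE \<omega> in Q. \<omega> \<in> ?A \<longrightarrow> \<omega> \<in> paths \<and> last_zero_at (last_zero_time \<omega>) \<omega> \<and> after \<omega> 0 = s"
      using AE_last_zero AE_space by eventually_elim auto
  qed
  \<comment> \<open>The conditioning event has probability 1/2, so conditioning doubles
    probabilities.\<close>
  have R: "measure ?R {\<omega> \<in> space ?R. P \<omega>} = 2 * prob {\<omega> \<in> space Q. after \<omega> 0 = s \<and> P \<omega>}"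
    if [measurable]: "Measurable.pred Q P" for P
  proof -
    have "{\<omega> \<in> space Q. P \<omega>} \<in> sets Q" by measurable
    moreover have "?A \<inter> {\<omega> \<in> space Q. P \<omega>} = {\<omega> \<in> space Q. after \<omega> 0 = s \<and> P \<omega>}" by auto
    ultimately have "measure ?R {\<omega> \<in> space Q. P \<omega>} = prob {\<omega> \<in> space Q. after \<omega> 0 = s \<and> P \<omega>} / (1/2)"
      using measure_uniform_measure[OF eA, of "{\<omega> \<in> space Q. P \<omega>}"] by (simp only: pA)
    then show ?thesis by (simp only: space_uniform_measure) simp
  qed
  show ?thesis
    unfolding bessel_star_walk_from_1_def markov_chain_from_def
  proof (intro conjI allI ballI impI)
    show "prob_space ?R" by (rule prob_space_uniform_measure[OF eA])
    show "(\<lambda>\<omega>. s * after \<omega> n) \<in> ?R \<rightarrow>\<^sub>M count_space UNIV" for n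
      unfolding measurable_cong_sets[OF sets_uniform_measure refl]
      by (rule measurable_compose[OF measurable_after' measurable_count_space])
    show "AE \<omega> in ?R. \<forall>n. s * after \<omega> n \<in> {1..}"
      using AE_A by eventually_elim (use after_sign s in auto)
    show "AE \<omega> in ?R. s * after \<omega> 0 = 1"
      using AE_A by eventually_elim (use ss[of 1] in auto)
    fix n :: nat and y :: "nat \<Rightarrow> int" and z :: int
    assume z: "z \<in> {1..}" and pos: "\<P>(\<omega> in ?R. \<forall>i\<le>n. s * after \<omega> i = y i) > 0"
    define v where "v = hist n (\<lambda>i. s * y i)"
    have v_iff: "(\<forall>i\<le>n. s * after \<omega> i = y i) \<longleftrightarrow> hist n (after \<omega>) = v" for \<omega>
    proof -
      have "hist n (after \<omega>) = v \<longleftrightarrow> (\<forall>i\<le>n. after \<omega> i = s * y i)"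
        by (auto simp: hist_eq_iff v_def nth_hist)
      moreover have "after \<omega> i = s * y i \<longleftrightarrow> s * after \<omega> i = y i" for i
        using ss by metis
      ultimately show ?thesis by simp
    qed
    have m: "Measurable.pred Q (\<lambda>\<omega>. hist n (after \<omega>) = u)" for n u by measurable
    have p1: "\<P>(\<omega> in ?R. \<forall>i\<le>n. s * after \<omega> i = y i) = 2 * prob {\<omega> \<in> space Q. after \<omega> 0 = s \<and> hist n (after \<omega>) = v}"
      unfolding v_iff using R[OF m] by simp
    \<comment> \<open>Values of positive probability must start at 1. The history \<open>v\<close>
      then starts at s and implies the conditioning event.\<close>
    have y0: "y 0 = 1"
    proof (rule ccontr)
      assume "y 0 \<noteq> 1"
      then have "{\<omega> \<in> space Q. after \<omega> 0 = s \<and> hist n (after \<omega>) = v} = {}"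
        using ss[of 1] unfolding v_iff[symmetric] by auto
      then have "prob {\<omega> \<in> space Q. after \<omega> 0 = s \<and> hist n (after \<omega>) = v} = 0" by (simp only: measure_empty)
      then show False using pos p1 by simp
    qed
    have st: "after \<omega> 0 = s" if "hist n (after \<omega>) = v" for \<omega>
      using that ss[of "after \<omega> 0"] y0 unfolding v_iff[symmetric] by (metis le0 mult.right_neutral)
    have p2: "\<P>(\<omega> in ?R. \<forall>i\<le>n. s * after \<omega> i = y i) = 2 * afterp v"
    proof -
      have "{\<omega> \<in> space Q. after \<omega> 0 = s \<and> hist n (after \<omega>) = v} = {\<omega> \<in> space Q. hist n (after \<omega>) = v}"
        using st by auto
      then show ?thesis unfolding p1 by (simp only:) (simp only: prob_hist_after length_hist v_def)
    qed
    have p3: "\<P>(\<omega> in ?R. s * after \<omega> (Suc n) = z \<and> (\<forall>i\<le>n. s * after \<omega> i = y i)) = 2 * afterp (s * z # v)"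
    proof -
      have e: "s * after \<omega> (Suc n) = z \<and> (\<forall>i\<le>n. s * after \<omega> i = y i) \<longleftrightarrow> hist (Suc n) (after \<omega>) = s * z # v" for \<omega>
      proof -
        have "s * after \<omega> (Suc n) = z \<longleftrightarrow> after \<omega> (Suc n) = s * z" using ss by metis
        then show ?thesis unfolding v_iff by simp
      qed
      have "{\<omega> \<in> space Q. after \<omega> 0 = s \<and> hist (Suc n) (after \<omega>) = s * z # v} = {\<omega> \<in> space Q. hist (Suc n) (after \<omega>) = s * z # v}"
        using st by auto
      then show ?thesis unfolding e using R[OF m, of "Suc n" "s * z # v"] prob_hist_after[of "s * z # v" "Suc n"]
        by (simp add: v_def del: space_Q hist.simps)
    qed
    have av: "afterp v > 0" using pos p2 by simp
    then have v: "0 \<notin> set v" "reach (v @ [0])" by (auto simp: afterp_def split: if_splits)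
    have hd: "hd v = s * y n" by (simp add: v_def)
    have vne: "v \<noteq> []" by (simp add: v_def)
    then have yn: "y n \<noteq> 0" using v(1) hd by (metis hd_in_set mult_zero_right)
    have abs1: "\<bar>real_of_int s\<bar> = 1" using s by simp
    have "afterp (s * z # v) / afterp v = bessel_star (y n) z"
    proof (cases "\<bar>z - y n\<bar> = 1")
      case True
      then have yz: "y n \<ge> 1" "z = y n + 1 \<or> z = y n - 1" using yn z by auto
      have "\<bar>s * z - s * y n\<bar> = 1" using True s by (simp add: abs_mult flip: right_diff_distrib)
      then have "reach (s * z # v @ [0])" using v vne hd by (simp add: reach_Cons)
      moreover have "s * z \<noteq> 0" using z s by auto
      ultimately have "afterp (s * z # v) = real_of_int z / 2 ^ Suc (length v)"
        using v z abs1 by (simp add: afterp_def abs_mult)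
      moreover have "afterp v = real_of_int (y n) / 2 ^ length v"
        using v yz abs1 by (simp add: afterp_def hd abs_mult)
      ultimately have "afterp (s * z # v) / afterp v = real_of_int z / (2 * real_of_int (y n))"
        by simp
      then show ?thesis using yz by (auto simp: bessel_star_def)
    next
      case False
      have "\<bar>s * z - s * y n\<bar> \<noteq> 1" using False s by (simp add: abs_mult flip: right_diff_distrib)
      then have "afterp (s * z # v) = 0" using vne hd by (simp add: afterp_def reach_Cons)
      then show ?thesis using False by (auto simp: bessel_star_def)
    qed
    then show "cond_prob ?R (\<lambda>\<omega>. s * after \<omega> (Suc n) = z) (\<lambda>\<omega>. \<forall>i\<le>n. s * after \<omega> i = y i) = bessel_star (y n) z"
      unfolding cond_prob_def p2 p3 by simp
  qed
qed

section \<open>The supremum of the whole path\<close>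

lemma AE_unbounded: "AE \<omega> in Q. \<forall>L k. (\<omega> L = 0 \<and> (\<forall>i>L. \<omega> i > 0)) \<longrightarrow> (\<exists>i. \<omega> i > int k)"
  unfolding AE_all_countable
proof (intro allI)
  fix L k
  let ?N = "{\<omega> \<in> space Q. (\<omega> L = 0 \<and> (\<forall>i>L. \<omega> i > 0)) \<and> (\<forall>i. \<omega> i \<le> int k)}"
  have N: "?N \<in> sets Q" by measurable
  have "prob ?N \<le> 0"
  \<comment> \<open>On this event there are at most L + 1 zeros up to time L and none later, whence
    the strict bound L + 2; n > L makes the current position positive.\<close>
  proof (rule LIMSEQ_le_const[OF avg_bounded_pen_tendsto[of "Suc (Suc L)" "int k"]], intro exI allI impI)
    fix n assume n: "n \<ge> Suc L"
    have "?N \<subseteq> {\<omega> \<in> paths. hist n \<omega> \<in> {g. count_list g 0 < Suc (Suc L) \<and> mx g \<le> int k \<and> hd g > 0}}"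
    proof
      fix \<omega> assume \<omega>: "\<omega> \<in> ?N"
      then have "count_list (hist (L + (n - L)) \<omega>) 0 \<le> count_list (hist L \<omega>) 0"
        unfolding count_hist_le_iff by (auto simp: less_imp_neq[symmetric])
      also have "\<dots> \<le> Suc L" using count_le_length[of "hist L \<omega>" 0] by simp
      finally have "count_list (hist n \<omega>) 0 < Suc (Suc L)" using n by simp
      moreover have "mx (hist n \<omega>) \<le> int k" using \<omega> by (auto simp: mx_def set_hist)
      ultimately show "\<omega> \<in> {\<omega> \<in> paths. hist n \<omega> \<in> {g. count_list g 0 < Suc (Suc L) \<and> mx g \<le> int k \<and> hd g > 0}}"
        using \<omega> n by simp
    qed
    then have "prob ?N \<le> prob {\<omega> \<in> paths. hist n \<omega> \<in> {g. count_list g 0 < Suc (Suc L) \<and> mx g \<le> int k \<and> hd g > 0}}"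
      by (rule finite_measure_mono[OF _ sets_hist])
    then show "prob ?N \<le> avg n [0] (\<lambda>g. of_bool (count_list g 0 < Suc (Suc L) \<and> mx g \<le> int k \<and> hd g > 0) * pen g)"
      unfolding prob_hist by simp
  qed
  then have "?N \<in> null_sets Q" using N measure_le_0_iff by (auto simp: null_sets_def emeasure_eq_measure simp del: space_Q)
  then have "AE \<omega> in Q. \<omega> \<notin> ?N" by (rule AE_not_in)
  then show "AE \<omega> in Q. (\<omega> L = 0 \<and> (\<forall>i>L. \<omega> i > 0)) \<longrightarrow> (\<exists>i. \<omega> i > int k)"
    using AE_space by eventually_elim (auto simp: not_le)
qed

text \<open>The first step after the last zero fixes the sign for ever. A positive end makes the
  path unbounded; a negative end adds nothing to a maximum that is already nonnegative.\<close>

lemma AE_Sinf: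
  "AE \<omega> in Q. (after \<omega> 0 = 1 \<and> Sinf \<omega> = \<infinity>) \<or>
    (after \<omega> 0 = -1 \<and> Sinf \<omega> = ereal (real_of_int (mx (hist (last_zero_time \<omega>) \<omega>))))"
  using AE_last_zero AE_unbounded AE_space
proof eventually_elim
  case (elim \<omega>)
  define L where "L = last_zero_time \<omega>"
  have \<omega>: "\<omega> \<in> paths" "last_zero_at L \<omega>" "reach (hist L \<omega>)" using elim by (auto simp: L_def)
  note path = after_path[OF \<omega>(1), unfolded L_def[symmetric], OF \<omega>(2)]
  have after: "after \<omega> (i - Suc L) = \<omega> i" if "i > L" for i
    using that by (simp add: after_def L_def[symmetric])
  note sign = after_sign[OF \<omega>(1), unfolded L_def[symmetric], OF \<omega>(2)]
  consider "after \<omega> 0 = 1" | "after \<omega> 0 = -1" using path(3) by linarith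
  then show ?case
  proof cases
    case 1
    have "\<omega> i > 0" if "i > L" for i
      using sign[of 1 "i - Suc L"] after[OF that] 1 by simp
    then have "\<exists>i. \<omega> i > int k" for k using elim(2) \<omega>(2) by (auto simp: last_zero_at_def)
    then have "\<exists>i\<in>UNIV. ereal (real k) \<le> ereal (real_of_int (\<omega> i))" for k
      by (metis UNIV_I ereal_less_eq(3) less_imp_le of_int_le_iff of_int_of_nat_eq)
    then have "Sinf \<omega> = \<infinity>" unfolding Sinf_def by (rule SUP_PInfty)
    then show ?thesis using 1 by simp
  next
    case 2
    have neg: "\<omega> i < 0" if "i > L" for i
      using sign[of "-1" "i - Suc L"] after[OF that] 2 by simp
    have "mx (hist L \<omega>) \<in> \<omega> ` {0..L}" unfolding mx_def set_hist by (rule Max_in) auto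
    then obtain j where j: "mx (hist L \<omega>) = \<omega> j" by auto
    have "Sinf \<omega> = ereal (real_of_int (mx (hist L \<omega>)))"
      unfolding Sinf_def
    proof (rule SUP_eqI)
      fix i :: nat
      have "\<omega> i \<le> mx (hist L \<omega>)"
      proof (cases "i \<le> L")
        case True
        then show ?thesis by (auto simp: mx_def set_hist)
      next
        case False
        then show ?thesis using neg[of i] mx_nonneg[OF \<omega>(3)] by simp
      qed
      then show "ereal (real_of_int (\<omega> i)) \<le> ereal (real_of_int (mx (hist L \<omega>)))" by simp
    next
      fix y assume "\<And>i. i \<in> UNIV \<Longrightarrow> ereal (real_of_int (\<omega> i)) \<le> y"
      then show "ereal (real_of_int (mx (hist L \<omega>))) \<le> y" unfolding j by simp
    qed
    then show ?thesis using 2 by (simp add: L_def)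
  qed
qed

lemma measurable_Sinf [measurable]: "Sinf \<in> borel_measurable Q"
  unfolding Sinf_def[abs_def] by measurable

lemma prob_Sinf_infinite: "\<P>(\<omega> in Q. Sinf \<omega> = \<infinity>) = 1/2"
proof -
  have "\<P>(\<omega> in Q. Sinf \<omega> = \<infinity>) = \<P>(\<omega> in Q. after \<omega> 0 = 1)"
  proof (rule finite_measure_eq_AE)
    show "AE \<omega> in Q. (\<omega> \<in> {\<omega> \<in> space Q. Sinf \<omega> = \<infinity>}) = (\<omega> \<in> {\<omega> \<in> space Q. after \<omega> 0 = 1})"
      using AE_Sinf by eventually_elim auto
  qed measurable
  then show ?thesis using prob_after_start[of 1] by simp
qed

text \<open>The supremum is finite exactly when the final part is negative, and then it equals the
  maximum at the last zero, which is independent of that sign.\<close>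

lemma cond_prob_Sinf: "cond_prob Q (\<lambda>\<omega>. Sinf \<omega> = ereal (real k)) (\<lambda>\<omega>. Sinf \<omega> < \<infinity>) = \<phi> k"
proof -
  have "\<P>(\<omega> in Q. Sinf \<omega> < \<infinity>) = \<P>(\<omega> in Q. after \<omega> 0 = -1)"
  proof (rule finite_measure_eq_AE)
    show "AE \<omega> in Q. (\<omega> \<in> {\<omega> \<in> space Q. Sinf \<omega> < \<infinity>}) = (\<omega> \<in> {\<omega> \<in> space Q. after \<omega> 0 = -1})"
      using AE_Sinf by eventually_elim auto
  qed measurable
  then have 1: "\<P>(\<omega> in Q. Sinf \<omega> < \<infinity>) = 1/2" using prob_after_start[of "-1"] by simp
  have "\<P>(\<omega> in Q. Sinf \<omega> = ereal (real k) \<and> Sinf \<omega> < \<infinity>)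
    = \<P>(\<omega> in Q. hist (last_zero_time \<omega>) \<omega> \<in> {w. mx w = int k} \<and> hist 0 (after \<omega>) \<in> {[-1]})"
  proof (rule finite_measure_eq_AE)
    show "AE \<omega> in Q. (\<omega> \<in> {\<omega> \<in> space Q. Sinf \<omega> = ereal (real k) \<and> Sinf \<omega> < \<infinity>})
        = (\<omega> \<in> {\<omega> \<in> space Q. hist (last_zero_time \<omega>) \<omega> \<in> {w. mx w = int k} \<and> hist 0 (after \<omega>) \<in> {[-1]}})"
      using AE_Sinf
    proof eventually_elim
      case (elim \<omega>)
      have e: "real_of_int x = real k \<longleftrightarrow> x = int k" for x
        by (metis of_int_eq_iff of_int_of_nat_eq)
      from elim show ?case by (elim disjE conjE) (simp_all add: e)
    qed
    have "Sinf -` {ereal (real k)} \<inter> space Q \<in> sets Q" by (rule measurable_sets[OF measurable_Sinf]) simp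
    moreover have "Sinf -` {ereal (real k)} \<inter> space Q = {\<omega> \<in> space Q. Sinf \<omega> = ereal (real k) \<and> Sinf \<omega> < \<infinity>}"
      by auto
    ultimately show "{\<omega> \<in> space Q. Sinf \<omega> = ereal (real k) \<and> Sinf \<omega> < \<infinity>} \<in> sets Q" by (simp only:)
    show "{\<omega> \<in> space Q. hist (last_zero_time \<omega>) \<omega> \<in> {w. mx w = int k} \<and> hist 0 (after \<omega>) \<in> {[-1]}} \<in> sets Q"
      by (intro sets.sets_Collect_conj sets_last_hist sets_hist_after)
  qed
  also have "\<dots> = \<P>(\<omega> in Q. hist (last_zero_time \<omega>) \<omega> \<in> {w. mx w = int k}) * \<P>(\<omega> in Q. hist 0 (after \<omega>) \<in> {[-1]})"
    by (rule prob_last_hist_after_indep)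
  also have "\<dots> = \<phi> k * (1/2)"
    using prob_max[of k] prob_after_start[of "-1"] by (simp add: Smax_hist)
  finally show ?thesis unfolding cond_prob_def 1 by simp
qed

text \<open>Independence is known for finite histories of the path after the last zero. They give a
  generating pi-system, because \<open>hist m\<close> and \<open>hist n\<close> can both be read off
  from \<open>hist (m + n)\<close>.\<close>

lemma indep_before_after:
  "indep_elements Q (count_space UNIV) (\<lambda>\<omega>. path_upto (last_zero_time \<omega>) \<omega>)
    (\<Pi>\<^sub>M n\<in>(UNIV::nat set). count_space (UNIV::int set)) after"
proof -
  let ?Y = "\<lambda>\<omega>. path_upto (last_zero_time \<omega>) \<omega>"
  let ?C = "count_space UNIV :: int list measure"
  let ?PM = "\<Pi>\<^sub>M n\<in>(UNIV::nat set). count_space (UNIV::int set)"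
  let ?GA = "{?Y -` A \<inter> space Q | A. A \<in> sets ?C}"
  let ?GB = "{(\<lambda>\<omega>. hist n (after \<omega>)) -` B \<inter> space Q | n B. True}"
  have Y: "?Y \<in> Q \<rightarrow>\<^sub>M ?C" unfolding rev_hist by measurable
  have Z: "(\<lambda>\<omega> n. after \<omega> n) \<in> Q \<rightarrow>\<^sub>M ?PM" by (rule measurable_PiM_single') auto
  have "indep_set ?GA ?GB"
  proof (rule indep_setI)
    show "?GA \<subseteq> events" using measurable_sets[OF Y] by blast
    show "?GB \<subseteq> events"
    proof
      fix b assume "b \<in> ?GB"
      then obtain n B where "b = (\<lambda>\<omega>. hist n (after \<omega>)) -` B \<inter> space Q" by blast
      then show "b \<in> events" using measurable_sets[OF measurable_hist_after, of B n] by (simp only:) simp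
    qed
    fix a b assume "a \<in> ?GA" "b \<in> ?GB"
    then obtain A n B where ab: "a = ?Y -` A \<inter> space Q" "b = (\<lambda>\<omega>. hist n (after \<omega>)) -` B \<inter> space Q" by blast
    let ?A = "{w. rev w \<in> A}"
    have "a \<inter> b = {\<omega> \<in> space Q. hist (last_zero_time \<omega>) \<omega> \<in> ?A \<and> hist n (after \<omega>) \<in> B}"
      "a = {\<omega> \<in> space Q. hist (last_zero_time \<omega>) \<omega> \<in> ?A}" "b = {\<omega> \<in> space Q. hist n (after \<omega>) \<in> B}"
      by (auto simp: ab rev_hist)
    then show "prob (a \<inter> b) = prob a * prob b" by (simp only: prob_last_hist_after_indep)
  qed
  moreover have "Int_stable ?GA"
  proof (rule Int_stableI)
    fix a b assume "a \<in> ?GA" "b \<in> ?GA"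
    then obtain A B where "a = ?Y -` A \<inter> space Q" "b = ?Y -` B \<inter> space Q" by blast
    then have "a \<inter> b = ?Y -` (A \<inter> B) \<inter> space Q" by auto
    moreover have "A \<inter> B \<in> sets ?C" by simp
    ultimately show "a \<inter> b \<in> ?GA" by blast
  qed
  moreover have "Int_stable ?GB"
  proof (rule Int_stableI)
    fix a b assume "a \<in> ?GB" "b \<in> ?GB"
    then obtain m A n B where ab: "a = (\<lambda>\<omega>. hist m (after \<omega>)) -` A \<inter> space Q"
      "b = (\<lambda>\<omega>. hist n (after \<omega>)) -` B \<inter> space Q" by blast
    have "a \<inter> b = (\<lambda>\<omega>. hist (m + n) (after \<omega>)) -` {h. drop n h \<in> A \<and> drop m h \<in> B} \<inter> space Q"
      using drop_hist[of n m] drop_hist[of m n] by (auto simp: ab add.commute)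
    then show "a \<inter> b \<in> ?GB" by blast
  qed
  ultimately have ind: "indep_set (sigma_sets (space Q) ?GA) (sigma_sets (space Q) ?GB)"
    by (rule indep_set_sigma_sets)
  let ?M = "sigma (space Q) ?GB"
  have sM: "sets ?M = sigma_sets (space Q) ?GB" by (rule sets_measure_of) auto
  have spM: "space ?M = space Q" by (rule space_measure_of) auto
  have "(\<lambda>\<omega>. after \<omega> n) \<in> ?M \<rightarrow>\<^sub>M count_space UNIV" for n
  proof (rule measurableI)
    fix A :: "int set"
    have "(\<lambda>\<omega>. after \<omega> n) -` A \<inter> space ?M = (\<lambda>\<omega>. hist n (after \<omega>)) -` {h. hd h \<in> A} \<inter> space Q"
      unfolding spM by auto
    also have "\<dots> \<in> sigma_sets (space Q) ?GB" by (rule sigma_sets.Basic) blast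
    finally show "(\<lambda>\<omega>. after \<omega> n) -` A \<inter> space ?M \<in> sets ?M" unfolding sM .
  qed auto
  then have "(\<lambda>\<omega> n. after \<omega> n) \<in> ?M \<rightarrow>\<^sub>M ?PM" by (intro measurable_PiM_single') auto
  then have "{(\<lambda>\<omega> n. after \<omega> n) -` A \<inter> space Q | A. A \<in> sets ?PM} \<subseteq> sigma_sets (space Q) ?GB"
    using measurable_sets[of _ ?M ?PM] unfolding sM spM by blast
  then have VZ: "sets (vimage_algebra (space Q) after ?PM) \<subseteq> sigma_sets (space Q) ?GB"
    unfolding sets_vimage_algebra by (intro sigma_sets_mono) simp
  have VY: "sets (vimage_algebra (space Q) ?Y ?C) = sigma_sets (space Q) ?GA"
    unfolding sets_vimage_algebra ..
  have "indep_set (sets (vimage_algebra (space Q) ?Y ?C)) (sets (vimage_algebra (space Q) after ?PM))"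
  proof (rule indep_setI)
    show "sets (vimage_algebra (space Q) ?Y ?C) \<subseteq> events" unfolding VY using indep_setD_ev1[OF ind] .
    show "sets (vimage_algebra (space Q) after ?PM) \<subseteq> events" using indep_setD_ev2[OF ind] VZ by blast
    show "prob (a \<inter> b) = prob a * prob b"
      if "a \<in> sets (vimage_algebra (space Q) ?Y ?C)" "b \<in> sets (vimage_algebra (space Q) after ?PM)" for a b
      using indep_setD[OF ind, of a b] that VZ unfolding VY by (meson subsetD)
  qed
  then show ?thesis unfolding indep_elements_def using Y Z by simp
qed

end

section \<open>The walk stopped at \<open>tau\<close> and the conditional law before the last
  zero\<close>

lemma tau_Least:
  "tau a \<omega> = (if \<exists>n. zeros n \<omega> = a then enat (LEAST n. zeros n \<omega> = a) else \<infinity>)"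
proof (cases "\<exists>n. zeros n \<omega> = a")
  case True
  then have "zeros (LEAST n. zeros n \<omega> = a) \<omega> = a" by (rule LeastI_ex)
  then have "tau a \<omega> = enat (LEAST n. zeros n \<omega> = a)"
    unfolding tau_def by (intro INF_eqI) (auto intro: Least_le)
  then show ?thesis using True by simp
next
  case False
  then have "{n. zeros n \<omega> = a} = {}" by auto
  then show ?thesis using False by (simp add: tau_def top_enat_def)
qed

lemma (in weighted_law) measurable_tau_hist: "(\<lambda>\<omega>. hist (the_enat (tau a \<omega>)) \<omega>) \<in> Q \<rightarrow>\<^sub>M count_space UNIV"
proof -
  have "(\<lambda>\<omega>. the_enat (tau a \<omega>)) \<in> Q \<rightarrow>\<^sub>M count_space UNIV"
    unfolding tau_Least zeros_hist if_distrib[of the_enat] by measurable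
  from measurable_compose_countable[OF measurable_hist_Q this] show ?thesis .
qed

lemma AE_hits_iff:
  assumes "a \<ge> 1" "B \<subseteq> zero_hist a"
  shows "AE \<omega> in walk. \<omega> \<in> hits B \<longleftrightarrow> hist (the_enat (tau a \<omega>)) \<omega> \<in> B"
  using AE_hits[OF assms(1)]
proof eventually_elim
  case (elim \<omega>)
  then obtain L where L: "\<omega> \<in> paths" "hist L \<omega> \<in> zero_hist a" by (auto simp: hits_def)
  then have t: "the_enat (tau a \<omega>) = L" by (simp add: tau_eq)
  have "hist n \<omega> \<in> B \<Longrightarrow> n = L" for n using zero_hist_unique[OF _ L(2)] assms(2) by auto
  then show ?case using L t by (auto simp: hits_def)
qed

context penalised
begin

text \<open>Both conditional laws give a set \<open>C\<close> of histories a probability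
  proportional to that of \<open>hits (zero_max a k \<inter> C)\<close> under the walk. On the side
  of Q the factor \<phi> k / 2 stands in numerator and denominator and cancels.\<close>

lemma law_before_last_zero:
  assumes "\<P>(\<omega> in Q. zeros (last_zero_time \<omega>) \<omega> = a \<and> Smax (last_zero_time \<omega>) \<omega> = b) > 0"
  shows "distr (uniform_measure Q {\<omega> \<in> space Q. zeros (last_zero_time \<omega>) \<omega> = a \<and> Smax (last_zero_time \<omega>) \<omega> = b})
      (count_space UNIV) (\<lambda>\<omega>. path_upto (last_zero_time \<omega>) \<omega>)
    = distr (uniform_measure walk {\<omega> \<in> space walk. Smax (the_enat (tau a \<omega>)) \<omega> = b})
      (count_space UNIV) (\<lambda>\<omega>. path_upto (the_enat (tau a \<omega>)) \<omega>)"
proof -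
  let ?B = "{w. count_list w 0 = a \<and> mx w = b}"
  define H where "H \<omega> = hist (last_zero_time \<omega>) \<omega>" for \<omega>
  define T where "T \<omega> = hist (the_enat (tau a \<omega>)) \<omega>" for \<omega>
  have mH: "H \<in> Q \<rightarrow>\<^sub>M count_space UNIV" unfolding H_def[abs_def] by measurable
  have mT: "T \<in> walk \<rightarrow>\<^sub>M count_space UNIV" unfolding T_def[abs_def] by (rule walk.measurable_tau_hist)
  have sH: "{\<omega> \<in> space Q. H \<omega> \<in> B} \<in> sets Q" for B
    using measurable_sets[OF mH, of B] by (simp add: vimage_def Int_def conj_commute)
  have sT: "{\<omega> \<in> space walk. T \<omega> \<in> B} \<in> sets walk" for B
    using measurable_sets[OF mT, of B] by (simp add: vimage_def Int_def conj_commute)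
  have A: "{\<omega> \<in> space Q. zeros (last_zero_time \<omega>) \<omega> = a \<and> Smax (last_zero_time \<omega>) \<omega> = b} = {\<omega> \<in> space Q. H \<omega> \<in> ?B}"
    by (simp add: zeros_hist Smax_hist H_def)
  have A': "{\<omega> \<in> space walk. Smax (the_enat (tau a \<omega>)) \<omega> = b} = {\<omega> \<in> space walk. T \<omega> \<in> {w. mx w = b}}"
    by (simp add: Smax_hist T_def)
  have "\<not> (AE \<omega> in Q. \<not> (count_list (H \<omega>) 0 = a \<and> mx (H \<omega>) = b))"
  proof
    assume "AE \<omega> in Q. \<not> (count_list (H \<omega>) 0 = a \<and> mx (H \<omega>) = b)"
    then have "prob {\<omega> \<in> space Q. H \<omega> \<in> ?B} = 0" using sH[of ?B] by (subst prob_eq_0) auto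
    then show False using assms unfolding A by simp
  qed
  \<comment> \<open>At the last zero the history has at least one zero and a nonnegative maximum, so
    positivity of the conditioning event rules out a = 0 and b < 0.\<close>
  moreover have "AE \<omega> in Q. \<not> (count_list (H \<omega>) 0 = a \<and> mx (H \<omega>) = b)" if "a = 0 \<or> b < 0"
    using AE_last_zero
  proof eventually_elim
    case (elim \<omega>)
    then have "count_list (H \<omega>) 0 \<ge> 1" "mx (H \<omega>) \<ge> 0"
      using reach_count_zeros[of "H \<omega>"] mx_nonneg[of "H \<omega>"] by (simp_all add: H_def)
    then show ?case using that by auto
  qed
  ultimately have a: "a \<ge> 1" and b: "b \<ge> 0" by (auto simp: not_less Suc_le_eq not_le)
  define k where "k = nat b"
  have bk: "b = int k" using b by (simp add: k_def)
  have H: "prob {\<omega> \<in> space Q. H \<omega> \<in> ?B \<and> H \<omega> \<in> C} = \<phi> k / 2 * measure walk (hits (zero_max a k \<inter> C))" for C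
  proof -
    have "prob {\<omega> \<in> space Q. H \<omega> \<in> ?B \<inter> C} = prob (ends (zero_max a k \<inter> C))"
    proof (rule finite_measure_eq_AE[OF _ sH sets_ends])
      show "AE \<omega> in Q. (\<omega> \<in> {\<omega> \<in> space Q. H \<omega> \<in> ?B \<inter> C}) = (\<omega> \<in> ends (zero_max a k \<inter> C))"
        using AE_last_zero AE_ends_iff[of "zero_max a k \<inter> C"] AE_space
        by eventually_elim (auto simp: zero_max_def zero_hist_def H_def bk)
    qed
    also have "\<dots> = \<phi> k / 2 * measure walk (hits (zero_max a k \<inter> C))"
      by (rule prob_ends) (auto simp: zero_max_def)
    finally show ?thesis by simp
  qed
  have T: "measure walk {\<omega> \<in> space walk. T \<omega> \<in> {w. mx w = b} \<and> T \<omega> \<in> C} = measure walk (hits (zero_max a k \<inter> C))" for C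
  proof -
    have "measure walk {\<omega> \<in> space walk. T \<omega> \<in> {w. mx w = b} \<inter> C} = measure walk (hits (zero_max a k \<inter> C))"
    proof (rule walk.finite_measure_eq_AE[OF _ sT walk.sets_hits])
      have "zero_max a k \<inter> C \<subseteq> zero_hist a" by (auto simp: zero_max_def)
      from AE_hits_iff[OF a this] AE_hits[OF a] AE_hits_iff[OF a order_refl] AE_space
      show "AE \<omega> in walk. (\<omega> \<in> {\<omega> \<in> space walk. T \<omega> \<in> {w. mx w = b} \<inter> C}) = (\<omega> \<in> hits (zero_max a k \<inter> C))"
        by eventually_elim (auto simp: zero_max_def T_def bk)
    qed
    then show ?thesis by simp
  qed
  let ?p = "measure walk (hits (zero_max a k))"
  have pA: "prob {\<omega> \<in> space Q. H \<omega> \<in> ?B} = \<phi> k / 2 * ?p" using H[of UNIV] by simp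
  have pA': "measure walk {\<omega> \<in> space walk. T \<omega> \<in> {w. mx w = b}} = ?p" using T[of UNIV] by simp
  have pos: "\<phi> k / 2 * ?p > 0" using assms unfolding A pA .
  then have pos': "\<phi> k > 0" "?p > 0" using \<phi>_nonneg[of k] measure_nonneg[of walk "hits (zero_max a k)"]
    by (auto simp: zero_less_mult_iff)
  let ?R = "uniform_measure Q {\<omega> \<in> space Q. H \<omega> \<in> ?B}" and ?R' = "uniform_measure walk {\<omega> \<in> space walk. T \<omega> \<in> {w. mx w = b}}"
  have e: "emeasure Q {\<omega> \<in> space Q. H \<omega> \<in> ?B} \<noteq> 0" "emeasure Q {\<omega> \<in> space Q. H \<omega> \<in> ?B} \<noteq> \<infinity>"
    using pos unfolding emeasure_eq_measure pA by auto
  have e': "emeasure walk {\<omega> \<in> space walk. T \<omega> \<in> {w. mx w = b}} \<noteq> 0" "emeasure walk {\<omega> \<in> space walk. T \<omega> \<in> {w. mx w = b}} \<noteq> \<infinity>"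
    using pos'(2) unfolding walk.emeasure_eq_measure pA' by auto
  interpret R: prob_space ?R by (rule prob_space_uniform_measure[OF e])
  interpret R': prob_space ?R' by (rule prob_space_uniform_measure[OF e'])
  have mR: "(\<lambda>\<omega>. rev (H \<omega>)) \<in> ?R \<rightarrow>\<^sub>M count_space UNIV"
    unfolding measurable_cong_sets[OF sets_uniform_measure refl] by (rule measurable_compose[OF mH]) simp
  have mR': "(\<lambda>\<omega>. rev (T \<omega>)) \<in> ?R' \<rightarrow>\<^sub>M count_space UNIV"
    unfolding measurable_cong_sets[OF sets_uniform_measure refl] by (rule measurable_compose[OF mT]) simp
  have "distr ?R (count_space UNIV) (\<lambda>\<omega>. rev (H \<omega>)) = distr ?R' (count_space UNIV) (\<lambda>\<omega>. rev (T \<omega>))"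
  proof (rule measure_eqI_countable[where A = UNIV])
    fix l :: "int list"
    let ?C = "{rev l}"
    have "emeasure (distr ?R (count_space UNIV) (\<lambda>\<omega>. rev (H \<omega>))) {l} = emeasure ?R {\<omega> \<in> space Q. H \<omega> \<in> ?C}"
    proof -
      have "(\<lambda>\<omega>. rev (H \<omega>)) -` {l} \<inter> space ?R = {\<omega> \<in> space Q. H \<omega> \<in> ?C}"
        by (auto simp: rev_swap)
      then show ?thesis using emeasure_distr[OF mR, of "{l}"] by (simp only: sets_count_space Pow_UNIV UNIV_I)
    qed
    also have "measure ?R {\<omega> \<in> space Q. H \<omega> \<in> ?C} = prob {\<omega> \<in> space Q. H \<omega> \<in> ?B \<and> H \<omega> \<in> ?C} / prob {\<omega> \<in> space Q. H \<omega> \<in> ?B}"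
      unfolding measure_uniform_measure[OF e sH] by (auto intro!: arg_cong2[where f = "(/)"] arg_cong[where f = prob])
    then have "emeasure ?R {\<omega> \<in> space Q. H \<omega> \<in> ?C} = ennreal (measure walk (hits (zero_max a k \<inter> ?C)) / ?p)"
      unfolding R.emeasure_eq_measure H pA using pos' by simp
    finally have 1: "emeasure (distr ?R (count_space UNIV) (\<lambda>\<omega>. rev (H \<omega>))) {l} = ennreal (measure walk (hits (zero_max a k \<inter> ?C)) / ?p)" .
    have "emeasure (distr ?R' (count_space UNIV) (\<lambda>\<omega>. rev (T \<omega>))) {l} = emeasure ?R' {\<omega> \<in> space walk. T \<omega> \<in> ?C}"
    proof -
      have "(\<lambda>\<omega>. rev (T \<omega>)) -` {l} \<inter> space ?R' = {\<omega> \<in> space walk. T \<omega> \<in> ?C}"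
        by (auto simp: rev_swap)
      then show ?thesis using emeasure_distr[OF mR', of "{l}"] by (simp only: sets_count_space Pow_UNIV UNIV_I)
    qed
    also have "measure ?R' {\<omega> \<in> space walk. T \<omega> \<in> ?C}
        = measure walk {\<omega> \<in> space walk. T \<omega> \<in> {w. mx w = b} \<and> T \<omega> \<in> ?C} / measure walk {\<omega> \<in> space walk. T \<omega> \<in> {w. mx w = b}}"
      unfolding measure_uniform_measure[OF e' sT] by (auto intro!: arg_cong2[where f = "(/)"] arg_cong[where f = "measure walk"])
    then have "emeasure ?R' {\<omega> \<in> space walk. T \<omega> \<in> ?C} = ennreal (measure walk (hits (zero_max a k \<inter> ?C)) / ?p)"
      unfolding R'.emeasure_eq_measure T pA' by simp
    finally show "emeasure (distr ?R (count_space UNIV) (\<lambda>\<omega>. rev (H \<omega>))) {l} = emeasure (distr ?R' (count_space UNIV) (\<lambda>\<omega>. rev (T \<omega>))) {l}"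
      using 1 by simp
  qed auto
  then show ?thesis unfolding A A' by (simp only: rev_hist H_def T_def)
qed

end

section \<open>Penalisation and the martingale\<close>

context weight
begin

lemma penalisation_limit:
  assumes "\<Lambda> \<in> sets (Fil n)"
  shows "(\<lambda>p. (\<integral>\<omega>. indicator \<Lambda> \<omega> * \<phi> (nat (Smax (last_zero_upto p \<omega>) \<omega>)) \<partial>walk)
             / (\<integral>\<omega>. \<phi> (nat (Smax (last_zero_upto p \<omega>) \<omega>)) \<partial>walk))
        \<longlonglongrightarrow> (\<integral>\<omega>. indicator \<Lambda> \<omega> * Mart \<phi> n \<omega> \<partial>walk)"
proof -
  obtain B where B: "\<Lambda> = {\<omega> \<in> paths. hist n \<omega> \<in> B}" using assms by (auto simp: sets_Fil)
  let ?f = "\<lambda>g. \<phi> (nat (sg g))"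
  have den: "(\<integral>\<omega>. \<phi> (nat (Smax (last_zero_upto p \<omega>) \<omega>)) \<partial>walk) = avg p [0] ?f" for p
    using walk.integral_hist(2)[of ?f p] by (simp add: Smax_last_zero_hist)
  have num: "(\<integral>\<omega>. indicator \<Lambda> \<omega> * \<phi> (nat (Smax (last_zero_upto p \<omega>) \<omega>)) \<partial>walk)
      = avg n [0] (\<lambda>h. of_bool (h \<in> B) * avg (p - n) h ?f)" if "p \<ge> n" for p
  proof -
    have d: "drop (p - n) (hist p \<omega>) = hist n \<omega>" for \<omega> using drop_hist[of "p - n" n \<omega>] that by simp
    have "(\<integral>\<omega>. indicator \<Lambda> \<omega> * \<phi> (nat (Smax (last_zero_upto p \<omega>) \<omega>)) \<partial>walk)
      = (\<integral>\<omega>. of_bool (drop (p - n) (hist p \<omega>) \<in> B) * ?f (hist p \<omega>) \<partial>walk)"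
      unfolding d by (intro Bochner_Integration.integral_cong) (auto simp: Smax_last_zero_hist indicator_def B)
    also have "\<dots> = avg p [0] (\<lambda>h. of_bool (drop (p - n) h \<in> B) * ?f h)"
      using walk.integral_hist(2)[of "\<lambda>h. of_bool (drop (p - n) h \<in> B) * ?f h" p] by simp
    also have "\<dots> = avg n [0] (\<lambda>h. of_bool (h \<in> B) * avg (p - n) h ?f)"
      using avg_drop[of n "p - n" B ?f] that by simp
    finally show ?thesis .
  qed
  have rhs: "(\<integral>\<omega>. indicator \<Lambda> \<omega> * Mart \<phi> n \<omega> \<partial>walk) = avg n [0] (\<lambda>h. of_bool (h \<in> B) * pen h)"
  proof -
    have "(\<integral>\<omega>. indicator \<Lambda> \<omega> * Mart \<phi> n \<omega> \<partial>walk) = (\<integral>\<omega>. of_bool (hist n \<omega> \<in> B) * pen (hist n \<omega>) \<partial>walk)"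
      by (intro Bochner_Integration.integral_cong) (auto simp: Mart_hist indicator_def B)
    then show ?thesis using walk.integral_hist(2)[of "\<lambda>h. of_bool (h \<in> B) * pen h" n] by simp
  qed
  show ?thesis
    unfolding rhs den
  proof (rule Lim_transform_eventually[OF avg_weight_ratio_tendsto])
    show "\<forall>\<^sub>F p in sequentially. avg n [0] (\<lambda>h. of_bool (h \<in> B) * avg (p - n) h ?f) / avg p [0] ?f
        = (\<integral>\<omega>. indicator \<Lambda> \<omega> * \<phi> (nat (Smax (last_zero_upto p \<omega>) \<omega>)) \<partial>walk) / avg p [0] ?f"
      using eventually_ge_at_top[of n] by eventually_elim (simp only: num)
  qed
qed

lemma Mart_measurable: "Mart \<phi> n \<in> borel_measurable (Fil n)"
proof (rule measurableI)
  fix A :: "real set"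
  have "Mart \<phi> n -` A \<inter> space (Fil n) = {\<omega> \<in> paths. hist n \<omega> \<in> pen -` A}"
    by (auto simp: Mart_hist)
  then show "Mart \<phi> n -` A \<inter> space (Fil n) \<in> sets (Fil n)" unfolding sets_Fil by blast
qed auto

lemma Mart_martingale: "martingale walk Fil (Mart \<phi>)"
  unfolding martingale_def
proof (intro conjI allI impI)
  have Mart: "Mart \<phi> n = (\<lambda>\<omega>. pen (hist n \<omega>))" for n by (simp add: fun_eq_iff Mart_hist)
  show "filtration (space walk) Fil"
    by (simp add: filtration_def Fil_mono)
  show sub: "subalgebra walk (Fil n)" for n
    using sets_Fil_subset by (auto simp: subalgebra_def walk.sets_Q)
  show "Mart \<phi> n \<in> borel_measurable (Fil n)" for n by (rule Mart_measurable)
  show int: "integrable walk (Mart \<phi> n)" for n unfolding Mart by (rule walk.integral_hist(1))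
  fix m n :: nat assume mn: "m \<le> n"
  interpret F: finite_measure_subalgebra walk "Fil m" by unfold_locales (rule sub)
  show "AE \<omega> in walk. real_cond_exp walk (Fil m) (Mart \<phi> n) \<omega> = Mart \<phi> m \<omega>"
  proof (rule F.real_cond_exp_charact[OF _ int int Mart_measurable])
    fix A assume "A \<in> sets (Fil m)"
    then obtain B where B: "A = {\<omega> \<in> paths. hist m \<omega> \<in> B}" by (auto simp: sets_Fil)
    have set: "(LINT \<omega>:A|walk. Mart \<phi> q \<omega>) = avg m [0] (\<lambda>g. of_bool (g \<in> B) * pen g)" if "q \<ge> m" for q
    proof -
      have d: "drop (q - m) (hist q \<omega>) = hist m \<omega>" for \<omega> using drop_hist[of "q - m" m \<omega>] that by simp
      have "(LINT \<omega>:A|walk. Mart \<phi> q \<omega>) = (\<integral>\<omega>. of_bool (drop (q - m) (hist q \<omega>) \<in> B) * pen (hist q \<omega>) \<partial>walk)"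
        unfolding set_lebesgue_integral_def d
        by (intro Bochner_Integration.integral_cong) (auto simp: Mart indicator_def B)
      also have "\<dots> = avg q [0] (\<lambda>h. of_bool (drop (q - m) h \<in> B) * pen h)"
        using walk.integral_hist(2)[of "\<lambda>h. of_bool (drop (q - m) h \<in> B) * pen h" q] by simp
      also have "\<dots> = avg m [0] (\<lambda>g. of_bool (g \<in> B) * avg (q - m) g pen)"
        using avg_drop[of m "q - m" B pen] that by simp
      also have "\<dots> = avg m [0] (\<lambda>g. of_bool (g \<in> B) * pen g)"
        by (intro avg_cong) (auto simp: avg_pen)
      finally show ?thesis .
    qed
    show "(LINT \<omega>:A|walk. Mart \<phi> n \<omega>) = (LINT \<omega>:A|walk. Mart \<phi> m \<omega>)"
      using set[OF mn] set[OF order_refl] by simp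
  qed
qed

lemma Mart_AE_nonneg: "AE \<omega> in walk. Mart \<phi> n \<omega> \<ge> 0"
  using walk.AE_reachable[of n] by eventually_elim (simp add: Mart_hist pen_nonneg reachable_def)

text \<open>Under the penalised law there are finitely many zeros, an event of probability \<open>0\<close> for the
  walk; uniform integrability would make the penalised law absolutely continuous.\<close>

lemma Mart_not_uniformly_integrable: "\<not> uniformly_integrable walk (Mart \<phi>)"
proof
  assume UI: "uniformly_integrable walk (Mart \<phi>)"
  obtain Q where "weighted_law Q pen" using penalised_exists by blast
  then interpret Q: penalised \<phi> Q
    by (intro penalised.intro weight_axioms)
  let ?E = "\<lambda>a. {\<omega> \<in> paths. \<forall>n. count_list (hist n \<omega>) 0 < a}"
  have E: "?E a \<in> sets Q" for a
  proof -
    have "{\<omega> \<in> space Q. \<forall>n. count_list (hist n \<omega>) 0 < a} \<in> sets Q" by measurable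
    then show ?thesis by simp
  qed
  have "(\<lambda>a. Q.prob (?E a)) \<longlonglongrightarrow> Q.prob (\<Union>a. ?E a)"
  proof (rule Q.finite_Lim_measure_incseq)
    show "incseq ?E" unfolding incseq_def using less_le_trans by blast
  qed (use E in blast)
  moreover have "Q.prob (\<Union>a. ?E a) = 1"
  proof (subst Q.prob_eq_1)
    show "AE \<omega> in Q. \<omega> \<in> (\<Union>a. ?E a)"
      using Q.AE_last_zero AE_space
    proof eventually_elim
      case (elim \<omega>)
      define L where "L = last_zero_time \<omega>"
      have "count_list (hist n \<omega>) 0 \<le> count_list (hist L \<omega>) 0" for n
      proof (cases "n \<le> L")
        case False
        then show ?thesis using count_hist_le_iff[of L "n - L" \<omega>] elim by (simp add: L_def last_zero_at_def)
      qed (rule count_hist_mono)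
      then show ?case using elim by (auto simp: less_Suc_eq_le intro!: exI[of _ "Suc (count_list (hist L \<omega>) 0)"])
    qed
    show "(\<Union>a. ?E a) \<in> sets Q" using E by auto
  qed
  \<comment> \<open>Some bound on the number of zeros holds with Q-probability above 1/2; the
    contradiction will bound the same probability by 1/4 + 1/4.\<close>
  ultimately have "\<forall>\<^sub>F a in sequentially. Q.prob (?E a) > 1/2"
    by (intro order_tendstoD) auto
  then obtain a where a: "Q.prob (?E a) > 1/2" by (auto simp: eventually_sequentially)
  let ?z = "\<lambda>g::int list. of_bool (count_list g 0 < a) :: real"
  let ?S = "\<lambda>K. SUP n. \<integral>\<^sup>+\<omega>. ennreal \<bar>Mart \<phi> n \<omega>\<bar> * indicator {\<omega>. K \<le> \<bar>Mart \<phi> n \<omega>\<bar>} \<omega> \<partial>walk"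
  have "\<forall>\<^sub>F K in at_top. ?S K < ennreal (1/4)"
    using UI unfolding uniformly_integrable_def by (rule order_tendstoD) simp
  then have "\<forall>\<^sub>F K in at_top. ?S K < ennreal (1/4) \<and> K > 0"
    using eventually_gt_at_top[of 0] by (rule eventually_conj)
  from eventually_happens[OF this] obtain K where K: "?S K < ennreal (1/4)" "K > 0" by auto
  let ?h = "\<lambda>g. of_bool (K \<le> \<bar>pen g\<bar>) * \<bar>pen g\<bar>"
  have big: "avg n [0] ?h < 1/4" for n
  proof -
    have "(\<integral>\<^sup>+\<omega>. ennreal \<bar>Mart \<phi> n \<omega>\<bar> * indicator {\<omega>. K \<le> \<bar>Mart \<phi> n \<omega>\<bar>} \<omega> \<partial>walk) = (\<integral>\<^sup>+\<omega>. ennreal (?h (hist n \<omega>)) \<partial>walk)"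
      by (intro nn_integral_cong) (auto simp: Mart_hist indicator_def)
    also have "\<dots> = ennreal (\<integral>\<omega>. ?h (hist n \<omega>) \<partial>walk)"
      by (intro nn_integral_eq_integral walk.integral_hist(1)[of ?h]) auto
    also have "(\<integral>\<omega>. ?h (hist n \<omega>) \<partial>walk) = avg n [0] ?h"
      using walk.integral_hist(2)[of ?h n] by simp
    finally have e: "(\<integral>\<^sup>+\<omega>. ennreal \<bar>Mart \<phi> n \<omega>\<bar> * indicator {\<omega>. K \<le> \<bar>Mart \<phi> n \<omega>\<bar>} \<omega> \<partial>walk) = ennreal (avg n [0] ?h)" .
    have "ennreal (avg n [0] ?h) \<le> ?S K" unfolding e[symmetric] by (rule SUP_upper) simp
    then have "ennreal (avg n [0] ?h) < ennreal (1/4)" using K(1) by (rule le_less_trans)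
    moreover have "avg n [0] ?h \<ge> 0" by (rule avg_nonneg) auto
    ultimately show ?thesis by (simp add: ennreal_less_iff)
  qed
  have "(\<lambda>n. K * avg n [0] ?z) \<longlonglongrightarrow> K * 0"
    by (intro tendsto_mult tendsto_const avg_zeros_tendsto) simp
  then have "\<forall>\<^sub>F n in sequentially. K * avg n [0] ?z < 1/4" by (intro order_tendstoD) auto
  then obtain n where n: "K * avg n [0] ?z < 1/4" by (auto simp: eventually_sequentially)
  have "Q.prob (?E a) \<le> Q.prob {\<omega> \<in> paths. hist n \<omega> \<in> {g. count_list g 0 < a}}"
    by (rule Q.finite_measure_mono[OF _ Q.sets_hist]) auto
  also have "\<dots> = avg n [0] (\<lambda>g. ?z g * pen g)" unfolding Q.prob_hist by simp
  \<comment> \<open>Where \<open>pen g\<close> reaches K it is covered by the tail controlled by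
    uniform integrability, and elsewhere it is below K.\<close>
  also have "\<dots> \<le> avg n [0] (\<lambda>g. K * ?z g + ?h g)"
    using K(2) by (intro avg_mono) auto
  also have "\<dots> = K * avg n [0] ?z + avg n [0] ?h" by (simp only: avg_plus avg_cmult)
  also have "\<dots> < 1/2" using n big[of n] by simp
  finally show False using a by simp
qed

end

theorem theorem1p2:
  fixes \<phi> :: "nat \<Rightarrow> real"
  assumes "\<And>k. \<phi> k \<ge> 0"
    and "\<phi> sums 1"
    and "summable (\<lambda>k. real k * \<phi> k)"
  shows
    "(\<comment> \<open>1(a)\<close>
      \<forall>n. \<forall>\<Lambda>\<in>sets (Fil n).
        (\<lambda>p. (\<integral>\<omega>. indicator \<Lambda> \<omega> * \<phi> (nat (Smax (last_zero_upto p \<omega>) \<omega>)) \<partial>walk)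
             / (\<integral>\<omega>. \<phi> (nat (Smax (last_zero_upto p \<omega>) \<omega>)) \<partial>walk))
        \<longlonglongrightarrow> (\<integral>\<omega>. indicator \<Lambda> \<omega> * Mart \<phi> n \<omega> \<partial>walk))
     \<and> \<comment> \<open>1(b)\<close>
     (martingale walk Fil (Mart \<phi>)
      \<and> (\<forall>n. AE \<omega> in walk. Mart \<phi> n \<omega> \<ge> 0)
      \<and> \<not> uniformly_integrable walk (Mart \<phi>))
     \<and> \<comment> \<open>2: the measure \<open>Q\<close> is well defined\<close>
     (\<exists>!Q. is_penalised \<phi> Q)
     \<and>
     (\<forall>Q. is_penalised \<phi> Q \<longrightarrow>
        \<comment> \<open>2(a)\<close>
        \<P>(\<omega> in Q. 0 \<le> last_zero \<omega> \<and> last_zero \<omega> < \<infinity>) = 1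
        \<and> \<comment> \<open>2(b)\<close>
        \<P>(\<omega> in Q. Sinf \<omega> = \<infinity>) = 1/2
        \<and> (\<forall>k::nat. cond_prob Q (\<lambda>\<omega>. Sinf \<omega> = ereal (real k)) (\<lambda>\<omega>. Sinf \<omega> < \<infinity>) = \<phi> k)
        \<and> \<comment> \<open>2(c)\<close>
        (\<forall>a k::nat. a \<ge> 1 \<longrightarrow>
           \<P>(\<omega> in Q. zeros (last_zero_time \<omega>) \<omega> = a \<and> Smax (last_zero_time \<omega>) \<omega> = int k)
           = (if k = 0 then (1/2) ^ a * \<phi> 0
              else 1/2 * ((1 - 1 / (2 * (real k + 1))) ^ (a - 1)
                          - (1 - 1 / (2 * real k)) ^ (a - 1)) * \<phi> k))
        \<and> (\<forall>k::nat. \<P>(\<omega> in Q. Smax (last_zero_time \<omega>) \<omega> = int k) = \<phi> k)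
        \<and> \<comment> \<open>3(a)\<close>
        indep_elements Q
          (count_space UNIV) (\<lambda>\<omega>. path_upto (last_zero_time \<omega>) \<omega>)
          (\<Pi>\<^sub>M n\<in>(UNIV::nat set). count_space (UNIV::int set))
          (\<lambda>\<omega> n. \<omega> (last_zero_time \<omega> + 1 + n))
        \<and> \<comment> \<open>3(b)\<close>
        \<P>(\<omega> in Q. \<omega> (last_zero_time \<omega> + 1) = 1) = 1/2
        \<and> \<P>(\<omega> in Q. \<omega> (last_zero_time \<omega> + 1) = -1) = 1/2
        \<and> bessel_star_walk_from_1
            (uniform_measure Q {\<omega> \<in> space Q. \<omega> (last_zero_time \<omega> + 1) = 1})
            (\<lambda>n \<omega>. \<omega> (last_zero_time \<omega> + 1 + n))
        \<and> bessel_star_walk_from_1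
            (uniform_measure Q {\<omega> \<in> space Q. \<omega> (last_zero_time \<omega> + 1) = -1})
            (\<lambda>n \<omega>. - \<omega> (last_zero_time \<omega> + 1 + n))
        \<and> \<comment> \<open>3(c)\<close>
        (\<forall>(a::nat) (b::int).
           \<P>(\<omega> in Q. zeros (last_zero_time \<omega>) \<omega> = a \<and> Smax (last_zero_time \<omega>) \<omega> = b) > 0 \<longrightarrow>
           distr
             (uniform_measure Q {\<omega> \<in> space Q. zeros (last_zero_time \<omega>) \<omega> = a
                                             \<and> Smax (last_zero_time \<omega>) \<omega> = b})
             (count_space UNIV) (\<lambda>\<omega>. path_upto (last_zero_time \<omega>) \<omega>)
           = distr
               (uniform_measure walk {\<omega> \<in> space walk. Smax (the_enat (tau a \<omega>)) \<omega> = b})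
               (count_space UNIV) (\<lambda>\<omega>. path_upto (the_enat (tau a \<omega>)) \<omega>)))"
proof -
  interpret weight \<phi> by (rule weight.intro) (rule assms)+
  show ?thesis
  proof (intro conjI allI impI)
    show "\<forall>\<Lambda>\<in>sets (Fil n).
        (\<lambda>p. (\<integral>\<omega>. indicator \<Lambda> \<omega> * \<phi> (nat (Smax (last_zero_upto p \<omega>) \<omega>)) \<partial>walk)
             / (\<integral>\<omega>. \<phi> (nat (Smax (last_zero_upto p \<omega>) \<omega>)) \<partial>walk))
        \<longlonglongrightarrow> (\<integral>\<omega>. indicator \<Lambda> \<omega> * Mart \<phi> n \<omega> \<partial>walk)" for n
      using penalisation_limit by blast
    show "martingale walk Fil (Mart \<phi>)" by (rule Mart_martingale)
    show "AE \<omega> in walk. Mart \<phi> n \<omega> \<ge> 0" for n by (rule Mart_AE_nonneg)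
    show "\<not> uniformly_integrable walk (Mart \<phi>)" by (rule Mart_not_uniformly_integrable)
    show "\<exists>!Q. is_penalised \<phi> Q"
      unfolding is_penalised_iff using penalised_exists penalised_unique by blast
  next
    fix Q assume "is_penalised \<phi> Q"
    then interpret Q: penalised \<phi> Q
      by (intro penalised.intro weight_axioms) (simp add: is_penalised_iff)
    show "\<P>(\<omega> in Q. 0 \<le> last_zero \<omega> \<and> last_zero \<omega> < \<infinity>) = 1"
      by (rule Q.prob_finite_last_zero)
    show "\<P>(\<omega> in Q. Sinf \<omega> = \<infinity>) = 1/2"
      by (rule Q.prob_Sinf_infinite)
    show "cond_prob Q (\<lambda>\<omega>. Sinf \<omega> = ereal (real k)) (\<lambda>\<omega>. Sinf \<omega> < \<infinity>) = \<phi> k" for k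
      by (rule Q.cond_prob_Sinf)
    show "\<P>(\<omega> in Q. zeros (last_zero_time \<omega>) \<omega> = a \<and> Smax (last_zero_time \<omega>) \<omega> = int k)
           = (if k = 0 then (1/2) ^ a * \<phi> 0
              else 1/2 * ((1 - 1 / (2 * (real k + 1))) ^ (a - 1)
                          - (1 - 1 / (2 * real k)) ^ (a - 1)) * \<phi> k)" if "a \<ge> 1" for a k
      using Q.prob_zeros_max[OF that] unfolding Q.endp_def .
    show "\<P>(\<omega> in Q. Smax (last_zero_time \<omega>) \<omega> = int k) = \<phi> k" for k
      by (rule Q.prob_max)
    show "indep_elements Q (count_space UNIV) (\<lambda>\<omega>. path_upto (last_zero_time \<omega>) \<omega>)
          (\<Pi>\<^sub>M n\<in>(UNIV::nat set). count_space (UNIV::int set)) (\<lambda>\<omega> n. \<omega> (last_zero_time \<omega> + 1 + n))"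
      using Q.indep_before_after unfolding after_def[abs_def] .
    show "\<P>(\<omega> in Q. \<omega> (last_zero_time \<omega> + 1) = 1) = 1/2"
      using Q.prob_after_start[of 1] by (simp add: after_def)
    show "\<P>(\<omega> in Q. \<omega> (last_zero_time \<omega> + 1) = -1) = 1/2"
      using Q.prob_after_start[of "-1"] by (simp add: after_def)
    show "bessel_star_walk_from_1 (uniform_measure Q {\<omega> \<in> space Q. \<omega> (last_zero_time \<omega> + 1) = 1})
            (\<lambda>n \<omega>. \<omega> (last_zero_time \<omega> + 1 + n))"
      using Q.bessel_after[of 1] by (simp add: after_def)
    show "bessel_star_walk_from_1 (uniform_measure Q {\<omega> \<in> space Q. \<omega> (last_zero_time \<omega> + 1) = -1})
            (\<lambda>n \<omega>. - \<omega> (last_zero_time \<omega> + 1 + n))"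
      using Q.bessel_after[of "-1"] by (simp add: after_def)
    show "distr (uniform_measure Q {\<omega> \<in> space Q. zeros (last_zero_time \<omega>) \<omega> = a \<and> Smax (last_zero_time \<omega>) \<omega> = b})
          (count_space UNIV) (\<lambda>\<omega>. path_upto (last_zero_time \<omega>) \<omega>)
        = distr (uniform_measure walk {\<omega> \<in> space walk. Smax (the_enat (tau a \<omega>)) \<omega> = b})
          (count_space UNIV) (\<lambda>\<omega>. path_upto (the_enat (tau a \<omega>)) \<omega>)"
      if "\<P>(\<omega> in Q. zeros (last_zero_time \<omega>) \<omega> = a \<and> Smax (last_zero_time \<omega>) \<omega> = b) > 0" for a b
      using that by (rule Q.law_before_last_zero)
  qed
qed

end
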